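(* Let $\alpha\in(0,2)$, let $S\subset\mathbb{R}^d$ be Borel measurable, let $\dot W^\alpha$ be a symmetric $\alpha$-stable Lévy white noise on $S$, and let $\mathcal{L}$ be a partial differential operator on $\mathbb{R}^d$ with a fixed fundamental solution $\rho$. Assume that for any $t\in\mathbb{R}^d$, $\rho(t-\cdot)\in L^\alpha(S)$. Let $u_{\text{mild}}$ be a jointly measurable version of the mild solution $u_{\text{mild}}(t)=\langle \dot W^\alpha,\rho(t-\cdot)\rangle$, $t\in\mathbb{R}^d$, of $\mathcal{L}u=\dot W^\alpha$, and let $u_{\text{gen}}$ be the generalized solution, $\langle u_{\text{gen}},\varphi\rangle=\langle\dot W^\alpha,\varphi*\check\rho\rangle$, $\varphi\in\mathcal{D}(\mathbb{R}^d)$. For $\varphi\in\mathcal{D}(\mathbb{R}^d)$ let $\mu_\varphi(\mathrm{d}t)=|\varphi(t)|\,\mathrm{d}t$. (i) If $\alpha>1$ and for any $\varphi\in\mathcal{D}(\mathbb{R}^d)$, $$\int_{\mathbb{R}^d}\left(\int_S|\rho(t-s)|^\alpha\,\mathrm{d}s\right)^{1/\alpha}\mu_\varphi(\mathrm{d}t)<+\infty,$$ then $u_{\text{mild}}=u_{\text{gen}}$ in the sense of generalized stochastic processes. (ii) If $\alpha=1$ and for any $\varphi\in\mathcal{D}(\mathbb{R}^d)$, $$\int_{\mathbb{R}^d}\mu_\varphi(\mathrm{d}t)\int_S\mathrm{d}s\,|\rho(t-s)|\left[1+\log_+\left(\frac{|\rho(t-s)|\int_{\mathbb{R}^d}\mu_\varphi(\mathrm{d}r)\int_S\mathrm{d}v\,|\rho(r-v)|}{\left(\int_S|\rho(t-v)|\,\mathrm{d}v\right)\left(\int_{\mathbb{R}^d}|\rho(r-s)|\,\mu_\varphi(\mathrm{d}r)\right)}\right)\right]<+\infty,$$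 then $u_{\text{mild}}=u_{\text{gen}}$ in the sense of generalized stochastic processes. (iii) If $\alpha<1$ and for any $\varphi\in\mathcal{D}(\mathbb{R}^d)$, $$\int_S\left(\int_{\mathbb{R}^d}|\rho(t-s)|\,\mu_\varphi(\mathrm{d}t)\right)^\alpha\mathrm{d}s<+\infty,$$ then $u_{\text{mild}}=u_{\text{gen}}$ in the sense of generalized stochastic processes.
   Context: $\mathcal{D}(\mathbb{R}^d)$ is the space of (real-valued) $C^\infty$ compactly supported functions and $\mathcal{D}'(\mathbb{R}^d)$ the space of Schwartz distributions. A fundamental solution of $\mathcal{L}$ is a distribution $\rho\in\mathcal{D}'(\mathbb{R}^d)$ with $\mathcal{L}\rho=\delta_0$ in $\mathcal{D}'(\mathbb{R}^d)$; one choice of $\rho$ is fixed. For $\varphi\in\mathcal{D}(\mathbb{R}^d)$, $\check\varphi(t)=\varphi(-t)$, $\langle\check\rho,\varphi\rangle=\langle\rho,\check\varphi\rangle$, and $(\varphi*\check\rho)(s)=\langle\check\rho,\varphi(s-\cdot)\rangle=\langle\rho,\varphi(s+\cdot)\rangle$, a $C^\infty$ function of $s$ (restricted to $S$ when integrated against the noise). Write $\log_+=\max(\log,0)$. The statement "$\rho(t-\cdot)\in L^\alpha(S)$ for any $t$" presupposes that the distribution $\rho$ is represented by a (Borel measurable, locally integrable) function, still denoted $\rho$; then $(\varphi*\check\rho)(s)=\int_{\mathbb{R}^d}\rho(t-s)\varphi(t)\,\mathrm{d}t$. For $\alpha\in(0,2)$, $L^\alpha(S)$ is the set of measurable $f$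 with $\int_S|f(s)|^\alpha\,\mathrm{d}s<\infty$. Symmetric $\alpha$-stable Lévy white noise: $\dot W^\alpha$ is an independently scattered symmetric $\alpha$-stable random measure on $S$, with characteristic function $\mathbb{E}(e^{iu\dot W^\alpha(A)})=\exp(-\mathrm{Leb}_d(A)|u|^\alpha)$, $u\in\mathbb{R}$, for Borel $A\subset S$ of finite Lebesgue measure. A deterministic measurable function $f$ is integrable with respect to $\dot W^\alpha$ iff $f\in L^\alpha(S)$; the integral is denoted $\langle\dot W^\alpha,f\rangle$, it is almost surely linear in $f$, and $\mathbb{E}(e^{i\langle\dot W^\alpha,f\rangle})=\exp(-\int_S|f(s)|^\alpha\,\mathrm{d}s)$. The mild solution is defined when $\rho(t-\cdot)\in L^\alpha(S)$ for any $t\in\mathbb{R}^d$; it has a jointly measurable version in $(t,\omega)$. The generalized solution is defined when $\varphi*\check\rho\in L^\alpha(S)$ for every $\varphi\in\mathcal{D}(\mathbb{R}^d)$. A generalized stochastic process is a linear map from $\mathcal{D}(\mathbb{R}^d)$ into the space $L^0(\Omega)$ of a.s. finite random variables. "$u_{\text{mild}}=u_{\text{gen}}$ in the sense of generalized stochastic processes" means that $u_{\text{mild}}$ has almost surely locally integrable sample paths (so that it defines a generalized stochastic process by $\langle u_{\text{mild}},\varphi\rangle:=\int_{\mathbb{R}^d}u_{\text{mild}}(t)\varphi(t)\,\mathrm{d}t$), that $u_{\text{gen}}$ is well defined, and that $\langle u_{\text{mild}},\varphi\rangle=\langle u_{\text{gen}},\varphi\rangle$ a.s. for every $\varphi\in\mathcal{D}(\mathbb{R}^d)$.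 In (ii), the integrand is taken to be $0$ where $\rho(t-s)=0$. *)

theory Defs
  imports "HOL-Probability.Probability"
begin

section \<open>Test functions and Schwartz distributions\<close>

definition partial :: "'n::finite \<Rightarrow> (real ^ 'n \<Rightarrow> real) \<Rightarrow> real ^ 'n \<Rightarrow> real" where
  "partial i f x = frechet_derivative f (at x) (axis i 1)"

text \<open>Iterated partial derivatives are indexed by lists of coordinate directions instead of
  multi-indices; for smooth functions the order of the list is irrelevant.\<close>

definition partials :: "'n::finite list \<Rightarrow> (real ^ 'n \<Rightarrow> real) \<Rightarrow> real ^ 'n \<Rightarrow> real" where
  "partials I f = foldr partial I f"

text \<open>Differentiability of all iterated partial derivatives makes all of them continuous.\<close>

definition smooth :: "(real ^ 'n::finite \<Rightarrow> real) \<Rightarrow> bool" where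
  "smooth f \<longleftrightarrow> (\<forall>I. partials I f differentiable_on UNIV)"

definition test_funs :: "(real ^ 'n::finite \<Rightarrow> real) set" where
  "test_funs = {\<phi>. smooth \<phi> \<and> compact (closure {x. \<phi> x \<noteq> 0})}"

definition test_tendsto ::
    "(nat \<Rightarrow> real ^ 'n::finite \<Rightarrow> real) \<Rightarrow> (real ^ 'n \<Rightarrow> real) \<Rightarrow> bool" where
  "test_tendsto \<psi> \<phi> \<longleftrightarrow>
     (\<exists>K. compact K \<and> (\<forall>k x. x \<notin> K \<longrightarrow> \<psi> k x = 0)) \<and>
     (\<forall>I. uniform_limit UNIV (\<lambda>k. partials I (\<psi> k)) (partials I \<phi>) sequentially)"

text \<open>A distribution is represented by a functional on all functions; only its values on
  \<open>test_funs\<close> are meaningful.\<close>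

definition distribution :: "((real ^ 'n::finite \<Rightarrow> real) \<Rightarrow> real) \<Rightarrow> bool" where
  "distribution T \<longleftrightarrow>
     (\<forall>\<phi>\<in>test_funs. \<forall>\<psi>\<in>test_funs. \<forall>a b. T (\<lambda>x. a * \<phi> x + b * \<psi> x) = a * T \<phi> + b * T \<psi>) \<and>
     (\<forall>\<psi>. \<forall>\<phi>\<in>test_funs. (\<forall>k. \<psi> k \<in> test_funs) \<longrightarrow> test_tendsto \<psi> \<phi> \<longrightarrow>
        (\<lambda>k. T (\<psi> k)) \<longlonglongrightarrow> T \<phi>)"

definition dist_partial ::
    "'n::finite \<Rightarrow> ((real ^ 'n \<Rightarrow> real) \<Rightarrow> real) \<Rightarrow> (real ^ 'n \<Rightarrow> real) \<Rightarrow> real" where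
  "dist_partial i T \<phi> = - T (partial i \<phi>)"

definition dist_times ::
    "(real ^ 'n::finite \<Rightarrow> real) \<Rightarrow> ((real ^ 'n \<Rightarrow> real) \<Rightarrow> real) \<Rightarrow> (real ^ 'n \<Rightarrow> real) \<Rightarrow> real" where
  "dist_times a T \<phi> = T (\<lambda>x. a x * \<phi> x)"

text \<open>The action on distributions of the linear partial differential operator
  \<open>\<Sum>\<^bsub>|I| \<le> m\<^esub> a\<^sub>I \<partial>\<^sup>I\<close> of order at most \<open>m\<close>.\<close>

definition pdo ::
    "nat \<Rightarrow> ('n::finite list \<Rightarrow> real ^ 'n \<Rightarrow> real) \<Rightarrow>
     ((real ^ 'n \<Rightarrow> real) \<Rightarrow> real) \<Rightarrow> (real ^ 'n \<Rightarrow> real) \<Rightarrow> real" where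
  "pdo m a T \<phi> = (\<Sum>I | length I \<le> m. dist_times (a I) (foldr dist_partial I T) \<phi>)"

definition fundamental_solution ::
    "nat \<Rightarrow> ('n::finite list \<Rightarrow> real ^ 'n \<Rightarrow> real) \<Rightarrow> ((real ^ 'n \<Rightarrow> real) \<Rightarrow> real) \<Rightarrow> bool" where
  "fundamental_solution m a T \<longleftrightarrow> distribution T \<and> (\<forall>\<phi>\<in>test_funs. pdo m a T \<phi> = \<phi> 0)"

definition locally_integrable :: "(real ^ 'n::finite \<Rightarrow> real) \<Rightarrow> bool" where
  "locally_integrable f \<longleftrightarrow> (\<forall>K. compact K \<longrightarrow> set_integrable lborel K f)"

definition represents ::
    "(real ^ 'n::finite \<Rightarrow> real) \<Rightarrow> ((real ^ 'n \<Rightarrow> real) \<Rightarrow> real) \<Rightarrow> bool" where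
  "represents \<rho> T \<longleftrightarrow> \<rho> \<in> borel_measurable borel \<and> locally_integrable \<rho> \<and>
     (\<forall>\<phi>\<in>test_funs. T \<phi> = (LINT x|lborel. \<rho> x * \<phi> x))"

definition reflect :: "((real ^ 'n::finite \<Rightarrow> real) \<Rightarrow> real) \<Rightarrow> (real ^ 'n \<Rightarrow> real) \<Rightarrow> real" where
  "reflect T \<phi> = T (\<lambda>x. \<phi> (- x))"

definition convolve ::
    "(real ^ 'n::finite \<Rightarrow> real) \<Rightarrow> ((real ^ 'n \<Rightarrow> real) \<Rightarrow> real) \<Rightarrow> real ^ 'n \<Rightarrow> real" where
  "convolve \<phi> T s = T (\<lambda>x. \<phi> (s - x))"


section \<open>Symmetric stable white noise and its integral\<close>

definition L_space :: "real \<Rightarrow> (real ^ 'n::finite) set \<Rightarrow> (real ^ 'n \<Rightarrow> real) set" where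
  "L_space \<alpha> S = {f. f \<in> borel_measurable (restrict_space borel S) \<and>
     (\<integral>\<^sup>+s\<in>S. ennreal (\<bar>f s\<bar> powr \<alpha>) \<partial>lborel) < \<infinity>}"

definition finite_borel :: "(real ^ 'n::finite) set \<Rightarrow> (real ^ 'n) set set" where
  "finite_borel S = {A. A \<in> sets borel \<and> A \<subseteq> S \<and> emeasure lborel A < \<infinity>}"

definition stable_white_noise ::
    "'w measure \<Rightarrow> real \<Rightarrow> (real ^ 'n::finite) set \<Rightarrow> ((real ^ 'n) set \<Rightarrow> 'w \<Rightarrow> real) \<Rightarrow> bool" where
  "stable_white_noise M \<alpha> S W \<longleftrightarrow>
     (\<forall>A\<in>finite_borel S. W A \<in> borel_measurable M) \<and>
     (\<forall>A\<in>finite_borel S. \<forall>u. char (distr M borel (W A)) u =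
        complex_of_real (exp (- (measure lborel A * \<bar>u\<bar> powr \<alpha>)))) \<and>
     (\<forall>A :: nat \<Rightarrow> _. range A \<subseteq> finite_borel S \<longrightarrow> disjoint_family A \<longrightarrow>
        prob_space.indep_vars M (\<lambda>_. borel) (\<lambda>k. W (A k)) UNIV) \<and>
     (\<forall>A :: nat \<Rightarrow> _. range A \<subseteq> finite_borel S \<longrightarrow> disjoint_family A \<longrightarrow>
        (\<Union>k. A k) \<in> finite_borel S \<longrightarrow>
        (AE \<omega> in M. (\<lambda>k. W (A k) \<omega>) sums W (\<Union>k. A k) \<omega>))"

definition simple_noise_integral ::
    "(real ^ 'n::finite) set \<Rightarrow> ((real ^ 'n) set \<Rightarrow> 'w \<Rightarrow> real) \<Rightarrow> (real ^ 'n \<Rightarrow> real) \<Rightarrow> 'w \<Rightarrow> real" where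
  "simple_noise_integral S W f \<omega> = (\<Sum>y\<in>f ` S - {0}. y * W {s \<in> S. f s = y} \<omega>)"

definition tendsto_in_prob :: "'w measure \<Rightarrow> (nat \<Rightarrow> 'w \<Rightarrow> real) \<Rightarrow> ('w \<Rightarrow> real) \<Rightarrow> bool" where
  "tendsto_in_prob M X Y \<longleftrightarrow>
     (\<forall>\<epsilon>>0. (\<lambda>k. measure M {\<omega> \<in> space M. \<bar>X k \<omega> - Y \<omega>\<bar> > \<epsilon>}) \<longlonglongrightarrow> 0)"

text \<open>\<open>X\<close> is a version of the integral of \<open>f\<close> over \<open>S\<close> with respect to \<open>W\<close>: the limit in
  probability of the integrals of simple functions that approximate \<open>f\<close> in \<open>L\<^sup>\<alpha>(S)\<close>.  This
  determines \<open>X\<close> up to almost sure equality.\<close>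

definition has_noise_integral ::
    "'w measure \<Rightarrow> real \<Rightarrow> (real ^ 'n::finite) set \<Rightarrow> ((real ^ 'n) set \<Rightarrow> 'w \<Rightarrow> real) \<Rightarrow>
     (real ^ 'n \<Rightarrow> real) \<Rightarrow> ('w \<Rightarrow> real) \<Rightarrow> bool" where
  "has_noise_integral M \<alpha> S W f X \<longleftrightarrow> f \<in> L_space \<alpha> S \<and> X \<in> borel_measurable M \<and>
     (\<exists>g. (\<forall>k. Bochner_Integration.simple_bochner_integrable (restrict_space lborel S) (g k)) \<and>
          (\<lambda>k. \<integral>\<^sup>+s\<in>S. ennreal (\<bar>g k s - f s\<bar> powr \<alpha>) \<partial>lborel) \<longlonglongrightarrow> 0 \<and>
          tendsto_in_prob M (\<lambda>k. simple_noise_integral S W (g k)) X)"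

definition noise_integral ::
    "'w measure \<Rightarrow> real \<Rightarrow> (real ^ 'n::finite) set \<Rightarrow> ((real ^ 'n) set \<Rightarrow> 'w \<Rightarrow> real) \<Rightarrow>
     (real ^ 'n \<Rightarrow> real) \<Rightarrow> 'w \<Rightarrow> real" where
  "noise_integral M \<alpha> S W f = (SOME X. has_noise_integral M \<alpha> S W f X)"


section \<open>Mild and generalized solutions\<close>

definition mild_solution ::
    "'w measure \<Rightarrow> real \<Rightarrow> (real ^ 'n::finite) set \<Rightarrow> ((real ^ 'n) set \<Rightarrow> 'w \<Rightarrow> real) \<Rightarrow>
     (real ^ 'n \<Rightarrow> real) \<Rightarrow> (real ^ 'n \<Rightarrow> 'w \<Rightarrow> real) \<Rightarrow> bool" where
  "mild_solution M \<alpha> S W \<rho> u \<longleftrightarrow> (\<forall>t. has_noise_integral M \<alpha> S W (\<lambda>s. \<rho> (t - s)) (u t))"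

definition gen_solution ::
    "'w measure \<Rightarrow> real \<Rightarrow> (real ^ 'n::finite) set \<Rightarrow> ((real ^ 'n) set \<Rightarrow> 'w \<Rightarrow> real) \<Rightarrow>
     ((real ^ 'n \<Rightarrow> real) \<Rightarrow> real) \<Rightarrow> (real ^ 'n \<Rightarrow> real) \<Rightarrow> 'w \<Rightarrow> real" where
  "gen_solution M \<alpha> S W T \<phi> = noise_integral M \<alpha> S W (convolve \<phi> (reflect T))"

text \<open>The second conjunct rules out an arbitrary value of the choice in \<open>noise_integral\<close>.\<close>

definition gen_solution_well_defined ::
    "'w measure \<Rightarrow> real \<Rightarrow> (real ^ 'n::finite) set \<Rightarrow> ((real ^ 'n) set \<Rightarrow> 'w \<Rightarrow> real) \<Rightarrow>
     ((real ^ 'n \<Rightarrow> real) \<Rightarrow> real) \<Rightarrow> bool" where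
  "gen_solution_well_defined M \<alpha> S W T \<longleftrightarrow>
     (\<forall>\<phi>\<in>test_funs. convolve \<phi> (reflect T) \<in> L_space \<alpha> S \<and>
        has_noise_integral M \<alpha> S W (convolve \<phi> (reflect T)) (gen_solution M \<alpha> S W T \<phi>))"

definition generalized_process ::
    "'w measure \<Rightarrow> ((real ^ 'n::finite \<Rightarrow> real) \<Rightarrow> 'w \<Rightarrow> real) \<Rightarrow> bool" where
  "generalized_process M U \<longleftrightarrow> (\<forall>\<phi>\<in>test_funs. U \<phi> \<in> borel_measurable M) \<and>
     (\<forall>\<phi>\<in>test_funs. \<forall>\<psi>\<in>test_funs. \<forall>a b.
        AE \<omega> in M. U (\<lambda>x. a * \<phi> x + b * \<psi> x) \<omega> = a * U \<phi> \<omega> + b * U \<psi> \<omega>)"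

definition pairing ::
    "(real ^ 'n::finite \<Rightarrow> 'w \<Rightarrow> real) \<Rightarrow> (real ^ 'n \<Rightarrow> real) \<Rightarrow> 'w \<Rightarrow> real" where
  "pairing u \<phi> \<omega> = (LINT t|lborel. u t \<omega> * \<phi> t)"

definition mild_eq_gen ::
    "'w measure \<Rightarrow> real \<Rightarrow> (real ^ 'n::finite) set \<Rightarrow> ((real ^ 'n) set \<Rightarrow> 'w \<Rightarrow> real) \<Rightarrow>
     ((real ^ 'n \<Rightarrow> real) \<Rightarrow> real) \<Rightarrow> (real ^ 'n \<Rightarrow> 'w \<Rightarrow> real) \<Rightarrow> bool" where
  "mild_eq_gen M \<alpha> S W T u \<longleftrightarrow>
     (AE \<omega> in M. locally_integrable (\<lambda>t. u t \<omega>)) \<and> generalized_process M (pairing u) \<and>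
     gen_solution_well_defined M \<alpha> S W T \<and> generalized_process M (gen_solution M \<alpha> S W T) \<and>
     (\<forall>\<phi>\<in>test_funs. AE \<omega> in M. pairing u \<phi> \<omega> = gen_solution M \<alpha> S W T \<phi> \<omega>)"

definition \<mu> :: "(real ^ 'n::finite \<Rightarrow> real) \<Rightarrow> (real ^ 'n) measure" where
  "\<mu> \<phi> = density lborel (\<lambda>t. ennreal \<bar>\<phi> t\<bar>)"

definition log_plus :: "real \<Rightarrow> real" where
  "log_plus x = max (ln x) 0"

text \<open>The bracket of the integrability condition for \<open>\<alpha> = 1\<close>.  The two integrals in the
  denominator are finite when \<open>\<rho>(t - \<cdot>) \<in> L\<^sup>1(S)\<close> and \<open>\<rho>\<close> is locally integrable.  If the double
  integral in the numerator diverges, its Bochner value is irrelevant: the bracket is at least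
  1, so the integral of \<open>|\<rho>(t - s)|\<close> times the bracket is infinite anyway.  Points with
  \<open>\<rho>(t - s) \<noteq> 0\<close> and a vanishing denominator form a null set
  for the product of \<open>\<mu> \<phi>\<close> and Lebesgue measure on \<open>S\<close>.\<close>

definition log_bracket ::
    "(real ^ 'n::finite) set \<Rightarrow> (real ^ 'n \<Rightarrow> real) \<Rightarrow> (real ^ 'n \<Rightarrow> real) \<Rightarrow>
     real ^ 'n \<Rightarrow> real ^ 'n \<Rightarrow> real" where
  "log_bracket S \<rho> \<phi> t s = 1 + log_plus
     (\<bar>\<rho> (t - s)\<bar> * (LINT r|\<mu> \<phi>. (LINT v:S|lborel. \<bar>\<rho> (r - v)\<bar>)) /
      ((LINT v:S|lborel. \<bar>\<rho> (t - v)\<bar>) * (LINT r|\<mu> \<phi>. \<bar>\<rho> (r - s)\<bar>)))"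

end

(*
The theorem is a stochastic Fubini theorem: integrating the stable integrals u(t) = <W, rho(t - .)>
against phi(t) dt must give the stable integral of the integrated kernels. It is clear when the
kernel f(t, s) = rho(t - s) is a step function in s, and the general case follows by
approximation, once the L^1(|phi(t)| dt) norm of the path of a step process is controlled in
probability.

For a step kernel with independent noise values W_j, discard the W_j larger than a level b_j, which
is improbable by the tail bound P(|W(A)| > x) <= 8 |A| x^(-alpha). For fixed t, the remaining
symmetric sum is split at a level tau(t): the large terms are estimated in L^1, the small ones in
L^2. The three integrability conditions say exactly that, for suitable b and tau, the functional Psi
that bounds these truncated moments is integrable along the kernel: up to a positive additive
constant, tau(t) is the norm of f(t, .) in L^alpha if alpha > 1 and a multiple of the L^1 norm of
f(t, .) if alpha = 1, while 1 / b(s) is the integral of |f(t, s)| |phi(t)| dt if alpha <= 1.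

For a fast approximating sequence of step kernels, the step processes converge to u in
L^1(|phi(t)| dt) almost surely, hence their integrals converge almost surely. This forces the
integrated step kernels to converge in L^alpha(S), since the law of the noise integral of a step
function determines its norm.
*)
theory Submission
  imports Defs
begin

section \<open>Step functions against the noise\<close>

definition noise_sum :: "('a set \<Rightarrow> 'w \<Rightarrow> real) \<Rightarrow> 'i set \<Rightarrow> ('i \<Rightarrow> real) \<Rightarrow> ('i \<Rightarrow> 'a set) \<Rightarrow> 'w \<Rightarrow> real" where
  "noise_sum W J c A \<omega> = (\<Sum>j\<in>J. c j * W (A j) \<omega>)"

definition step :: "'i set \<Rightarrow> ('i \<Rightarrow> real) \<Rightarrow> ('i \<Rightarrow> 'a set) \<Rightarrow> 'a \<Rightarrow> real" where
  "step J c A s = (\<Sum>j\<in>J. c j * indicator (A j) s)"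

text \<open>The sets of a step function may overlap. Disjointness is recovered by passing to the atoms of
  the sets, so that differences of step functions need no common refinement.\<close>

definition atom :: "'i set \<Rightarrow> ('i \<Rightarrow> 'a set) \<Rightarrow> 'i set \<Rightarrow> 'a set" where
  "atom J A \<sigma> = {s. {j \<in> J. s \<in> A j} = \<sigma>}"

definition atom_ids :: "'i set \<Rightarrow> 'i set set" where
  "atom_ids J = Pow J - {{}}"

lemma finite_atom_ids [simp]: "finite J \<Longrightarrow> finite (atom_ids J)"
  by (simp add: atom_ids_def)

lemma disjoint_atoms: "disjoint_family_on (atom J A) I"
  by (auto simp: disjoint_family_on_def atom_def)

lemma atom_Union: "j \<in> J \<Longrightarrow> A j = (\<Union>\<sigma>\<in>{\<sigma>\<in>atom_ids J. j \<in> \<sigma>}. atom J A \<sigma>)"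
  by (auto simp: atom_def atom_ids_def)

lemma atom_eq: "atom J A \<sigma> = (\<Inter>j\<in>\<sigma>. A j) - (\<Union>j\<in>J - \<sigma>. A j)" if "\<sigma> \<in> atom_ids J"
  using that by (auto simp: atom_def atom_ids_def)

lemma step_atom: "s \<in> atom J A \<sigma> \<Longrightarrow> finite J \<Longrightarrow> step J c A s = (\<Sum>j\<in>\<sigma>. c j)"
  unfolding step_def atom_def by (auto simp: indicator_def if_distrib sum.If_cases Int_def cong: if_cong)

lemma step_measurable [measurable]:
  assumes "\<And>j. j \<in> J \<Longrightarrow> A j \<in> sets N"
  shows "step J c A \<in> borel_measurable N"
  unfolding step_def using assms by (intro borel_measurable_sum) auto

lemma step_zero: "s \<notin> (\<Union>j\<in>J. A j) \<Longrightarrow> step J c A s = 0"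
  unfolding step_def by (intro sum.neutral) auto

lemma finite_borelD:
  "A \<in> finite_borel S \<Longrightarrow> A \<in> sets borel" "A \<in> finite_borel S \<Longrightarrow> A \<subseteq> S"
  "A \<in> finite_borel S \<Longrightarrow> emeasure lborel A < \<infinity>"
  by (auto simp: finite_borel_def)

lemma finite_borel_empty [simp]: "{} \<in> finite_borel S"
  by (auto simp: finite_borel_def)

lemma finite_borel_subset: "A \<in> finite_borel S \<Longrightarrow> B \<in> sets borel \<Longrightarrow> B \<subseteq> A \<Longrightarrow> B \<in> finite_borel S"
  using emeasure_mono[of B A lborel] by (auto simp: finite_borel_def)

lemma finite_borel_UN:
  assumes "finite I" "\<And>i. i \<in> I \<Longrightarrow> B i \<in> finite_borel S"
  shows "(\<Union>i\<in>I. B i) \<in> finite_borel S"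
  unfolding finite_borel_def
proof (safe)
  show "(\<Union>i\<in>I. B i) \<in> sets borel" using assms by (intro sets.finite_UN) (auto simp: finite_borel_def)
  have "emeasure lborel (\<Union>i\<in>I. B i) \<le> (\<Sum>i\<in>I. emeasure lborel (B i))"
    using assms by (intro emeasure_subadditive_finite) (auto simp: finite_borel_def)
  also have "\<dots> < \<infinity>" using assms by (auto simp: finite_borel_def)
  finally show "emeasure lborel (\<Union>i\<in>I. B i) < \<infinity>" .
qed (use assms in \<open>auto simp: finite_borel_def\<close>)

lemma atom_finite_borel:
  assumes "finite J" "\<And>j. j \<in> J \<Longrightarrow> A j \<in> finite_borel S" "\<sigma> \<in> atom_ids J"
  shows "atom J A \<sigma> \<in> finite_borel S"
proof -
  have \<sigma>: "finite \<sigma>" "\<sigma> \<subseteq> J" "\<sigma> \<noteq> {}" using assms by (auto simp: atom_ids_def finite_subset)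
  then obtain j where j: "j \<in> \<sigma>" by auto
  show ?thesis
  proof (rule finite_borel_subset[of "A j"])
    show "atom J A \<sigma> \<in> sets borel"
      unfolding atom_eq[OF assms(3)] using assms \<sigma>
      by (intro sets.Diff sets.finite_INT sets.finite_UN finite_borelD(1)) (auto intro!: finite_borelD(1))
    show "atom J A \<sigma> \<subseteq> A j" using j by (auto simp: atom_def)
  qed (use j \<sigma> assms in auto)
qed

lemma (in prob_space) indep_vars_reindex:
  assumes f: "inj_on f I" and X: "indep_vars N X (f ` I)"
  shows "indep_vars (\<lambda>i. N (f i)) (\<lambda>i. X (f i)) I"
  unfolding indep_vars_def
proof (intro conjI indep_setsI ballI)
  fix A J assume J: "J \<noteq> {}" "J \<subseteq> I" "finite J"
    and A: "\<forall>j\<in>J. A j \<in> sigma_sets (space M) {X (f j) -` B \<inter> space M |B. B \<in> sets (N (f j))}"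
  define A' where "A' k = A (the_inv_into I f k)" for k
  have A': "A' (f j) = A j" if "j \<in> J" for j
    using that J f by (auto simp: A'_def the_inv_into_f_f)
  have "prob (\<Inter>k\<in>f ` J. A' k) = (\<Prod>k\<in>f ` J. prob (A' k))"
    by (rule indep_setsD[OF X[unfolded indep_vars_def, THEN conjunct2]])
       (use J A A' in auto)
  then show "prob (\<Inter>(A ` J)) = (\<Prod>j\<in>J. prob (A j))"
    using J f by (subst (asm) prod.reindex) (auto simp: A' inj_on_subset)
qed (use X in \<open>auto simp: indep_vars_def indep_sets_def\<close>)

locale stable_noise = prob_space M
  for M :: "'w measure" and \<alpha> :: real and S :: "(real ^ 'n::finite) set"
    and W :: "(real ^ 'n) set \<Rightarrow> 'w \<Rightarrow> real" +
  assumes alpha: "0 < \<alpha>" "\<alpha> < 2"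
    and S_borel [measurable]: "S \<in> sets borel"
    and noise: "stable_white_noise M \<alpha> S W"
begin

lemma W_measurable [measurable]: "A \<in> finite_borel S \<Longrightarrow> W A \<in> borel_measurable M"
  using noise by (auto simp: stable_white_noise_def)

lemma W_char: "A \<in> finite_borel S \<Longrightarrow>
    char (distr M borel (W A)) u = complex_of_real (exp (- (measure lborel A * \<bar>u\<bar> powr \<alpha>)))"
  using noise by (auto simp: stable_white_noise_def)

lemma W_indep_seq: "range A \<subseteq> finite_borel S \<Longrightarrow> disjoint_family (A :: nat \<Rightarrow> _) \<Longrightarrow>
    indep_vars (\<lambda>_. borel) (\<lambda>k. W (A k)) UNIV"
  using noise by (auto simp: stable_white_noise_def)

lemma W_sums: "range A \<subseteq> finite_borel S \<Longrightarrow> disjoint_family (A :: nat \<Rightarrow> _) \<Longrightarrow>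
    (\<Union>k. A k) \<in> finite_borel S \<Longrightarrow> AE \<omega> in M. (\<lambda>k. W (A k) \<omega>) sums W (\<Union>k. A k) \<omega>"
  using noise by (auto simp: stable_white_noise_def)

lemma W_empty: "AE \<omega> in M. W {} \<omega> = 0"
proof -
  have "AE \<omega> in M. (\<lambda>k::nat. W {} \<omega>) sums W (\<Union>k::nat. {}) \<omega>"
    by (rule W_sums) (auto simp: disjoint_family_on_def)
  then show ?thesis
  proof eventually_elim
    case (elim \<omega>)
    then have "(\<lambda>k::nat. W {} \<omega>) \<longlonglongrightarrow> 0" by (intro summable_LIMSEQ_zero sums_summable)
    then show ?case by (simp add: LIMSEQ_const_iff)
  qed
qed

lemma
  fixes I :: "'i set"
  assumes "finite I" "\<And>i. i \<in> I \<Longrightarrow> B i \<in> finite_borel S" "disjoint_family_on B I"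
  shows W_indep: "indep_vars (\<lambda>_. borel) (\<lambda>i. W (B i)) I"
    and W_finite_additive: "AE \<omega> in M. W (\<Union>i\<in>I. B i) \<omega> = (\<Sum>i\<in>I. W (B i) \<omega>)"
proof -
  obtain f :: "'i \<Rightarrow> nat" where f: "inj_on f I"
    using finite_imp_inj_to_nat_seg[OF assms(1)] by auto
  define C where "C k = (if k \<in> f ` I then B (the_inv_into I f k) else {})" for k
  have C: "C (f i) = B i" if "i \<in> I" for i
    using that f by (simp add: C_def the_inv_into_f_f)
  have Cr: "range C \<subseteq> finite_borel S"
    using assms f by (auto simp: C_def the_inv_into_f_f)
  have Cd: "disjoint_family C"
    using assms(3) f
    by (auto simp: C_def disjoint_family_on_def the_inv_into_f_f) (metis disjoint_iff inj_onD)
  have CU: "(\<Union>k. C k) = (\<Union>i\<in>I. B i)"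
    using f by (auto simp: C_def the_inv_into_f_f split: if_splits)
  have "indep_vars (\<lambda>_. borel) (\<lambda>k. W (C k)) (f ` I)"
    by (rule indep_vars_subset[OF W_indep_seq[OF Cr Cd]]) auto
  then have "indep_vars (\<lambda>_. borel) (\<lambda>i. W (C (f i))) I"
    using indep_vars_reindex[OF f, of "\<lambda>_. borel" "\<lambda>k. W (C k)"] by (simp add: comp_def)
  then show "indep_vars (\<lambda>_. borel) (\<lambda>i. W (B i)) I"
    by (subst indep_vars_cong[OF refl, of I _ "\<lambda>i. W (C (f i))"]) (auto simp: C)
  have "AE \<omega> in M. (\<lambda>k. W (C k) \<omega>) sums W (\<Union>k. C k) \<omega>"
    by (rule W_sums[OF Cr Cd]) (use CU finite_borel_UN[OF assms(1,2)] in auto)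
  with W_empty show "AE \<omega> in M. W (\<Union>i\<in>I. B i) \<omega> = (\<Sum>i\<in>I. W (B i) \<omega>)"
  proof eventually_elim
    case (elim \<omega>)
    have "(\<lambda>k. W (C k) \<omega>) sums (\<Sum>k\<in>f ` I. W (C k) \<omega>)"
      by (rule sums_finite) (use assms(1) elim(1) in \<open>auto simp: C_def\<close>)
    then have "W (\<Union>k. C k) \<omega> = (\<Sum>k\<in>f ` I. W (C k) \<omega>)"
      using elim(2) sums_unique2 by blast
    also have "\<dots> = (\<Sum>i\<in>I. W (B i) \<omega>)"
      by (subst sum.reindex[OF f]) (simp add: C)
    finally show ?case by (simp add: CU)
  qed
qed

lemma noise_sum_measurable [measurable]:
  assumes "\<And>j. j \<in> J \<Longrightarrow> A j \<in> finite_borel S"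
  shows "noise_sum W J c A \<in> borel_measurable M"
  unfolding noise_sum_def using assms by (intro borel_measurable_sum borel_measurable_times) auto

lemma W_atoms:
  assumes "finite J" "\<And>j. j \<in> J \<Longrightarrow> A j \<in> finite_borel S"
  shows "AE \<omega> in M. \<forall>c. noise_sum W J c A \<omega> =
    noise_sum W (atom_ids J) (\<lambda>\<sigma>. \<Sum>j\<in>\<sigma>. c j) (atom J A) \<omega>"
proof -
  have "AE \<omega> in M. W (A j) \<omega> = (\<Sum>\<sigma>\<in>{\<sigma>\<in>atom_ids J. j \<in> \<sigma>}. W (atom J A \<sigma>) \<omega>)" if "j \<in> J" for j
    unfolding arg_cong[where f=W, OF atom_Union[OF that, of A]]
    by (rule W_finite_additive) (use assms in \<open>auto simp: disjoint_atoms atom_finite_borel\<close>)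
  then have "AE \<omega> in M. \<forall>j\<in>J. W (A j) \<omega> = (\<Sum>\<sigma>\<in>{\<sigma>\<in>atom_ids J. j \<in> \<sigma>}. W (atom J A \<sigma>) \<omega>)"
    using assms(1) by (intro AE_finite_allI) auto
  then show ?thesis
  proof (eventually_elim, intro allI)
    fix \<omega> c
    assume *: "\<forall>j\<in>J. W (A j) \<omega> = (\<Sum>\<sigma>\<in>{\<sigma>\<in>atom_ids J. j \<in> \<sigma>}. W (atom J A \<sigma>) \<omega>)"
    have "noise_sum W J c A \<omega> = (\<Sum>j\<in>J. \<Sum>\<sigma>\<in>{\<sigma>\<in>atom_ids J. j \<in> \<sigma>}. c j * W (atom J A \<sigma>) \<omega>)"
      unfolding noise_sum_def using * by (simp add: sum_distrib_left)
    also have "\<dots> = (\<Sum>\<sigma>\<in>atom_ids J. \<Sum>j\<in>{j\<in>J. j \<in> \<sigma>}. c j * W (atom J A \<sigma>) \<omega>)"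
      by (rule sum.swap_restrict) (use assms(1) in auto)
    also have "\<dots> = (\<Sum>\<sigma>\<in>atom_ids J. (\<Sum>j\<in>\<sigma>. c j) * W (atom J A \<sigma>) \<omega>)"
      unfolding sum_distrib_right by (intro sum.cong) (auto simp: atom_ids_def)
    finally show "noise_sum W J c A \<omega> =
        noise_sum W (atom_ids J) (\<lambda>\<sigma>. \<Sum>j\<in>\<sigma>. c j) (atom J A) \<omega>"
      by (simp add: noise_sum_def)
  qed
qed

lemma char_W_scale:
  assumes "A \<in> finite_borel S"
  shows "char (distr M borel (\<lambda>\<omega>. c * W A \<omega>)) u =
    complex_of_real (exp (- (measure lborel A * (\<bar>c\<bar> powr \<alpha> * \<bar>u\<bar> powr \<alpha>))))"
proof -
  have "char (distr M borel (\<lambda>\<omega>. c * W A \<omega>)) u = char (distr M borel (W A)) (u * c)"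
    unfolding char_def using assms by (subst (1 2) integral_distr) (auto simp: mult_ac)
  then show ?thesis by (simp add: W_char[OF assms] abs_mult powr_mult mult_ac)
qed

lemma step_integral:
  assumes "finite J" "\<And>j. j \<in> J \<Longrightarrow> A j \<in> finite_borel S"
  shows "(\<integral>\<^sup>+s\<in>S. ennreal (\<bar>step J c A s\<bar> powr \<alpha>) \<partial>lborel) =
    ennreal (\<Sum>\<sigma>\<in>atom_ids J. measure lborel (atom J A \<sigma>) * \<bar>\<Sum>j\<in>\<sigma>. c j\<bar> powr \<alpha>)"
proof -
  have fb: "atom J A \<sigma> \<in> finite_borel S" if "\<sigma> \<in> atom_ids J" for \<sigma>
    using atom_finite_borel assms that by blast
  have *: "ennreal (\<bar>step J c A s\<bar> powr \<alpha>) * indicator S s =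
    (\<Sum>\<sigma>\<in>atom_ids J. ennreal (\<bar>\<Sum>j\<in>\<sigma>. c j\<bar> powr \<alpha>) * indicator (atom J A \<sigma>) s)" (is "?l = ?r") for s
  proof (cases "s \<in> (\<Union>j\<in>J. A j)")
    case True
    define \<sigma> where "\<sigma> = {j\<in>J. s \<in> A j}"
    have \<sigma>: "s \<in> atom J A \<sigma>" "\<sigma> \<in> atom_ids J" using True by (auto simp: atom_def \<sigma>_def atom_ids_def)
    have "s \<in> S" using True assms finite_borelD(2) by blast
    have "?r = (\<Sum>\<sigma>'\<in>atom_ids J. if \<sigma>' = \<sigma> then ennreal (\<bar>\<Sum>j\<in>\<sigma>'. c j\<bar> powr \<alpha>) else 0)"
      by (intro sum.cong) (auto simp: atom_def \<sigma>_def indicator_def)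
    also have "\<dots> = ?l"
      using assms(1) \<sigma> \<open>s \<in> S\<close> by (subst sum.delta) (auto simp: step_atom)
    finally show ?thesis by simp
  next
    case False
    have "s \<notin> atom J A \<sigma>" if "\<sigma> \<in> atom_ids J" for \<sigma>
      using False that by (auto simp: atom_def atom_ids_def)
    then show ?thesis using False step_zero[OF False, of c] by (auto intro!: sum.neutral simp: alpha)
  qed
  have "(\<integral>\<^sup>+s\<in>S. ennreal (\<bar>step J c A s\<bar> powr \<alpha>) \<partial>lborel) =
      (\<Sum>\<sigma>\<in>atom_ids J. ennreal (\<bar>\<Sum>j\<in>\<sigma>. c j\<bar> powr \<alpha>) * emeasure lborel (atom J A \<sigma>))"
    unfolding * using finite_borelD(1)[OF fb] 
    by (subst nn_integral_sum) (auto simp: nn_integral_cmult_indicator intro!: sum.cong)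
  also have "\<dots> = (\<Sum>\<sigma>\<in>atom_ids J. ennreal (measure lborel (atom J A \<sigma>) * \<bar>\<Sum>j\<in>\<sigma>. c j\<bar> powr \<alpha>))"
    using finite_borelD(3)[OF fb]
    by (intro sum.cong) (auto simp: emeasure_eq_ennreal_measure ennreal_mult mult_ac less_top)
  also have "\<dots> = ennreal (\<Sum>\<sigma>\<in>atom_ids J. measure lborel (atom J A \<sigma>) * \<bar>\<Sum>j\<in>\<sigma>. c j\<bar> powr \<alpha>)"
    by (subst sum_ennreal) auto
  finally show ?thesis .
qed

lemma char_noise_sum:
  assumes J: "finite J" "\<And>j. j \<in> J \<Longrightarrow> A j \<in> finite_borel S"
  shows "char (distr M borel (noise_sum W J c A)) u = complex_of_real
    (exp (- (enn2real (\<integral>\<^sup>+s\<in>S. ennreal (\<bar>step J c A s\<bar> powr \<alpha>) \<partial>lborel) * \<bar>u\<bar> powr \<alpha>)))"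
proof -
  let ?a = "\<lambda>\<sigma>. \<Sum>j\<in>\<sigma>. c j" and ?A = "atom J A" and ?I = "atom_ids J"
  have fb: "?A \<sigma> \<in> finite_borel S" if "\<sigma> \<in> ?I" for \<sigma>
    using atom_finite_borel J that by blast
  have ind: "indep_vars (\<lambda>_. borel) (\<lambda>\<sigma> \<omega>. ?a \<sigma> * W (?A \<sigma>) \<omega>) ?I"
    using indep_vars_compose2[OF W_indep[of ?I ?A], of "\<lambda>\<sigma> x. ?a \<sigma> * x" "\<lambda>_. borel"]
    by (auto simp: J disjoint_atoms fb)
  have "distr M borel (noise_sum W J c A) = distr M borel (noise_sum W ?I ?a ?A)"
  proof (rule distr_cong_AE)
    have "AE \<omega> in M. \<forall>c. noise_sum W J c A \<omega> = noise_sum W ?I (\<lambda>\<sigma>. \<Sum>j\<in>\<sigma>. c j) ?A \<omega>"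
      by (rule W_atoms) (use J in auto)
    then show "AE \<omega> in M. noise_sum W J c A \<omega> = noise_sum W ?I ?a ?A \<omega>"
      by eventually_elim blast
  qed (use J fb in \<open>auto intro!: noise_sum_measurable\<close>)
  then have "char (distr M borel (noise_sum W J c A)) u =
      (\<Prod>\<sigma>\<in>?I. char (distr M borel (\<lambda>\<omega>. ?a \<sigma> * W (?A \<sigma>) \<omega>)) u)"
    using char_distr_sum[OF ind, of u] by (simp add: noise_sum_def[abs_def])
  also have "\<dots> = (\<Prod>\<sigma>\<in>?I. complex_of_real (exp (- (measure lborel (?A \<sigma>) * \<bar>?a \<sigma>\<bar> powr \<alpha> * \<bar>u\<bar> powr \<alpha>))))"
    by (intro prod.cong refl) (simp add: char_W_scale fb mult_ac)
  also have "\<dots> = complex_of_real (exp (- ((\<Sum>\<sigma>\<in>?I. measure lborel (?A \<sigma>) * \<bar>?a \<sigma>\<bar> powr \<alpha>) * \<bar>u\<bar> powr \<alpha>)))"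
    using J by (simp add: of_real_prod[symmetric] exp_sum[symmetric] sum_distrib_right sum_negf)
  finally show ?thesis
    by (simp add: step_integral[OF J] enn2real_ennreal sum_nonneg)
qed

lemma expectation_cos_noise_sum:
  assumes J: "finite J" "\<And>j. j \<in> J \<Longrightarrow> A j \<in> finite_borel S"
  shows "expectation (\<lambda>\<omega>. cos (u * noise_sum W J c A \<omega>)) = 
    exp (- (enn2real (\<integral>\<^sup>+s\<in>S. ennreal (\<bar>step J c A s\<bar> powr \<alpha>) \<partial>lborel) * \<bar>u\<bar> powr \<alpha>))"
proof -
  let ?X = "noise_sum W J c A"
  have [measurable]: "?X \<in> borel_measurable M" using J by auto
  have "Re (char (distr M borel ?X) u) = Re (CLINT \<omega>|M. iexp (u * ?X \<omega>))"
    unfolding char_def by (subst integral_distr) auto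
  also have "\<dots> = (LINT \<omega>|M. Re (iexp (u * ?X \<omega>)))"
    by (rule integral_Re[symmetric]) (auto intro!: integrable_iexp)
  also have "\<dots> = expectation (\<lambda>\<omega>. cos (u * ?X \<omega>))"
    by (simp add: Re_exp)
  finally show ?thesis by (simp add: char_noise_sum[OF J])
qed

end

lemma abs_powr_add_le:
  fixes x y a :: real
  assumes "0 < a" "a \<le> 2"
  shows "\<bar>x + y\<bar> powr a \<le> 4 * (\<bar>x\<bar> powr a + \<bar>y\<bar> powr a)"
proof -
  have two: "2 powr a \<le> (4::real)" using powr_mono[of a 2 "2::real"] assms by simp
  have "\<bar>x + y\<bar> powr a \<le> (2 * max \<bar>x\<bar> \<bar>y\<bar>) powr a"
    using assms by (intro powr_mono2) auto
  also have "\<dots> = 2 powr a * (max \<bar>x\<bar> \<bar>y\<bar>) powr a" by (simp add: powr_mult)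
  also have "\<dots> \<le> 4 * (max \<bar>x\<bar> \<bar>y\<bar>) powr a" using two by (intro mult_right_mono) auto
  also have "\<dots> \<le> 4 * (\<bar>x\<bar> powr a + \<bar>y\<bar> powr a)" by (auto simp: max_def)
  finally show ?thesis .
qed

lemma one_minus_cos_integral:
  fixes x u :: real
  assumes "u > 0"
  shows "(\<integral>\<^sup>+v\<in>{0..u}. ennreal (1 - cos (v * x)) \<partial>lborel) \<ge> ennreal (u / 2) * indicator {x. \<bar>x\<bar> \<ge> 2 / u} x"
proof (cases "\<bar>x\<bar> \<ge> 2 / u")
  case True
  have x0: "x \<noteq> 0" using True assms by auto
  have "(\<integral>\<^sup>+v\<in>{0..u}. ennreal (1 - cos (v * x)) \<partial>lborel) =
      ennreal ((u - sin (u * x) / x) - (0 - sin (0 * x) / x))"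
    using x0 assms by (intro nn_integral_FTC_Icc) (auto intro!: derivative_eq_intros simp: field_simps)
  moreover have "sin (u * x) / x \<le> u / 2"
  proof -
    have "\<bar>sin (u * x) / x\<bar> \<le> 1 / \<bar>x\<bar>" by (simp add: divide_right_mono)
    also have "\<dots> \<le> u / 2" using True assms x0 by (simp add: field_simps)
    finally show ?thesis by (rule order_trans[OF abs_ge_self])
  qed
  ultimately show ?thesis using True by (auto intro!: ennreal_leI)
qed auto

text \<open>Averaging \<open>1 - cos (v X)\<close> over frequencies \<open>v \<le> 2 / x\<close>, as in the proof of tightness in
  Levy's continuity theorem.\<close>

lemma (in prob_space) tail_from_cos:
  fixes X :: "'a \<Rightarrow> real"
  assumes X [measurable]: "X \<in> borel_measurable M" and x: "x > 0" and a: "0 < a" "a \<le> 2" and "0 \<le> \<sigma>"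
    and cos: "\<And>v. 0 \<le> v \<Longrightarrow> expectation (\<lambda>\<omega>. cos (v * X \<omega>)) \<ge> 1 - \<sigma> * v powr a"
  shows "emeasure M {\<omega> \<in> space M. \<bar>X \<omega>\<bar> \<ge> x} \<le> ennreal (8 * x powr (- a) * \<sigma>)"
proof -
  interpret pair_sigma_finite lborel M ..
  define u where "u = 2 / x"
  have u: "u > 0" "2 / u = x" using x by (auto simp: u_def)
  have "ennreal (u / 2) * emeasure M {\<omega> \<in> space M. \<bar>X \<omega>\<bar> \<ge> x} =
      (\<integral>\<^sup>+\<omega>. ennreal (u / 2) * indicator {x. \<bar>x\<bar> \<ge> 2 / u} (X \<omega>) \<partial>M)"
    unfolding u by (subst nn_integral_cmult_indicator[symmetric])
      (auto intro!: nn_integral_cong simp: indicator_def)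
  also have "\<dots> \<le> (\<integral>\<^sup>+\<omega>. (\<integral>\<^sup>+v\<in>{0..u}. ennreal (1 - cos (v * X \<omega>)) \<partial>lborel) \<partial>M)"
    by (intro nn_integral_mono one_minus_cos_integral u)
  also have "\<dots> = (\<integral>\<^sup>+v. (\<integral>\<^sup>+\<omega>. ennreal (1 - cos (v * X \<omega>)) * indicator {0..u} v \<partial>M) \<partial>lborel)"
    by (rule Fubini') measurable
  also have "\<dots> \<le> (\<integral>\<^sup>+v. ennreal (\<sigma> * u powr a) * indicator {0..u} v \<partial>lborel)"
  proof (rule nn_integral_mono)
    fix v :: real
    have int: "integrable M (\<lambda>\<omega>. cos (v * X \<omega>))"
      by (rule integrable_const_bound[where B=1]) auto
    show "(\<integral>\<^sup>+\<omega>. ennreal (1 - cos (v * X \<omega>)) * indicator {0..u} v \<partial>M) \<le> ennreal (\<sigma> * u powr a) * indicator {0..u} v"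
    proof (cases "v \<in> {0..u}")
      case True
      have "(\<integral>\<^sup>+\<omega>. ennreal (1 - cos (v * X \<omega>)) \<partial>M) = ennreal (1 - expectation (\<lambda>\<omega>. cos (v * X \<omega>)))"
        using int by (subst nn_integral_eq_integral) (auto simp: prob_space)
      also have "\<dots> \<le> ennreal (\<sigma> * v powr a)" using cos[of v] True by (intro ennreal_leI) auto
      also have "\<dots> \<le> ennreal (\<sigma> * u powr a)"
        using True assms by (intro ennreal_leI mult_left_mono powr_mono2) auto
      finally show ?thesis using True by simp
    qed auto
  qed
  also have "\<dots> = ennreal (\<sigma> * u powr a * u)"
    using u assms by (subst nn_integral_cmult_indicator) (auto simp: ennreal_mult)
  finally have "ennreal (2 / u) * (ennreal (u / 2) * emeasure M {\<omega> \<in> space M. \<bar>X \<omega>\<bar> \<ge> x}) \<le>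
      ennreal (2 / u) * ennreal (\<sigma> * u powr a * u)" by (rule mult_left_mono) simp
  also have "ennreal (2 / u) * (ennreal (u / 2) * emeasure M {\<omega> \<in> space M. \<bar>X \<omega>\<bar> \<ge> x}) =
      emeasure M {\<omega> \<in> space M. \<bar>X \<omega>\<bar> \<ge> x}"
    using u by (subst mult.assoc[symmetric], subst ennreal_mult[symmetric]) auto
  also have "ennreal (2 / u) * ennreal (\<sigma> * u powr a * u) = ennreal (2 * \<sigma> * u powr a)"
    using u assms by (subst ennreal_mult[symmetric]) auto
  also have "\<dots> \<le> ennreal (8 * x powr (- a) * \<sigma>)"
  proof (rule ennreal_leI)
    have "2 powr a \<le> (4::real)" using powr_mono[of a 2 "2::real"] assms by simp
    then have "2 powr a * x powr (-a) * \<sigma> \<le> 4 * x powr (- a) * \<sigma>"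
      using assms by (intro mult_right_mono) auto
    then show "2 * \<sigma> * u powr a \<le> 8 * x powr (- a) * \<sigma>"
      using x by (simp add: u_def powr_divide powr_minus field_simps)
  qed
  finally show ?thesis .
qed

lemma noise_sum_diff:
  assumes "finite J" "finite J'"
  shows "noise_sum W J c A \<omega> - noise_sum W J' c' A' \<omega> =
    noise_sum W (J <+> J') (case_sum c (\<lambda>j. - c' j)) (case_sum A A') \<omega>"
  unfolding noise_sum_def using assms by (simp add: sum.Plus sum_negf)

lemma step_diff:
  assumes "finite J" "finite J'"
  shows "step J c A s - step J' c' A' s = step (J <+> J') (case_sum c (\<lambda>j. - c' j)) (case_sum A A') s"
  unfolding step_def sum.Plus[OF assms] by (simp only: sum.case o_def mult_minus_left sum_negf diff_conv_add_uminus)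

lemma simple_function_step:
  assumes S: "S \<in> sets borel"
    and g: "Bochner_Integration.simple_bochner_integrable (restrict_space lborel S) g"
  defines "J \<equiv> g ` S - {0}" and "A \<equiv> (\<lambda>y. {s \<in> S. g s = y})"
  shows "finite J" "\<And>y. y \<in> J \<Longrightarrow> A y \<in> finite_borel S" "\<And>s. s \<in> S \<Longrightarrow> step J (\<lambda>y. y) A s = g s"
proof -
  have sf: "simple_function (restrict_space lborel S) g"
    and fin: "emeasure (restrict_space lborel S) {y \<in> space (restrict_space lborel S). g y \<noteq> 0} \<noteq> \<infinity>"
    using g by (auto simp: simple_bochner_integrable.simps)
  have sp: "space (restrict_space lborel S) = S" by (simp add: space_restrict_space)
  show J: "finite J" using sf by (auto simp: J_def simple_function_def sp)
  have lev: "{s \<in> S. P (g s)} \<in> sets borel" for P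
  proof -
    have "g -` {y. P y} \<inter> space (restrict_space lborel S) \<in> sets (restrict_space lborel S)"
      by (rule simple_functionD(2)[OF sf])
    moreover have "g -` {y. P y} \<inter> S = {s \<in> S. P (g s)}" by auto
    ultimately show ?thesis using S by (simp add: sp sets_restrict_space_iff)
  qed
  have "emeasure lborel {s \<in> S. g s \<noteq> 0} < \<infinity>"
    using fin lev[of "\<lambda>y. y \<noteq> 0"] S by (subst (asm) emeasure_restrict_space) (auto simp: sp less_top)
  then have *: "{s \<in> S. g s \<noteq> 0} \<in> finite_borel S"
    using lev[of "\<lambda>y. y \<noteq> 0"] by (auto simp: finite_borel_def)
  show "A y \<in> finite_borel S" if "y \<in> J" for y
    by (rule finite_borel_subset[OF *]) (use that lev in \<open>auto simp: J_def A_def\<close>)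
  show "step J (\<lambda>y. y) A s = g s" if "s \<in> S" for s
  proof -
    have "step J (\<lambda>y. y) A s = (\<Sum>y\<in>J. if y = g s then y else 0)"
      unfolding step_def A_def using that by (intro sum.cong) (auto simp: indicator_def)
    also have "\<dots> = g s" using that J by (subst sum.delta) (auto simp: J_def)
    finally show ?thesis .
  qed
qed

context stable_noise
begin

abbreviation La :: "(real ^ 'n \<Rightarrow> real) \<Rightarrow> ennreal" where
  "La f \<equiv> \<integral>\<^sup>+s\<in>S. ennreal (\<bar>f s\<bar> powr \<alpha>) \<partial>lborel"

lemma La_triangle:
  assumes [measurable]: "f \<in> borel_measurable (restrict_space borel S)" "g \<in> borel_measurable (restrict_space borel S)"
    and h: "\<And>s. s \<in> S \<Longrightarrow> h s = f s + g s"
  shows "La h \<le> 4 * (La f + La g)"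
proof -
  have m: "(\<lambda>s. ennreal (\<bar>f s\<bar> powr \<alpha>) * indicator S s) \<in> borel_measurable lborel"
    if "f \<in> borel_measurable (restrict_space borel S)" for f
  proof -
    have "(\<lambda>s. ennreal (\<bar>f s\<bar> powr \<alpha>)) \<in> borel_measurable (restrict_space borel S)"
      using that by measurable
    then show ?thesis by (subst (asm) borel_measurable_restrict_space_iff_ennreal) auto
  qed
  have "La h \<le> (\<integral>\<^sup>+s. 4 * (ennreal (\<bar>f s\<bar> powr \<alpha>) * indicator S s + ennreal (\<bar>g s\<bar> powr \<alpha>) * indicator S s) \<partial>lborel)"
  proof (rule nn_integral_mono)
    fix s
    have "ennreal (\<bar>f s + g s\<bar> powr \<alpha>) \<le> ennreal (4 * (\<bar>f s\<bar> powr \<alpha> + \<bar>g s\<bar> powr \<alpha>))"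
      using alpha by (intro ennreal_leI abs_powr_add_le) auto
    then show "ennreal (\<bar>h s\<bar> powr \<alpha>) * indicator S s \<le>
        4 * (ennreal (\<bar>f s\<bar> powr \<alpha>) * indicator S s + ennreal (\<bar>g s\<bar> powr \<alpha>) * indicator S s)"
      by (auto simp: indicator_def ennreal_mult h)
  qed
  also have "\<dots> = 4 * (La f + La g)"
    using m[OF assms(1)] m[OF assms(2)]
    by (subst nn_integral_cmult) (auto simp: nn_integral_add)
  finally show ?thesis .
qed

lemma La_step_finite:
  assumes "finite J" "\<And>j. j \<in> J \<Longrightarrow> A j \<in> finite_borel S"
  shows "La (step J c A) < \<infinity>"
  by (subst step_integral[OF assms]) auto

lemma step_measurable_restrict:
  assumes "\<And>j. j \<in> J \<Longrightarrow> A j \<in> finite_borel S"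
  shows "step J c A \<in> borel_measurable (restrict_space borel S)"
  using assms by (intro measurable_restrict_space1 step_measurable finite_borelD(1)) auto

lemma noise_sum_tail:
  assumes J: "finite J" "\<And>j. j \<in> J \<Longrightarrow> A j \<in> finite_borel S" and x: "x > 0"
  shows "emeasure M {\<omega> \<in> space M. \<bar>noise_sum W J c A \<omega>\<bar> \<ge> x} \<le> ennreal (8 * x powr (- \<alpha>)) * La (step J c A)"
proof -
  let ?\<sigma> = "enn2real (La (step J c A))"
  have "emeasure M {\<omega> \<in> space M. \<bar>noise_sum W J c A \<omega>\<bar> \<ge> x} \<le> ennreal (8 * x powr (- \<alpha>) * ?\<sigma>)"
  proof (rule tail_from_cos)
    fix v :: real assume "0 \<le> v"
    then show "1 - ?\<sigma> * v powr \<alpha> \<le> expectation (\<lambda>\<omega>. cos (v * noise_sum W J c A \<omega>))"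
      using exp_ge_add_one_self[of "- (?\<sigma> * v powr \<alpha>)"] by (subst expectation_cos_noise_sum[OF J]) auto
  qed (use alpha x J in auto)
  also have "\<dots> = ennreal (8 * x powr (- \<alpha>)) * ennreal ?\<sigma>" by (rule ennreal_mult) auto
  also have "ennreal ?\<sigma> = La (step J c A)"
    by (rule ennreal_enn2real) (rule La_step_finite[OF J, unfolded infinity_ennreal_def])
  finally show ?thesis .
qed

lemma noise_sum_diff_tail:
  assumes J: "finite J" "\<And>j. j \<in> J \<Longrightarrow> A j \<in> finite_borel S"
    and J': "finite J'" "\<And>j. j \<in> J' \<Longrightarrow> A' j \<in> finite_borel S" and x: "x > 0"
  shows "emeasure M {\<omega> \<in> space M. \<bar>noise_sum W J c A \<omega> - noise_sum W J' c' A' \<omega>\<bar> \<ge> x}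
    \<le> ennreal (8 * x powr (- \<alpha>)) * La (\<lambda>s. step J c A s - step J' c' A' s)"
  unfolding noise_sum_diff[OF J(1) J'(1)] step_diff[OF J(1) J'(1)]
  by (rule noise_sum_tail) (use J J' x in auto)

lemma simple_noise_integral_eq:
  "simple_noise_integral S W g = noise_sum W (g ` S - {0}) (\<lambda>y. y) (\<lambda>y. {s \<in> S. g s = y})"
  by (simp add: fun_eq_iff simple_noise_integral_def noise_sum_def)

lemma noise_integral_tail:
  assumes f: "has_noise_integral M \<alpha> S W f X"
    and J: "finite J" "\<And>j. j \<in> J \<Longrightarrow> A j \<in> finite_borel S" and x: "x > 0"
  shows "emeasure M {\<omega> \<in> space M. \<bar>X \<omega> - noise_sum W J c A \<omega>\<bar> \<ge> x}
    \<le> ennreal (128 * x powr (- \<alpha>)) * La (\<lambda>s. f s - step J c A s)"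
proof -
  obtain g where g: "\<And>k. Bochner_Integration.simple_bochner_integrable (restrict_space lborel S) (g k)"
    and lim: "(\<lambda>k. La (\<lambda>s. g k s - f s)) \<longlonglongrightarrow> 0"
    and prob: "tendsto_in_prob M (\<lambda>k. simple_noise_integral S W (g k)) X"
    and fL: "f \<in> L_space \<alpha> S" and X [measurable]: "X \<in> borel_measurable M"
    using f unfolding has_noise_integral_def by auto
  note fs = simple_function_step[OF S_borel g]
  have [measurable]: "simple_noise_integral S W (g k) \<in> borel_measurable M" for k
    unfolding simple_noise_integral_eq by (rule noise_sum_measurable) (use fs in auto)
  have [measurable]: "noise_sum W J c A \<in> borel_measurable M" using J by auto
  have [measurable]: "f \<in> borel_measurable (restrict_space borel S)" using fL by (auto simp: L_space_def)
  have [measurable]: "step J c A \<in> borel_measurable (restrict_space borel S)"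
    using J by (intro step_measurable_restrict) auto
  have gm [measurable]: "g k \<in> borel_measurable (restrict_space borel S)" for k
  proof -
    have "step (g k ` S - {0}) (\<lambda>y. y) (\<lambda>y. {s \<in> S. g k s = y}) \<in> borel_measurable (restrict_space borel S)"
      using fs by (intro step_measurable_restrict) auto
    then show ?thesis
      by (rule measurable_cong[THEN iffD1, rotated]) (use fs in \<open>auto simp: space_restrict_space\<close>)
  qed
  let ?B = "\<lambda>k. emeasure M {\<omega> \<in> space M. \<bar>simple_noise_integral S W (g k) \<omega> - X \<omega>\<bar> > x / 4} +
    ennreal (128 * x powr (- \<alpha>)) * (La (\<lambda>s. g k s - f s) + La (\<lambda>s. f s - step J c A s))"
  have B: "emeasure M {\<omega> \<in> space M. \<bar>X \<omega> - noise_sum W J c A \<omega>\<bar> \<ge> x} \<le> ?B k" for k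
  proof -
    have "emeasure M {\<omega> \<in> space M. \<bar>X \<omega> - noise_sum W J c A \<omega>\<bar> \<ge> x} \<le>
      emeasure M ({\<omega> \<in> space M. \<bar>simple_noise_integral S W (g k) \<omega> - X \<omega>\<bar> > x / 4} \<union>
        {\<omega> \<in> space M. \<bar>simple_noise_integral S W (g k) \<omega> - noise_sum W J c A \<omega>\<bar> \<ge> x / 2})"
      using x by (intro emeasure_mono) (auto, smt (verit) field_sum_of_halves)
    also have "\<dots> \<le> emeasure M {\<omega> \<in> space M. \<bar>simple_noise_integral S W (g k) \<omega> - X \<omega>\<bar> > x / 4} +
        emeasure M {\<omega> \<in> space M. \<bar>simple_noise_integral S W (g k) \<omega> - noise_sum W J c A \<omega>\<bar> \<ge> x / 2}"
      by (rule emeasure_subadditive) measurable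
    also have "emeasure M {\<omega> \<in> space M. \<bar>simple_noise_integral S W (g k) \<omega> - noise_sum W J c A \<omega>\<bar> \<ge> x / 2} \<le>
      ennreal (8 * (x / 2) powr (- \<alpha>)) *
        La (\<lambda>s. step (g k ` S - {0}) (\<lambda>y. y) (\<lambda>y. {s \<in> S. g k s = y}) s - step J c A s)"
      unfolding simple_noise_integral_eq
      by (rule noise_sum_diff_tail) (use fs J x in auto)
    also have "La (\<lambda>s. step (g k ` S - {0}) (\<lambda>y. y) (\<lambda>y. {s \<in> S. g k s = y}) s - step J c A s) \<le>
        4 * (La (\<lambda>s. g k s - f s) + La (\<lambda>s. f s - step J c A s))"
      by (rule La_triangle) (auto simp: fs(3))
    also have "ennreal (8 * (x / 2) powr (- \<alpha>)) * (4 * (La (\<lambda>s. g k s - f s) + La (\<lambda>s. f s - step J c A s)))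
      \<le> ennreal (128 * x powr (- \<alpha>)) * (La (\<lambda>s. g k s - f s) + La (\<lambda>s. f s - step J c A s))"
    proof -
      have "2 powr \<alpha> \<le> (4::real)" using powr_mono[of \<alpha> 2 "2::real"] alpha by simp
      then have "2 powr \<alpha> * (32 * x powr (-\<alpha>)) \<le> 4 * (32 * x powr (- \<alpha>))"
        by (intro mult_right_mono) auto
      then have *: "8 * (x / 2) powr (- \<alpha>) * 4 \<le> 128 * x powr (- \<alpha>)"
        using x by (simp add: powr_divide powr_minus field_simps)
      have "ennreal (8 * (x / 2) powr (- \<alpha>)) * 4 = ennreal (8 * (x / 2) powr (- \<alpha>)) * ennreal 4"
        by simp
      also have "\<dots> = ennreal (8 * (x / 2) powr (- \<alpha>) * 4)" by (rule ennreal_mult[symmetric]) auto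
      also have "\<dots> \<le> ennreal (128 * x powr (- \<alpha>))" by (rule ennreal_leI[OF *])
      finally have "ennreal (8 * (x / 2) powr (- \<alpha>)) * 4 \<le> ennreal (128 * x powr (- \<alpha>))" .
      from mult_right_mono[OF this zero_le] show ?thesis by (simp only: mult.assoc)
    qed
    finally show ?thesis by (auto simp: add_left_mono mult_left_mono)
  qed
  have "x / 4 > 0" using x by simp
  from tendsto_ennrealI[OF prob[unfolded tendsto_in_prob_def, rule_format, OF this]]
  have "(\<lambda>k. emeasure M {\<omega> \<in> space M. \<bar>simple_noise_integral S W (g k) \<omega> - X \<omega>\<bar> > x / 4}) \<longlonglongrightarrow> 0"
    by (simp only: emeasure_eq_measure ennreal_0)
  then have "?B \<longlonglongrightarrow> 0 + ennreal (128 * x powr (- \<alpha>)) * (0 + La (\<lambda>s. f s - step J c A s))"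
    using lim by (intro tendsto_add ennreal_tendsto_cmult tendsto_const) auto
  then show ?thesis using B by (intro LIMSEQ_le_const[of ?B]) auto
qed

lemma noise_integral_unique:
  assumes "has_noise_integral M \<alpha> S W f X" "has_noise_integral M \<alpha> S W f Y"
  shows "AE \<omega> in M. X \<omega> = Y \<omega>"
proof -
  obtain g where g: "\<And>k. Bochner_Integration.simple_bochner_integrable (restrict_space lborel S) (g k)"
    and lim: "(\<lambda>k. La (\<lambda>s. g k s - f s)) \<longlonglongrightarrow> 0"
    and prob: "tendsto_in_prob M (\<lambda>k. simple_noise_integral S W (g k)) Y"
    and Y [measurable]: "Y \<in> borel_measurable M"
    using assms(2) unfolding has_noise_integral_def by auto
  have [measurable]: "X \<in> borel_measurable M" using assms(1) by (auto simp: has_noise_integral_def)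
  note fs = simple_function_step[OF S_borel g]
  have [measurable]: "simple_noise_integral S W (g k) \<in> borel_measurable M" for k
    unfolding simple_noise_integral_eq by (rule noise_sum_measurable) (use fs in auto)
  have null: "emeasure M {\<omega> \<in> space M. \<bar>X \<omega> - Y \<omega>\<bar> \<ge> x} = 0" if x: "x > 0" for x
  proof -
    let ?B = "\<lambda>k. emeasure M {\<omega> \<in> space M. \<bar>simple_noise_integral S W (g k) \<omega> - Y \<omega>\<bar> > x / 4} +
      ennreal (128 * (x / 2) powr (- \<alpha>)) * La (\<lambda>s. g k s - f s)"
    have B: "emeasure M {\<omega> \<in> space M. \<bar>X \<omega> - Y \<omega>\<bar> \<ge> x} \<le> ?B k" for k
    proof -
      have "emeasure M {\<omega> \<in> space M. \<bar>X \<omega> - Y \<omega>\<bar> \<ge> x} \<le>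
        emeasure M ({\<omega> \<in> space M. \<bar>simple_noise_integral S W (g k) \<omega> - Y \<omega>\<bar> > x / 4} \<union>
          {\<omega> \<in> space M. \<bar>X \<omega> - simple_noise_integral S W (g k) \<omega>\<bar> \<ge> x / 2})"
        using x by (intro emeasure_mono) (auto, smt (verit) field_sum_of_halves)
      also have "\<dots> \<le> emeasure M {\<omega> \<in> space M. \<bar>simple_noise_integral S W (g k) \<omega> - Y \<omega>\<bar> > x / 4} +
          emeasure M {\<omega> \<in> space M. \<bar>X \<omega> - simple_noise_integral S W (g k) \<omega>\<bar> \<ge> x / 2}"
        by (rule emeasure_subadditive) measurable
      also have "emeasure M {\<omega> \<in> space M. \<bar>X \<omega> - simple_noise_integral S W (g k) \<omega>\<bar> \<ge> x / 2} \<le>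
        ennreal (128 * (x / 2) powr (- \<alpha>)) *
          La (\<lambda>s. f s - step (g k ` S - {0}) (\<lambda>y. y) (\<lambda>y. {s \<in> S. g k s = y}) s)"
        unfolding simple_noise_integral_eq
        by (rule noise_integral_tail) (use fs assms x in auto)
      also have "La (\<lambda>s. f s - step (g k ` S - {0}) (\<lambda>y. y) (\<lambda>y. {s \<in> S. g k s = y}) s) = La (\<lambda>s. g k s - f s)"
        by (intro nn_integral_cong) (auto simp: indicator_def fs(3) abs_minus_commute)
      finally show ?thesis by (auto simp: add_left_mono)
    qed
    have "x / 4 > 0" using x by simp
    from tendsto_ennrealI[OF prob[unfolded tendsto_in_prob_def, rule_format, OF this]]
    have "(\<lambda>k. emeasure M {\<omega> \<in> space M. \<bar>simple_noise_integral S W (g k) \<omega> - Y \<omega>\<bar> > x / 4}) \<longlonglongrightarrow> 0"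
      by (simp only: emeasure_eq_measure ennreal_0)
    then have "?B \<longlonglongrightarrow> 0 + ennreal (128 * (x / 2) powr (- \<alpha>)) * 0"
      using lim by (intro tendsto_add ennreal_tendsto_cmult) auto
    then have "emeasure M {\<omega> \<in> space M. \<bar>X \<omega> - Y \<omega>\<bar> \<ge> x} \<le> 0"
      using B by (intro LIMSEQ_le_const[of ?B]) auto
    then show ?thesis by simp
  qed
  have "AE \<omega> in M. \<forall>n. \<bar>X \<omega> - Y \<omega>\<bar> < inverse (real (Suc n))"
    unfolding AE_all_countable
  proof
    fix n show "AE \<omega> in M. \<bar>X \<omega> - Y \<omega>\<bar> < inverse (real (Suc n))"
      by (rule AE_I[where N="{\<omega> \<in> space M. \<bar>X \<omega> - Y \<omega>\<bar> \<ge> inverse (real (Suc n))}"]) (auto intro: null)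
  qed
  then show ?thesis
  proof eventually_elim
    case (elim \<omega>)
    show ?case
    proof (rule ccontr)
      assume "X \<omega> \<noteq> Y \<omega>"
      then obtain n where "inverse (real (Suc n)) < \<bar>X \<omega> - Y \<omega>\<bar>"
        using reals_Archimedean[of "\<bar>X \<omega> - Y \<omega>\<bar>"] by auto
      with elim show False by (meson less_asym)
    qed
  qed
qed

lemma noise_integral_from_steps:
  assumes J: "\<And>k. finite (J k)" "\<And>k j. j \<in> J k \<Longrightarrow> A k j \<in> finite_borel S"
    and f: "f \<in> L_space \<alpha> S"
    and lim: "(\<lambda>k. La (\<lambda>s. step (J k) (c k) (A k) s - f s)) \<longlonglongrightarrow> 0"
    and Z [measurable]: "Z \<in> borel_measurable M"
    and conv: "AE \<omega> in M. (\<lambda>k. noise_sum W (J k) (c k) (A k) \<omega>) \<longlonglongrightarrow> Z \<omega>"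
  shows "has_noise_integral M \<alpha> S W f Z"
  unfolding has_noise_integral_def
proof (intro conjI exI allI)
  let ?g = "\<lambda>k. step (J k) (c k) (A k)" and ?N = "\<lambda>k. noise_sum W (J k) (c k) (A k)"
  have [measurable]: "?N k \<in> borel_measurable M" for k using J by auto
  show g: "Bochner_Integration.simple_bochner_integrable (restrict_space lborel S) (?g k)" for k
    unfolding simple_bochner_integrable.simps
  proof
    have U: "(\<Union>j\<in>J k. A k j) \<in> finite_borel S" using J by (intro finite_borel_UN) auto
    have "?g k ` UNIV \<subseteq> (\<lambda>K. \<Sum>j\<in>K. c k j) ` Pow (J k)"
    proof (clarsimp)
      fix s
      have "step (J k) (c k) (A k) s = (\<Sum>j\<in>{j\<in>J k. s \<in> A k j}. c k j)"
        by (rule step_atom) (use J in \<open>auto simp: atom_def\<close>)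
      then show "step (J k) (c k) (A k) s \<in> sum (c k) ` Pow (J k)" by auto
    qed
    then have "finite (range (?g k))" by (rule finite_subset) (use J in auto)
    then have fin: "finite (?g k ` S)" by (rule finite_subset[rotated]) auto
    have "?g k \<in> borel_measurable (restrict_space borel S)"
      using J by (intro step_measurable_restrict) auto
    then have m: "?g k \<in> borel_measurable (restrict_space lborel S)"
      by (subst measurable_cong_sets[OF _ refl, of _ "restrict_space borel S"]) (simp_all add: sets_restrict_space)
    show "simple_function (restrict_space lborel S) (?g k)"
      by (rule simple_function_borel_measurable[OF m]) (use fin in \<open>simp add: space_restrict_space\<close>)
    have "y \<in> (\<Union>j\<in>J k. A k j)" if "?g k y \<noteq> 0" for y
      using that step_zero[of y "A k" "J k" "c k"] by (rule contrapos_np)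
    then have "{y \<in> S. ?g k y \<noteq> 0} \<subseteq> (\<Union>j\<in>J k. A k j)" by (rule subsetI) simp
    then have "emeasure lborel {y \<in> S. ?g k y \<noteq> 0} \<le> emeasure lborel (\<Union>j\<in>J k. A k j)"
      using U by (intro emeasure_mono) (auto simp: finite_borel_def)
    also have "\<dots> < \<infinity>" using finite_borelD(3)[OF U] .
    finally show "emeasure (restrict_space lborel S) {y \<in> space (restrict_space lborel S). ?g k y \<noteq> 0} \<noteq> \<infinity>"
      by (subst emeasure_restrict_space) (auto simp: space_restrict_space)
  qed
  note fs = simple_function_step[OF S_borel g]
  have [measurable]: "simple_noise_integral S W (?g k) \<in> borel_measurable M" for k
    unfolding simple_noise_integral_eq by (rule noise_sum_measurable) (use fs in auto)
  have null: "measure M {\<omega> \<in> space M. \<bar>simple_noise_integral S W (?g k) \<omega> - ?N k \<omega>\<bar> \<ge> x} = 0" if "x > 0" for k x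
  proof -
    let ?I = "?g k ` S - {0}" and ?B = "\<lambda>y. {s \<in> S. ?g k s = y}"
    have "emeasure M {\<omega> \<in> space M. \<bar>simple_noise_integral S W (?g k) \<omega> - ?N k \<omega>\<bar> \<ge> x} \<le>
      ennreal (8 * x powr (- \<alpha>)) * La (\<lambda>s. step ?I (\<lambda>y. y) ?B s - step (J k) (c k) (A k) s)"
      unfolding simple_noise_integral_eq
      by (rule noise_sum_diff_tail) (use fs J that in auto)
    also have "La (\<lambda>s. step ?I (\<lambda>y. y) ?B s - step (J k) (c k) (A k) s) = (\<integral>\<^sup>+s. 0 \<partial>(lborel :: (real^'n) measure))"
      by (intro nn_integral_cong) (use fs(3) in \<open>auto simp: indicator_def\<close>)
    finally show ?thesis by (simp add: emeasure_eq_measure)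
  qed
  have lim0: "(\<lambda>k. measure M {\<omega> \<in> space M. \<bar>?N k \<omega> - Z \<omega>\<bar> \<ge> x}) \<longlonglongrightarrow> 0" if x: "x > 0" for x
  proof -
    have "(\<lambda>k. \<integral>\<omega>. indicator {\<omega> \<in> space M. \<bar>?N k \<omega> - Z \<omega>\<bar> \<ge> x} \<omega> \<partial>M) \<longlonglongrightarrow> (\<integral>\<omega>. (0::real) \<partial>M)"
    proof (rule integral_dominated_convergence[where w="\<lambda>_. 1"])
      show "AE \<omega> in M. (\<lambda>k. indicat_real {\<omega> \<in> space M. \<bar>?N k \<omega> - Z \<omega>\<bar> \<ge> x} \<omega>) \<longlonglongrightarrow> 0"
        using conv
      proof eventually_elim
        case (elim \<omega>)
        then have "eventually (\<lambda>k. dist (?N k \<omega>) (Z \<omega>) < x) sequentially" using x by (rule tendstoD)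
        then have "eventually (\<lambda>k. indicat_real {\<omega> \<in> space M. \<bar>?N k \<omega> - Z \<omega>\<bar> \<ge> x} \<omega> = 0) sequentially"
          by eventually_elim (auto simp: dist_real_def)
        then show ?case by (rule tendsto_eventually)
      qed
    qed auto
    then show ?thesis by simp
  qed
  show "tendsto_in_prob M (\<lambda>k. simple_noise_integral S W (?g k)) Z"
    unfolding tendsto_in_prob_def
  proof (intro allI impI)
    fix e :: real assume e: "e > 0"
    show "(\<lambda>k. prob {\<omega> \<in> space M. e < \<bar>simple_noise_integral S W (?g k) \<omega> - Z \<omega>\<bar>}) \<longlonglongrightarrow> 0"
    proof (rule tendsto_sandwich[OF _ _ tendsto_const lim0[of "e / 2"]])
      show "\<forall>\<^sub>F k in sequentially. prob {\<omega> \<in> space M. e < \<bar>simple_noise_integral S W (?g k) \<omega> - Z \<omega>\<bar>}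
          \<le> prob {\<omega> \<in> space M. e / 2 \<le> \<bar>?N k \<omega> - Z \<omega>\<bar>}"
      proof (intro always_eventually allI)
        fix k
        have "prob {\<omega> \<in> space M. e < \<bar>simple_noise_integral S W (?g k) \<omega> - Z \<omega>\<bar>} \<le>
          prob ({\<omega> \<in> space M. \<bar>simple_noise_integral S W (?g k) \<omega> - ?N k \<omega>\<bar> \<ge> e / 2} \<union>
            {\<omega> \<in> space M. e / 2 \<le> \<bar>?N k \<omega> - Z \<omega>\<bar>})"
          by (intro finite_measure_mono) (auto, smt (verit) field_sum_of_halves)
        also have "\<dots> \<le> prob {\<omega> \<in> space M. \<bar>simple_noise_integral S W (?g k) \<omega> - ?N k \<omega>\<bar> \<ge> e / 2} +
            prob {\<omega> \<in> space M. e / 2 \<le> \<bar>?N k \<omega> - Z \<omega>\<bar>}"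
          by (rule measure_Un_le) auto
        finally show "prob {\<omega> \<in> space M. e < \<bar>simple_noise_integral S W (?g k) \<omega> - Z \<omega>\<bar>} \<le>
            prob {\<omega> \<in> space M. e / 2 \<le> \<bar>?N k \<omega> - Z \<omega>\<bar>}"
          using null[of "e / 2" k] e by simp
      qed
    qed (use e in auto)
  qed
qed (use f lim Z in auto)

text \<open>Almost sure convergence of the integrals of step functions forces convergence of the step
  functions in \<open>L\<^sup>\<alpha>\<close>, because the law of a noise sum determines the norm of its integrand.\<close>

lemma noise_integral_from_AE_limits:
  assumes J: "\<And>k. finite (J k)" "\<And>k j. j \<in> J k \<Longrightarrow> A k j \<in> finite_borel S"
    and f [measurable]: "f \<in> borel_measurable borel"
    and pw: "AE s in lborel. s \<in> S \<longrightarrow> (\<lambda>k. step (J k) (c k) (A k) s) \<longlonglongrightarrow> f s"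
    and Z [measurable]: "Z \<in> borel_measurable M"
    and conv: "AE \<omega> in M. (\<lambda>k. noise_sum W (J k) (c k) (A k) \<omega>) \<longlonglongrightarrow> Z \<omega>"
  shows "has_noise_integral M \<alpha> S W f Z"
proof -
  let ?g = "\<lambda>k. step (J k) (c k) (A k)" and ?N = "\<lambda>k. noise_sum W (J k) (c k) (A k)"
  have [measurable]: "?N k \<in> borel_measurable M" for k using J by auto
  have gm [measurable]: "?g k \<in> borel_measurable borel" for k
    using J by (intro step_measurable) (auto intro: finite_borelD(1))
  define q where "q k = expectation (\<lambda>\<omega>. cos (?N k \<omega> - Z \<omega>))" for k
  have q1: "q \<longlonglongrightarrow> 1"
  proof -
    have "q \<longlonglongrightarrow> expectation (\<lambda>\<omega>. 1)" unfolding q_def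
    proof (rule integral_dominated_convergence[where w="\<lambda>_. 1"])
      show "AE \<omega> in M. (\<lambda>k. cos (?N k \<omega> - Z \<omega>)) \<longlonglongrightarrow> 1" using conv
      proof eventually_elim
        case (elim \<omega>)
        then have "(\<lambda>k. cos (?N k \<omega> - Z \<omega>)) \<longlonglongrightarrow> cos (Z \<omega> - Z \<omega>)" by (intro tendsto_intros)
        then show ?case by simp
      qed
    qed auto
    then show ?thesis by (simp add: prob_space)
  qed
  have key: "La (\<lambda>s. ?g k s - f s) \<le> ennreal (- ln (q k))" if q: "q k > 0" for k
  proof -
    define D where "D l = enn2real (La (\<lambda>s. ?g k s - ?g l s))" for l
    have La_D: "La (\<lambda>s. ?g k s - ?g l s) = ennreal (D l)" for l
    proof -
      have "La (step (J k <+> J l) (case_sum (c k) (\<lambda>j. - c l j)) (case_sum (A k) (A l))) < \<infinity>"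
        by (rule La_step_finite) (use J in auto)
      then show ?thesis unfolding D_def step_diff[OF J(1) J(1)] by (simp add: ennreal_enn2real)
    qed
    have "(\<lambda>l. expectation (\<lambda>\<omega>. cos (?N k \<omega> - ?N l \<omega>))) \<longlonglongrightarrow> q k" unfolding q_def
    proof (rule integral_dominated_convergence[where w="\<lambda>_. 1"])
      show "AE \<omega> in M. (\<lambda>l. cos (?N k \<omega> - ?N l \<omega>)) \<longlonglongrightarrow> cos (?N k \<omega> - Z \<omega>)" using conv
        by eventually_elim (intro tendsto_intros)
    qed auto
    moreover have "expectation (\<lambda>\<omega>. cos (?N k \<omega> - ?N l \<omega>)) = exp (- D l)" for l
    proof -
      have fb: "\<And>j. j \<in> J k <+> J l \<Longrightarrow> case_sum (A k) (A l) j \<in> finite_borel S"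
        using J(2) by auto
      show ?thesis
        using expectation_cos_noise_sum[where u = 1 and c = "case_sum (c k) (\<lambda>j. - c l j)",
            OF finite_Plus[OF J(1) J(1)] fb]
        unfolding D_def step_diff[OF J(1) J(1)] noise_sum_diff[OF J(1) J(1)] by simp
    qed
    ultimately have "(\<lambda>l. exp (- D l)) \<longlonglongrightarrow> q k" by simp
    then have "(\<lambda>l. - ln (exp (- D l))) \<longlonglongrightarrow> - ln (q k)" using q by (intro tendsto_intros) auto
    then have Dl: "D \<longlonglongrightarrow> - ln (q k)" by simp
    have "La (\<lambda>s. ?g k s - f s) \<le> (\<integral>\<^sup>+s. liminf (\<lambda>l. ennreal (\<bar>?g k s - ?g l s\<bar> powr \<alpha>) * indicator S s) \<partial>lborel)"
    proof (rule nn_integral_mono_AE)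
      show "AE s in lborel. ennreal (\<bar>?g k s - f s\<bar> powr \<alpha>) * indicator S s \<le>
          liminf (\<lambda>l. ennreal (\<bar>?g k s - ?g l s\<bar> powr \<alpha>) * indicator S s)"
        using pw
      proof eventually_elim
        case (elim s)
        show ?case
        proof (cases "s \<in> S")
          case True
          then have "(\<lambda>l. ennreal (\<bar>?g k s - ?g l s\<bar> powr \<alpha>)) \<longlonglongrightarrow> ennreal (\<bar>?g k s - f s\<bar> powr \<alpha>)"
            using elim alpha by (intro tendsto_ennrealI tendsto_powr2 tendsto_intros) auto
          from lim_imp_Liminf[OF _ this] show ?thesis using True by simp
        qed auto
      qed
    qed
    also have "\<dots> \<le> liminf (\<lambda>l. La (\<lambda>s. ?g k s - ?g l s))"
      by (rule nn_integral_liminf) measurable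
    also have "\<dots> = liminf (\<lambda>l. ennreal (D l))" by (simp add: La_D)
    also have "\<dots> = ennreal (- ln (q k))"
      by (intro lim_imp_Liminf tendsto_ennrealI Dl) auto
    finally show ?thesis .
  qed
  have qpos: "eventually (\<lambda>k. q k > 0) sequentially"
    using q1 by (rule order_tendstoD) simp
  have "(\<lambda>k. ennreal (- ln (q k))) \<longlonglongrightarrow> ennreal (- ln 1)"
    using q1 by (intro tendsto_ennrealI tendsto_intros) auto
  then have lnq: "(\<lambda>k. ennreal (- ln (q k))) \<longlonglongrightarrow> 0" by simp
  have lim: "(\<lambda>k. La (\<lambda>s. ?g k s - f s)) \<longlonglongrightarrow> 0"
    by (rule tendsto_sandwich[OF _ _ tendsto_const lnq])
       (use qpos in \<open>auto elim!: eventually_mono intro: key\<close>)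
  have "f \<in> L_space \<alpha> S"
    unfolding L_space_def
  proof (safe)
    show "f \<in> borel_measurable (restrict_space borel S)" by (rule measurable_restrict_space1[OF f])
    obtain k where "q k > 0" using eventually_happens[OF qpos] by auto
    have "La f \<le> 4 * (La (\<lambda>s. - (?g k s - f s)) + La (?g k))"
      by (rule La_triangle) (auto intro!: measurable_restrict_space1)
    also have "La (\<lambda>s. - (?g k s - f s)) = La (\<lambda>s. ?g k s - f s)" by (simp only: abs_minus_cancel)
    also have "4 * (La (\<lambda>s. ?g k s - f s) + La (?g k)) < \<infinity>"
      using key[OF \<open>q k > 0\<close>] La_step_finite[of "J k" "A k" "c k"] J
      by (auto simp: ennreal_mult_less_top intro: le_less_trans)
    finally show "La f < \<infinity>" .
  qed
  from noise_integral_from_steps[OF J this lim Z conv] show ?thesis .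
qed

end

section \<open>A weak type inequality\<close>

text \<open>Up to a constant, \<open>Psi \<alpha> x \<tau> b\<close> bounds the expectation of \<open>min (Y\<^sup>2 / \<tau>) \<bar>Y\<bar>\<close>, where \<open>Y\<close> is \<open>x\<close>
  times a symmetric stable variable of unit scale that is set to \<open>0\<close> when it exceeds \<open>b\<close>.\<close>

definition Psi :: "real \<Rightarrow> real \<Rightarrow> real \<Rightarrow> real \<Rightarrow> ennreal" where
  "Psi \<alpha> x \<tau> b = (\<integral>\<^sup>+v\<in>{0..b}. ennreal (min (x\<^sup>2 * v / \<tau>) \<bar>x\<bar> * v powr (- \<alpha>)) \<partial>lborel)"

lemma Psi_zero [simp]: "Psi \<alpha> 0 \<tau> b = 0"
  by (simp add: Psi_def)

lemma Psi_measurable [measurable]: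
  assumes [measurable]: "f \<in> borel_measurable N" "g \<in> borel_measurable N" "h \<in> borel_measurable N"
  shows "(\<lambda>z. Psi \<alpha> (f z) (g z) (h z)) \<in> borel_measurable N"
  unfolding Psi_def indicator_def atLeastAtMost_iff by measurable

lemma Psi_mono:
  assumes "\<bar>x\<bar> \<le> \<bar>y\<bar>" "\<tau> > 0" "b \<le> b'"
  shows "Psi \<alpha> x \<tau> b \<le> Psi \<alpha> y \<tau> b'"
  unfolding Psi_def
proof (intro nn_integral_mono)
  fix v :: real
  show "ennreal (min (x\<^sup>2 * v / \<tau>) \<bar>x\<bar> * v powr - \<alpha>) * indicator {0..b} v
         \<le> ennreal (min (y\<^sup>2 * v / \<tau>) \<bar>y\<bar> * v powr - \<alpha>) * indicator {0..b'} v"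
  proof (cases "v \<in> {0..b}")
    case True
    have "x\<^sup>2 \<le> y\<^sup>2" using assms(1) by (simp add: abs_le_square_iff)
    then have "min (x\<^sup>2 * v / \<tau>) \<bar>x\<bar> \<le> min (y\<^sup>2 * v / \<tau>) \<bar>y\<bar>"
      using True assms by (intro min.mono divide_right_mono mult_right_mono) auto
    then show ?thesis using True assms by (auto intro!: ennreal_leI mult_right_mono)
  qed auto
qed

lemma Psi_double:
  assumes "\<tau> > 0"
  shows "Psi \<alpha> (2 * x) \<tau> b \<le> 4 * Psi \<alpha> x \<tau> b"
proof -
  have "Psi \<alpha> (2 * x) \<tau> b \<le>
      (\<integral>\<^sup>+v. 4 * (ennreal (min (x\<^sup>2 * v / \<tau>) \<bar>x\<bar> * v powr (- \<alpha>)) * indicator {0..b} v) \<partial>lborel)"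
    unfolding Psi_def
  proof (intro nn_integral_mono)
    fix v :: real
    show "ennreal (min ((2 * x)\<^sup>2 * v / \<tau>) \<bar>2 * x\<bar> * v powr - \<alpha>) * indicator {0..b} v
         \<le> 4 * (ennreal (min (x\<^sup>2 * v / \<tau>) \<bar>x\<bar> * v powr - \<alpha>) * indicator {0..b} v)"
    proof (cases "v \<in> {0..b}")
      case True
      have "min ((2 * x)\<^sup>2 * v / \<tau>) \<bar>2 * x\<bar> \<le> 4 * min (x\<^sup>2 * v / \<tau>) \<bar>x\<bar>"
        by (simp add: min_mult_distrib_left power_mult_distrib min_le_iff_disj) auto
      then have "min ((2 * x)\<^sup>2 * v / \<tau>) \<bar>2 * x\<bar> * v powr - \<alpha> \<le> 4 * min (x\<^sup>2 * v / \<tau>) \<bar>x\<bar> * v powr - \<alpha>"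
        by (rule mult_right_mono) auto
      from ennreal_leI[OF this] show ?thesis using True assms
        by (simp add: ennreal_mult[symmetric] mult.assoc flip: ennreal_numeral)
    qed auto
  qed
  also have "\<dots> = 4 * Psi \<alpha> x \<tau> b"
    unfolding Psi_def by (rule nn_integral_cmult) measurable
  finally show ?thesis .
qed

lemma Psi_add:
  assumes "\<tau> > 0"
  shows "Psi \<alpha> (x + y) \<tau> b \<le> 4 * (Psi \<alpha> x \<tau> b + Psi \<alpha> y \<tau> b)"
proof -
  define z where "z = (if \<bar>x\<bar> \<le> \<bar>y\<bar> then y else x)"
  have "Psi \<alpha> (x + y) \<tau> b \<le> Psi \<alpha> (2 * z) \<tau> b"
    using assms by (intro Psi_mono) (auto simp: z_def)
  also have "\<dots> \<le> 4 * Psi \<alpha> z \<tau> b" by (rule Psi_double[OF assms])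
  also have "\<dots> \<le> 4 * (Psi \<alpha> x \<tau> b + Psi \<alpha> y \<tau> b)"
    by (intro mult_left_mono) (auto simp: z_def add_increasing add_increasing2)
  finally show ?thesis .
qed

lemma nn_integral_id_Icc:
  fixes w :: real assumes "w \<ge> 0"
  shows "(\<integral>\<^sup>+v\<in>{0..w}. ennreal v \<partial>lborel) = ennreal (w\<^sup>2 / 2)"
proof -
  have "(\<integral>\<^sup>+v\<in>{0..w}. ennreal v \<partial>lborel) = ennreal (w\<^sup>2 / 2 - 0\<^sup>2 / 2)"
    using assms by (intro nn_integral_FTC_Icc) (auto intro!: derivative_eq_intros)
  then show ?thesis by simp
qed

lemma min_square_le_integral:
  fixes h w \<tau> :: real
  assumes "\<tau> > 0" "w \<ge> 0"
  shows "ennreal (min (h\<^sup>2 * w\<^sup>2 / \<tau>) (\<bar>h\<bar> * w)) \<le> (\<integral>\<^sup>+v\<in>{0..w}. ennreal (2 * min (h\<^sup>2 * v / \<tau>) \<bar>h\<bar>) \<partial>lborel)"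
proof (cases "w = 0")
  case False
  then have w: "w > 0" using assms by simp
  define a where "a = min (h\<^sup>2 * w / \<tau>) \<bar>h\<bar>"
  have a0: "a \<ge> 0" using assms by (auto simp: a_def)
  have "min (h\<^sup>2 * w\<^sup>2 / \<tau>) (\<bar>h\<bar> * w) = a * w"
    using w by (simp add: a_def min_mult_distrib_right power2_eq_square)
  then have "ennreal (min (h\<^sup>2 * w\<^sup>2 / \<tau>) (\<bar>h\<bar> * w)) = ennreal (2 * a / w) * ennreal (w\<^sup>2 / 2)"
    using w a0 by (simp add: ennreal_mult[symmetric] power2_eq_square)
  also have "\<dots> = (\<integral>\<^sup>+v. ennreal (2 * a / w) * (ennreal v * indicator {0..w} v) \<partial>lborel)"
    using assms by (subst nn_integral_cmult) (auto simp: nn_integral_id_Icc)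
  also have "\<dots> \<le> (\<integral>\<^sup>+v\<in>{0..w}. ennreal (2 * min (h\<^sup>2 * v / \<tau>) \<bar>h\<bar>) \<partial>lborel)"
  proof (intro nn_integral_mono)
    fix v :: real
    show "ennreal (2 * a / w) * (ennreal v * indicator {0..w} v) \<le>
        ennreal (2 * min (h\<^sup>2 * v / \<tau>) \<bar>h\<bar>) * indicator {0..w} v"
    proof (cases "v \<in> {0..w}")
      case True
      have "a * (v / w) \<le> h\<^sup>2 * w / \<tau> * (v / w)"
        using True w by (intro mult_right_mono) (auto simp: a_def)
      moreover have "a * (v / w) \<le> \<bar>h\<bar> * 1"
        using True w a0 by (intro mult_mono) (auto simp: a_def)
      ultimately have "a * (v / w) \<le> min (h\<^sup>2 * v / \<tau>) \<bar>h\<bar>" using w by simp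
      then have "2 * (a * (v / w)) \<le> 2 * min (h\<^sup>2 * v / \<tau>) \<bar>h\<bar>" by (rule mult_left_mono) simp
      then have "2 * a / w * v \<le> 2 * min (h\<^sup>2 * v / \<tau>) \<bar>h\<bar>" by (simp only: times_divide_eq_left times_divide_eq_right mult.assoc)
      then show ?thesis using True w a0 by (simp add: ennreal_mult[symmetric] ennreal_leI)
    qed auto
  qed
  finally show ?thesis .
qed auto

lemma (in prob_space) truncated_moment:
  fixes X :: "'a \<Rightarrow> real"
  assumes [measurable]: "X \<in> borel_measurable M" and \<tau>: "\<tau> > 0"
    and tail: "\<And>v. v > 0 \<Longrightarrow> emeasure M {\<omega> \<in> space M. \<bar>X \<omega>\<bar> \<ge> v} \<le> ennreal (v powr (- a)) * K"
  shows "(\<integral>\<^sup>+\<omega>. ennreal (min (h\<^sup>2 * (X \<omega>)\<^sup>2 / \<tau>) (\<bar>h\<bar> * \<bar>X \<omega>\<bar>)) * indicator {x. \<bar>x\<bar> \<le> b} (X \<omega>) \<partial>M)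
    \<le> 2 * K * Psi a h \<tau> b"
proof -
  interpret pair_sigma_finite lborel M ..
  let ?D = "\<lambda>v. ennreal (2 * min (h\<^sup>2 * v / \<tau>) \<bar>h\<bar>)"
  have "(\<integral>\<^sup>+\<omega>. ennreal (min (h\<^sup>2 * (X \<omega>)\<^sup>2 / \<tau>) (\<bar>h\<bar> * \<bar>X \<omega>\<bar>)) * indicator {x. \<bar>x\<bar> \<le> b} (X \<omega>) \<partial>M)
      \<le> (\<integral>\<^sup>+\<omega>. (\<integral>\<^sup>+v. ?D v * indicator {0..b} v * indicator {x. v \<le> \<bar>x\<bar>} (X \<omega>) \<partial>lborel) \<partial>M)"
  proof (intro nn_integral_mono)
    fix \<omega>
    show "ennreal (min (h\<^sup>2 * (X \<omega>)\<^sup>2 / \<tau>) (\<bar>h\<bar> * \<bar>X \<omega>\<bar>)) * indicator {x. \<bar>x\<bar> \<le> b} (X \<omega>)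
      \<le> (\<integral>\<^sup>+v. ?D v * indicator {0..b} v * indicator {x. v \<le> \<bar>x\<bar>} (X \<omega>) \<partial>lborel)"
    proof (cases "\<bar>X \<omega>\<bar> \<le> b")
      case True
      have "ennreal (min (h\<^sup>2 * \<bar>X \<omega>\<bar>\<^sup>2 / \<tau>) (\<bar>h\<bar> * \<bar>X \<omega>\<bar>)) \<le> (\<integral>\<^sup>+v\<in>{0..\<bar>X \<omega>\<bar>}. ?D v \<partial>lborel)"
        by (rule min_square_le_integral) (use \<tau> in auto)
      also have "\<dots> \<le> (\<integral>\<^sup>+v. ?D v * indicator {0..b} v * indicator {x. v \<le> \<bar>x\<bar>} (X \<omega>) \<partial>lborel)"
        using True by (intro nn_integral_mono) (auto simp: indicator_def)
      finally show ?thesis using True by simp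
    qed auto
  qed
  also have "\<dots> = (\<integral>\<^sup>+v. (\<integral>\<^sup>+\<omega>. ?D v * indicator {0..b} v * indicator {x. v \<le> \<bar>x\<bar>} (X \<omega>) \<partial>M) \<partial>lborel)"
    by (rule Fubini') (unfold indicator_def mem_Collect_eq, measurable)
  also have "\<dots> \<le> (\<integral>\<^sup>+v. (2 * K) * (ennreal (min (h\<^sup>2 * v / \<tau>) \<bar>h\<bar> * v powr (- a)) * indicator {0..b} v) \<partial>lborel)"
  proof (intro nn_integral_mono)
    fix v :: real
    have "(\<integral>\<^sup>+\<omega>. ?D v * indicator {0..b} v * indicator {x. v \<le> \<bar>x\<bar>} (X \<omega>) \<partial>M) =
        (\<integral>\<^sup>+\<omega>. (?D v * indicator {0..b} v) * indicator {\<omega> \<in> space M. \<bar>X \<omega>\<bar> \<ge> v} \<omega> \<partial>M)"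
      by (intro nn_integral_cong) (auto simp: indicator_def)
    also have "\<dots> = ?D v * indicator {0..b} v * emeasure M {\<omega> \<in> space M. \<bar>X \<omega>\<bar> \<ge> v}"
      by (rule nn_integral_cmult_indicator) measurable
    also have "\<dots> \<le> (2 * K) * (ennreal (min (h\<^sup>2 * v / \<tau>) \<bar>h\<bar> * v powr (- a)) * indicator {0..b} v)"
    proof (cases "v \<in> {0<..b}")
      case True
      have m: "0 \<le> min (h\<^sup>2 * v / \<tau>) \<bar>h\<bar>" using True \<tau> by auto
      have "?D v * emeasure M {\<omega> \<in> space M. \<bar>X \<omega>\<bar> \<ge> v} \<le> ?D v * (ennreal (v powr (- a)) * K)"
        using True by (intro mult_left_mono tail) auto
      also have "\<dots> = 2 * K * (ennreal (min (h\<^sup>2 * v / \<tau>) \<bar>h\<bar>) * ennreal (v powr (- a)))"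
        using m by (simp add: ennreal_mult mult_ac)
      also have "ennreal (min (h\<^sup>2 * v / \<tau>) \<bar>h\<bar>) * ennreal (v powr (- a)) = ennreal (min (h\<^sup>2 * v / \<tau>) \<bar>h\<bar> * v powr (- a))"
        using m by (subst ennreal_mult) auto
      finally show ?thesis using True by simp
    next
      case False
      then show ?thesis by (cases "v = 0") (auto simp: indicator_def)
    qed
    finally show "(\<integral>\<^sup>+\<omega>. ?D v * indicator {0..b} v * indicator {x. v \<le> \<bar>x\<bar>} (X \<omega>) \<partial>M) \<le>
      (2 * K) * (ennreal (min (h\<^sup>2 * v / \<tau>) \<bar>h\<bar> * v powr (- a)) * indicator {0..b} v)" .
  qed
  also have "\<dots> = 2 * K * Psi a h \<tau> b"
    unfolding Psi_def by (rule nn_integral_cmult) measurable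
  finally show ?thesis .
qed

lemma (in prob_space) second_moment_indep_sum:
  fixes Z :: "'i \<Rightarrow> 'a \<Rightarrow> real"
  assumes I: "finite I" and ind: "indep_vars (\<lambda>_. borel) Z I"
    and bd: "\<And>i \<omega>. i \<in> I \<Longrightarrow> \<bar>Z i \<omega>\<bar> \<le> c" and zero: "\<And>i. i \<in> I \<Longrightarrow> expectation (Z i) = 0"
  shows "(\<integral>\<^sup>+\<omega>. ennreal ((\<Sum>i\<in>I. Z i \<omega>)\<^sup>2) \<partial>M) = (\<Sum>i\<in>I. \<integral>\<^sup>+\<omega>. ennreal ((Z i \<omega>)\<^sup>2) \<partial>M)"
proof -
  have m [measurable]: "Z i \<in> borel_measurable M" if "i \<in> I" for i
    using ind that by (auto simp: indep_vars_def)
  have prodb: "\<bar>Z i \<omega> * Z j \<omega>\<bar> \<le> c * c" if "i \<in> I" "j \<in> I" for i j \<omega>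
    unfolding abs_mult using bd that by (intro mult_mono) (auto intro: order_trans[OF abs_ge_zero])
  have int: "integrable M (\<lambda>\<omega>. Z i \<omega> * Z j \<omega>)" if "i \<in> I" "j \<in> I" for i j
    using that by (intro integrable_const_bound[where B="c * c"]) (auto simp: prodb)
  have int1: "integrable M (Z i)" if "i \<in> I" for i
    using that bd by (intro integrable_const_bound[where B=c]) auto
  have cross: "expectation (\<lambda>\<omega>. Z i \<omega> * Z j \<omega>) = 0" if "i \<in> I" "j \<in> I" "i \<noteq> j" for i j
  proof -
    have "indep_vars (\<lambda>_. borel) Z {i, j}" using that by (intro indep_vars_subset[OF ind]) auto
    then have "expectation (\<lambda>\<omega>. \<Prod>k\<in>{i, j}. Z k \<omega>) = (\<Prod>k\<in>{i, j}. expectation (Z k))"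
      using that int1 by (intro indep_vars_lebesgue_integral) auto
    then show ?thesis using that zero by simp
  qed
  have sq: "(\<Sum>i\<in>I. Z i \<omega>)\<^sup>2 = (\<Sum>i\<in>I. \<Sum>j\<in>I. Z i \<omega> * Z j \<omega>)" for \<omega>
    by (simp add: power2_eq_square sum_product)
  have "(\<integral>\<^sup>+\<omega>. ennreal ((\<Sum>i\<in>I. Z i \<omega>)\<^sup>2) \<partial>M) = ennreal (expectation (\<lambda>\<omega>. (\<Sum>i\<in>I. Z i \<omega>)\<^sup>2))"
    unfolding sq by (intro nn_integral_eq_integral Bochner_Integration.integrable_sum int) (auto simp: sq[symmetric])
  also have "expectation (\<lambda>\<omega>. (\<Sum>i\<in>I. Z i \<omega>)\<^sup>2) = (\<Sum>i\<in>I. \<Sum>j\<in>I. expectation (\<lambda>\<omega>. Z i \<omega> * Z j \<omega>))"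
    unfolding sq using int by (subst Bochner_Integration.integral_sum)
      (auto intro!: Bochner_Integration.integrable_sum sum.cong Bochner_Integration.integral_sum)
  also have "\<dots> = (\<Sum>i\<in>I. \<Sum>j\<in>I. if j = i then expectation (\<lambda>\<omega>. Z i \<omega> * Z i \<omega>) else 0)"
    by (intro sum.cong) (auto simp: cross)
  also have "\<dots> = (\<Sum>i\<in>I. expectation (\<lambda>\<omega>. (Z i \<omega>)\<^sup>2))"
    using I by (simp add: power2_eq_square)
  also have "ennreal \<dots> = (\<Sum>i\<in>I. \<integral>\<^sup>+\<omega>. ennreal ((Z i \<omega>)\<^sup>2) \<partial>M)"
  proof -
    have "(\<integral>\<^sup>+\<omega>. ennreal ((Z i \<omega>)\<^sup>2) \<partial>M) = ennreal (expectation (\<lambda>\<omega>. (Z i \<omega>)\<^sup>2))" if "i \<in> I" for i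
      using int[OF that that] by (intro nn_integral_eq_integral) (auto simp: power2_eq_square)
    then show ?thesis by (subst sum_ennreal[symmetric]) auto
  qed
  finally show ?thesis .
qed

context stable_noise
begin

lemma W_odd:
  fixes g :: "real \<Rightarrow> real"
  assumes A: "A \<in> finite_borel S" and [measurable]: "g \<in> borel_measurable borel" and odd: "\<And>x. g (- x) = - g x"
  shows "expectation (\<lambda>\<omega>. g (W A \<omega>)) = 0"
proof -
  have [measurable]: "W A \<in> borel_measurable M" using A by simp
  have eq: "distr M borel (\<lambda>\<omega>. - 1 * W A \<omega>) = distr M borel (W A)"
  proof (rule Levy_uniqueness)
    show "char (distr M borel (\<lambda>\<omega>. - 1 * W A \<omega>)) = char (distr M borel (W A))"
      by (rule ext) (simp add: char_W_scale[OF A, of "-1", simplified] W_char[OF A])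
  qed (auto intro!: real_distribution_distr)
  have "expectation (\<lambda>\<omega>. g (W A \<omega>)) = (\<integral>x. g x \<partial>distr M borel (\<lambda>\<omega>. - 1 * W A \<omega>))"
    unfolding eq by (subst integral_distr) auto
  also have "\<dots> = expectation (\<lambda>\<omega>. - g (W A \<omega>))"
    by (subst integral_distr) (auto simp: odd)
  finally show ?thesis by simp
qed

lemma W_tail:
  assumes A: "A \<in> finite_borel S" and x: "x > 0"
  shows "emeasure M {\<omega> \<in> space M. \<bar>W A \<omega>\<bar> \<ge> x} \<le> ennreal (x powr (- \<alpha>)) * (8 * emeasure lborel A)"
proof -
  have "emeasure M {\<omega> \<in> space M. \<bar>noise_sum W {()} (\<lambda>_. 1) (\<lambda>_. A) \<omega>\<bar> \<ge> x} \<le>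
      ennreal (8 * x powr (- \<alpha>)) * La (step {()} (\<lambda>_. 1) (\<lambda>_. A))"
    by (rule noise_sum_tail) (use A x in auto)
  also have "La (step {()} (\<lambda>_. 1) (\<lambda>_. A)) = (\<integral>\<^sup>+s. indicator A s \<partial>lborel)"
    using finite_borelD(2)[OF A] by (intro nn_integral_cong) (auto simp: step_def indicator_def)
  finally show ?thesis using finite_borelD(1)[OF A]
    by (simp add: noise_sum_def ennreal_mult mult_ac)
qed

lemma truncated_sum_bound:
  fixes I :: "'i set"
  assumes I: "finite I" "\<And>i. i \<in> I \<Longrightarrow> B i \<in> finite_borel S" "disjoint_family_on B I"
    and \<tau>: "\<tau> > 0" and r: "0 < r" "r \<le> 1"
  shows "(\<integral>\<^sup>+\<omega>. ennreal \<bar>\<Sum>i\<in>I. x i * (W (B i) \<omega> * indicator {y. \<bar>y\<bar> \<le> b i} (W (B i) \<omega>))\<bar> \<partial>M)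
    \<le> ennreal (r * \<tau>) + ennreal (16 / r) * (\<Sum>i\<in>I. emeasure lborel (B i) * Psi \<alpha> (x i) \<tau> (b i))"
proof -
  define Y where "Y i \<omega> = x i * (W (B i) \<omega> * indicator {y. \<bar>y\<bar> \<le> b i} (W (B i) \<omega>))" for i \<omega>
  define Z where "Z i \<omega> = (if \<bar>Y i \<omega>\<bar> \<le> \<tau> then Y i \<omega> else 0)" for i \<omega>
  define g where "g i w = (let y = x i * (w * indicator {y. \<bar>y\<bar> \<le> b i} w) in if \<bar>y\<bar> \<le> \<tau> then y else 0)" for i w
  define q where "q i \<omega> = min ((Y i \<omega>)\<^sup>2 / \<tau>) \<bar>Y i \<omega>\<bar>" for i \<omega>
  have [measurable]: "g i \<in> borel_measurable borel" for i unfolding g_def Let_def by measurable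
  have Zg: "Z i \<omega> = g i (W (B i) \<omega>)" for i \<omega> by (simp add: Z_def Y_def g_def Let_def)
  have Wm [measurable]: "W (B i) \<in> borel_measurable M" if "i \<in> I" for i using I that by auto
  have Ym [measurable]: "Y i \<in> borel_measurable M" if "i \<in> I" for i using that unfolding Y_def by measurable
  have Zm [measurable]: "Z i \<in> borel_measurable M" if "i \<in> I" for i using that unfolding Z_def by measurable
  have qm [measurable]: "q i \<in> borel_measurable M" if "i \<in> I" for i using that unfolding q_def by measurable
  have sumZm [measurable]: "(\<lambda>\<omega>. \<Sum>i\<in>I. Z i \<omega>) \<in> borel_measurable M" by (intro borel_measurable_sum Zm)
  have q0: "0 \<le> q i \<omega>" for i \<omega> using \<tau> by (auto simp: q_def)
  have indZ: "indep_vars (\<lambda>_. borel) Z I"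
  proof -
    have "indep_vars (\<lambda>_. borel) (\<lambda>i \<omega>. g i (W (B i) \<omega>)) I"
      by (rule indep_vars_compose2[OF W_indep[OF I]]) auto
    then show ?thesis by (simp add: Zg[abs_def])
  qed
  have EZ: "expectation (Z i) = 0" if "i \<in> I" for i
    unfolding Zg[abs_def] using that I
    by (intro W_odd) (auto simp: g_def Let_def indicator_def)
  have pw: "\<bar>\<Sum>i\<in>I. Y i \<omega>\<bar> \<le> r * \<tau> + ((\<Sum>i\<in>I. Z i \<omega>)\<^sup>2 / (r * \<tau>) + (\<Sum>i\<in>I. \<bar>Y i \<omega> - Z i \<omega>\<bar>))" for \<omega>
  proof -
    have aux: "\<bar>y\<bar> \<le> r * \<tau> + y\<^sup>2 / (r * \<tau>)" for y :: real
    proof -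
      have rt: "r * \<tau> > 0" using r \<tau> by simp
      have "0 \<le> (\<bar>y\<bar> - r * \<tau>)\<^sup>2 + \<bar>y\<bar> * (r * \<tau>)" using rt by simp
      then have "\<bar>y\<bar> * (r * \<tau>) \<le> (r * \<tau>) * (r * \<tau>) + y\<^sup>2"
        by (simp add: power2_eq_square algebra_simps)
      then have "\<bar>y\<bar> * (r * \<tau>) / (r * \<tau>) \<le> ((r * \<tau>) * (r * \<tau>) + y\<^sup>2) / (r * \<tau>)"
        using rt by (intro divide_right_mono) auto
      then show ?thesis using r \<tau> by (simp add: add_divide_distrib)
    qed
    have "\<bar>\<Sum>i\<in>I. Y i \<omega>\<bar> = \<bar>(\<Sum>i\<in>I. Z i \<omega>) + (\<Sum>i\<in>I. Y i \<omega> - Z i \<omega>)\<bar>"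
      by (simp add: sum_subtractf)
    also have "\<dots> \<le> \<bar>\<Sum>i\<in>I. Z i \<omega>\<bar> + (\<Sum>i\<in>I. \<bar>Y i \<omega> - Z i \<omega>\<bar>)"
      by (rule order_trans[OF abs_triangle_ineq add_left_mono[OF sum_abs]])
    finally show ?thesis using aux[of "\<Sum>i\<in>I. Z i \<omega>"] by simp
  qed
  have split: "(Z i \<omega>)\<^sup>2 / (r * \<tau>) + \<bar>Y i \<omega> - Z i \<omega>\<bar> \<le> q i \<omega> / r" for i \<omega>
  proof (cases "\<bar>Y i \<omega>\<bar> \<le> \<tau>")
    case True
    have "(Y i \<omega>)\<^sup>2 \<le> \<tau> * \<bar>Y i \<omega>\<bar>"
      using True by (simp add: power2_eq_square abs_mult_self_eq[symmetric, of "Y i \<omega>"] mult_right_mono del: abs_mult_self_eq)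
    then have "q i \<omega> = (Y i \<omega>)\<^sup>2 / \<tau>" using \<tau> by (simp add: q_def min_def field_simps)
    then show ?thesis using True by (simp add: Z_def mult.commute)
  next
    case False
    have "\<tau> * \<bar>Y i \<omega>\<bar> \<le> (Y i \<omega>)\<^sup>2"
      using False by (simp add: power2_eq_square abs_mult_self_eq[symmetric, of "Y i \<omega>"] mult_right_mono del: abs_mult_self_eq)
    then have q: "q i \<omega> = \<bar>Y i \<omega>\<bar>" using \<tau> by (simp add: q_def min_def field_simps)
    have "\<bar>Y i \<omega>\<bar> * r \<le> \<bar>Y i \<omega>\<bar> * 1" using r by (intro mult_left_mono) auto
    then show ?thesis using False r q by (simp add: Z_def field_simps)
  qed
  have Eq: "(\<integral>\<^sup>+\<omega>. ennreal (q i \<omega>) \<partial>M) \<le> 16 * (emeasure lborel (B i) * Psi \<alpha> (x i) \<tau> (b i))" if "i \<in> I" for i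
  proof -
    have "(\<integral>\<^sup>+\<omega>. ennreal (q i \<omega>) \<partial>M) = (\<integral>\<^sup>+\<omega>. ennreal (min ((x i)\<^sup>2 * (W (B i) \<omega>)\<^sup>2 / \<tau>) (\<bar>x i\<bar> * \<bar>W (B i) \<omega>\<bar>)) *
        indicator {y. \<bar>y\<bar> \<le> b i} (W (B i) \<omega>) \<partial>M)"
      by (intro nn_integral_cong) (auto simp: q_def Y_def indicator_def abs_mult power_mult_distrib)
    also have "\<dots> \<le> 2 * (8 * emeasure lborel (B i)) * Psi \<alpha> (x i) \<tau> (b i)"
      using that I by (intro truncated_moment \<tau> W_tail) auto
    finally show ?thesis by (simp add: mult.assoc[symmetric])
  qed
  have "(\<integral>\<^sup>+\<omega>. ennreal \<bar>\<Sum>i\<in>I. Y i \<omega>\<bar> \<partial>M) \<le>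
      (\<integral>\<^sup>+\<omega>. ennreal (r * \<tau>) + (ennreal (1 / (r * \<tau>)) * ennreal ((\<Sum>i\<in>I. Z i \<omega>)\<^sup>2) +
        (\<Sum>i\<in>I. ennreal \<bar>Y i \<omega> - Z i \<omega>\<bar>)) \<partial>M)"
    using r \<tau> by (intro nn_integral_mono)
      (auto simp: ennreal_mult[symmetric] ennreal_plus[symmetric] sum_nonneg intro!: ennreal_leI pw[simplified] simp del: ennreal_plus)
  also have "\<dots> = ennreal (r * \<tau>) + (ennreal (1 / (r * \<tau>)) * (\<Sum>i\<in>I. \<integral>\<^sup>+\<omega>. ennreal ((Z i \<omega>)\<^sup>2) \<partial>M) +
        (\<Sum>i\<in>I. \<integral>\<^sup>+\<omega>. ennreal \<bar>Y i \<omega> - Z i \<omega>\<bar> \<partial>M))"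
  proof -
    have m2: "(\<lambda>\<omega>. ennreal (1 / (r * \<tau>)) * ennreal ((\<Sum>i\<in>I. Z i \<omega>)\<^sup>2)) \<in> borel_measurable M" by measurable
    have m3: "(\<lambda>\<omega>. \<Sum>i\<in>I. ennreal \<bar>Y i \<omega> - Z i \<omega>\<bar>) \<in> borel_measurable M"
      by (intro borel_measurable_sum) measurable
    have "(\<integral>\<^sup>+\<omega>. ennreal ((\<Sum>i\<in>I. Z i \<omega>)\<^sup>2) \<partial>M) = (\<Sum>i\<in>I. \<integral>\<^sup>+\<omega>. ennreal ((Z i \<omega>)\<^sup>2) \<partial>M)"
      by (rule second_moment_indep_sum[OF I(1) indZ, where c=\<tau>]) (use \<tau> EZ in \<open>auto simp: Z_def\<close>)
    then show ?thesis using m2 m3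
      by (subst nn_integral_add, simp, simp, subst nn_integral_add, simp, simp, subst nn_integral_cmult, simp,
          subst nn_integral_sum, simp) (simp add: emeasure_space_1)
  qed
  also have "\<dots> = ennreal (r * \<tau>) + (\<Sum>i\<in>I. \<integral>\<^sup>+\<omega>. ennreal ((Z i \<omega>)\<^sup>2 / (r * \<tau>) + \<bar>Y i \<omega> - Z i \<omega>\<bar>) \<partial>M)"
  proof -
    have "(\<integral>\<^sup>+\<omega>. ennreal ((Z i \<omega>)\<^sup>2 / (r * \<tau>) + \<bar>Y i \<omega> - Z i \<omega>\<bar>) \<partial>M) =
      ennreal (1 / (r * \<tau>)) * (\<integral>\<^sup>+\<omega>. ennreal ((Z i \<omega>)\<^sup>2) \<partial>M) + (\<integral>\<^sup>+\<omega>. ennreal \<bar>Y i \<omega> - Z i \<omega>\<bar> \<partial>M)" if "i \<in> I" for i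
    proof -
      have "ennreal ((Z i \<omega>)\<^sup>2 / (r * \<tau>) + \<bar>Y i \<omega> - Z i \<omega>\<bar>) =
          ennreal (1 / (r * \<tau>)) * ennreal ((Z i \<omega>)\<^sup>2) + ennreal \<bar>Y i \<omega> - Z i \<omega>\<bar>" for \<omega>
        using r \<tau> by (simp add: ennreal_mult[symmetric])
      then show ?thesis using that by (simp add: nn_integral_add nn_integral_cmult)
    qed
    then show ?thesis by (simp add: sum.distrib sum_distrib_left)
  qed
  also have "\<dots> \<le> ennreal (r * \<tau>) + (\<Sum>i\<in>I. \<integral>\<^sup>+\<omega>. ennreal (1 / r) * ennreal (q i \<omega>) \<partial>M)"
    using split r q0 by (intro add_left_mono sum_mono nn_integral_mono)
      (auto simp: ennreal_mult[symmetric] simp del: ennreal_plus intro!: ennreal_leI)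
  also have "\<dots> = ennreal (r * \<tau>) + (\<Sum>i\<in>I. ennreal (1 / r) * (\<integral>\<^sup>+\<omega>. ennreal (q i \<omega>) \<partial>M))"
    by (simp add: nn_integral_cmult)
  also have "\<dots> \<le> ennreal (r * \<tau>) + (\<Sum>i\<in>I. ennreal (1 / r) * (16 * (emeasure lborel (B i) * Psi \<alpha> (x i) \<tau> (b i))))"
    by (intro add_left_mono sum_mono mult_left_mono Eq) auto
  also have "\<dots> = ennreal (r * \<tau>) + ennreal (16 / r) * (\<Sum>i\<in>I. emeasure lborel (B i) * Psi \<alpha> (x i) \<tau> (b i))"
  proof -
    have "ennreal (1 / r) * 16 = ennreal (16 / r)" using r by (simp add: ennreal_mult[symmetric] flip: ennreal_numeral)
    then show ?thesis by (simp add: sum_distrib_left mult.assoc[symmetric])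
  qed
  finally show ?thesis by (simp add: Y_def)
qed

lemma weak_type:
  fixes h :: "'i \<Rightarrow> 'c \<Rightarrow> real"
  assumes J: "finite J" "\<And>j. j \<in> J \<Longrightarrow> A j \<in> finite_borel S"
    and h [measurable]: "\<And>j. j \<in> J \<Longrightarrow> h j \<in> borel_measurable N"
    and N: "sigma_finite_measure N"
    and \<tau>: "\<And>t. \<tau> t > 0" and \<tau>m [measurable]: "\<tau> \<in> borel_measurable N"
    and b: "\<And>s. b s > 0" and bm [measurable]: "b \<in> borel_measurable borel"
    and bconst: "\<And>j s s'. j \<in> J \<Longrightarrow> s \<in> A j \<Longrightarrow> s' \<in> A j \<Longrightarrow> b s = b s'"
    and r: "0 < r" "r \<le> 1" and e: "e > 0"
  shows "emeasure M {\<omega> \<in> space M. ennreal e \<le> (\<integral>\<^sup>+t. ennreal \<bar>noise_sum W J (\<lambda>j. h j t) A \<omega>\<bar> \<partial>N)}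
    \<le> 8 * (\<integral>\<^sup>+s\<in>S. ennreal (b s powr (- \<alpha>)) \<partial>lborel) +
      ennreal (1 / e) * (ennreal r * (\<integral>\<^sup>+t. ennreal (\<tau> t) \<partial>N) +
        ennreal (16 / r) * (\<integral>\<^sup>+t. (\<integral>\<^sup>+s\<in>S. Psi \<alpha> (step J (\<lambda>j. h j t) A s) (\<tau> t) (b s) \<partial>lborel) \<partial>N))"
proof -
  interpret N: sigma_finite_measure N by (rule N)
  interpret pair_sigma_finite N M ..
  let ?I = "atom_ids J" and ?B = "atom J A"
  define x where "x \<sigma> t = (\<Sum>j\<in>\<sigma>. h j t)" for \<sigma> t
  define c where "c \<sigma> = (if ?B \<sigma> = {} then 1 else b (SOME s. s \<in> ?B \<sigma>))" for \<sigma>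
  have I: "finite ?I" using J by simp
  have fb: "?B \<sigma> \<in> finite_borel S" if "\<sigma> \<in> ?I" for \<sigma> using atom_finite_borel J that by blast
  have cpos: "c \<sigma> > 0" for \<sigma> using b by (simp add: c_def)
  have cb: "b s = c \<sigma>" if "\<sigma> \<in> ?I" "s \<in> ?B \<sigma>" for \<sigma> s
  proof -
    have "\<sigma> \<noteq> {}" "\<sigma> \<subseteq> J" using that(1) by (auto simp: atom_ids_def)
    then obtain j where j: "j \<in> \<sigma>" "j \<in> J" by blast
    have "(SOME s. s \<in> ?B \<sigma>) \<in> ?B \<sigma>" using that by (intro someI[of "\<lambda>s. s \<in> ?B \<sigma>"])
    moreover have "?B \<sigma> \<subseteq> A j" using j by (auto simp: atom_def)
    ultimately have "b s = b (SOME s. s \<in> ?B \<sigma>)" using that j by (intro bconst[of j]) auto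
    then show ?thesis using that by (auto simp: c_def)
  qed
  have xm [measurable]: "x \<sigma> \<in> borel_measurable N" if "\<sigma> \<in> ?I" for \<sigma>
    unfolding x_def using that by (intro borel_measurable_sum h) (auto simp: atom_ids_def)
  have Wm [measurable]: "W (?B \<sigma>) \<in> borel_measurable M" if "\<sigma> \<in> ?I" for \<sigma> using fb that by auto
  define Y where "Y t \<omega> = (\<Sum>\<sigma>\<in>?I. x \<sigma> t * (W (?B \<sigma>) \<omega> * indicator {y. \<bar>y\<bar> \<le> c \<sigma>} (W (?B \<sigma>) \<omega>)))" for t \<omega>
  have Ym [measurable]: "(\<lambda>(t, \<omega>). Y t \<omega>) \<in> borel_measurable (N \<Otimes>\<^sub>M M)"
    unfolding Y_def case_prod_beta by (intro borel_measurable_sum) measurable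
  define bad where "bad \<sigma> = {\<omega> \<in> space M. \<bar>W (?B \<sigma>) \<omega>\<bar> \<ge> c \<sigma>}" for \<sigma>
  have badm: "bad \<sigma> \<in> sets M" if "\<sigma> \<in> ?I" for \<sigma> using that unfolding bad_def by measurable
  define G where "G = {\<omega> \<in> space M. ennreal e \<le> (\<integral>\<^sup>+t. ennreal \<bar>Y t \<omega>\<bar> \<partial>N)}"
  have Gm: "G \<in> sets M" unfolding G_def by measurable
  have "emeasure M {\<omega> \<in> space M. ennreal e \<le> (\<integral>\<^sup>+t. ennreal \<bar>noise_sum W J (\<lambda>j. h j t) A \<omega>\<bar> \<partial>N)}
      \<le> emeasure M ((\<Union>\<sigma>\<in>?I. bad \<sigma>) \<union> G)"
  proof (rule emeasure_mono_AE)
    have "AE \<omega> in M. \<forall>c. noise_sum W J c A \<omega> = noise_sum W ?I (\<lambda>\<sigma>. \<Sum>j\<in>\<sigma>. c j) ?B \<omega>"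
      by (rule W_atoms) (use J in auto)
    then show "AE \<omega> in M. \<omega> \<in> {\<omega> \<in> space M. ennreal e \<le> (\<integral>\<^sup>+t. ennreal \<bar>noise_sum W J (\<lambda>j. h j t) A \<omega>\<bar> \<partial>N)} \<longrightarrow>
        \<omega> \<in> (\<Union>\<sigma>\<in>?I. bad \<sigma>) \<union> G"
    proof (eventually_elim, intro impI)
      fix \<omega>
      assume *: "\<forall>c. noise_sum W J c A \<omega> = noise_sum W ?I (\<lambda>\<sigma>. \<Sum>j\<in>\<sigma>. c j) ?B \<omega>"
        and \<omega>: "\<omega> \<in> {\<omega> \<in> space M. ennreal e \<le> (\<integral>\<^sup>+t. ennreal \<bar>noise_sum W J (\<lambda>j. h j t) A \<omega>\<bar> \<partial>N)}"
      show "\<omega> \<in> (\<Union>\<sigma>\<in>?I. bad \<sigma>) \<union> G"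
      proof (cases "\<omega> \<in> (\<Union>\<sigma>\<in>?I. bad \<sigma>)")
        case False
        then have tr: "W (?B \<sigma>) \<omega> * indicator {y. \<bar>y\<bar> \<le> c \<sigma>} (W (?B \<sigma>) \<omega>) = W (?B \<sigma>) \<omega>" if "\<sigma> \<in> ?I" for \<sigma>
          using \<omega> that by (auto simp: bad_def indicator_def)
        have "noise_sum W J (\<lambda>j. h j t) A \<omega> = Y t \<omega>" for t
        proof -
          have "noise_sum W J (\<lambda>j. h j t) A \<omega> = noise_sum W ?I (\<lambda>\<sigma>. x \<sigma> t) ?B \<omega>"
            unfolding x_def by (rule *[rule_format])
          also have "\<dots> = Y t \<omega>"
            unfolding noise_sum_def Y_def by (intro sum.cong refl) (simp only: tr)
          finally show ?thesis .
        qed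
        then show ?thesis using \<omega> by (simp add: G_def)
      qed auto
    qed
    show "(\<Union>\<sigma>\<in>?I. bad \<sigma>) \<union> G \<in> events"
      using badm Gm I by (intro sets.Un sets.finite_UN) auto
  qed
  also have "\<dots> \<le> emeasure M (\<Union>\<sigma>\<in>?I. bad \<sigma>) + emeasure M G"
    using badm Gm I by (intro emeasure_subadditive sets.finite_UN) auto
  also have "emeasure M (\<Union>\<sigma>\<in>?I. bad \<sigma>) \<le> 8 * (\<integral>\<^sup>+s\<in>S. ennreal (b s powr (- \<alpha>)) \<partial>lborel)"
  proof -
    have "emeasure M (\<Union>\<sigma>\<in>?I. bad \<sigma>) \<le> (\<Sum>\<sigma>\<in>?I. emeasure M (bad \<sigma>))"
      using badm I by (intro emeasure_subadditive_finite) auto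
    also have "\<dots> \<le> (\<Sum>\<sigma>\<in>?I. ennreal (c \<sigma> powr (- \<alpha>)) * (8 * emeasure lborel (?B \<sigma>)))"
      unfolding bad_def using fb cpos by (intro sum_mono W_tail)
    also have "\<dots> = 8 * (\<Sum>\<sigma>\<in>?I. ennreal (c \<sigma> powr (- \<alpha>)) * emeasure lborel (?B \<sigma>))"
      by (simp add: sum_distrib_left mult_ac)
    also have "(\<Sum>\<sigma>\<in>?I. ennreal (c \<sigma> powr (- \<alpha>)) * emeasure lborel (?B \<sigma>)) =
        (\<Sum>\<sigma>\<in>?I. \<integral>\<^sup>+s\<in>?B \<sigma>. ennreal (b s powr (- \<alpha>)) \<partial>lborel)"
    proof (intro sum.cong refl)
      fix \<sigma> assume \<sigma>: "\<sigma> \<in> ?I"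
      have "ennreal (c \<sigma> powr (- \<alpha>)) * emeasure lborel (?B \<sigma>) = (\<integral>\<^sup>+s\<in>?B \<sigma>. ennreal (c \<sigma> powr (- \<alpha>)) \<partial>lborel)"
        using finite_borelD(1)[OF fb[OF \<sigma>]] by (subst nn_integral_cmult_indicator) auto
      also have "\<dots> = (\<integral>\<^sup>+s\<in>?B \<sigma>. ennreal (b s powr (- \<alpha>)) \<partial>lborel)"
        using cb[OF \<sigma>] by (intro nn_integral_cong) (auto simp: indicator_def)
      finally show "ennreal (c \<sigma> powr (- \<alpha>)) * emeasure lborel (?B \<sigma>) =
          (\<integral>\<^sup>+s\<in>?B \<sigma>. ennreal (b s powr (- \<alpha>)) \<partial>lborel)" .
    qed
    also have "\<dots> = (\<integral>\<^sup>+s. (\<Sum>\<sigma>\<in>?I. ennreal (b s powr (- \<alpha>)) * indicator (?B \<sigma>) s) \<partial>lborel)"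
      using finite_borelD(1)[OF fb] by (intro nn_integral_sum[symmetric]) auto
    also have "\<dots> \<le> (\<integral>\<^sup>+s\<in>S. ennreal (b s powr (- \<alpha>)) \<partial>lborel)"
    proof (intro nn_integral_mono)
      fix s
      have "(\<Sum>\<sigma>\<in>?I. ennreal (b s powr (- \<alpha>)) * indicator (?B \<sigma>) s) =
        (\<Sum>\<sigma>\<in>?I. if \<sigma> = {j\<in>J. s \<in> A j} then ennreal (b s powr (- \<alpha>)) else 0)"
        by (intro sum.cong) (auto simp: atom_def indicator_def)
      also have "\<dots> \<le> ennreal (b s powr (- \<alpha>)) * indicator S s"
        using I finite_borelD(2)[OF J(2)] by (subst sum.delta) (auto simp: atom_ids_def indicator_def)
      finally show "(\<Sum>\<sigma>\<in>?I. ennreal (b s powr (- \<alpha>)) * indicator (?B \<sigma>) s) \<le> ennreal (b s powr (- \<alpha>)) * indicator S s" .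
    qed
    finally show ?thesis by (simp add: mult_left_mono)
  qed
  also have "emeasure M G \<le> ennreal (1 / e) * (\<integral>\<^sup>+\<omega>. (\<integral>\<^sup>+t. ennreal \<bar>Y t \<omega>\<bar> \<partial>N) \<partial>M)"
  proof -
    have "G \<subseteq> {\<omega> \<in> space M. 1 \<le> ennreal (1 / e) * (\<integral>\<^sup>+t. ennreal \<bar>Y t \<omega>\<bar> \<partial>N)}"
    proof (clarsimp simp: G_def)
      fix \<omega> assume "ennreal e \<le> (\<integral>\<^sup>+t. ennreal \<bar>Y t \<omega>\<bar> \<partial>N)"
      from mult_left_mono[OF this, of "ennreal (1 / e)"]
      show "1 \<le> ennreal (1 / e) * (\<integral>\<^sup>+t. ennreal \<bar>Y t \<omega>\<bar> \<partial>N)"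
        using e by (simp add: ennreal_mult[symmetric])
    qed
    then have "emeasure M G \<le> emeasure M ({\<omega> \<in> space M. 1 \<le> ennreal (1 / e) * (\<integral>\<^sup>+t. ennreal \<bar>Y t \<omega>\<bar> \<partial>N)})"
      by (intro emeasure_mono) measurable
    also have "\<dots> \<le> ennreal (1 / e) * (\<integral>\<^sup>+\<omega>\<in>space M. (\<integral>\<^sup>+t. ennreal \<bar>Y t \<omega>\<bar> \<partial>N) \<partial>M)"
      by (rule nn_integral_Markov_inequality) measurable
    also have "(\<integral>\<^sup>+\<omega>\<in>space M. (\<integral>\<^sup>+t. ennreal \<bar>Y t \<omega>\<bar> \<partial>N) \<partial>M) = (\<integral>\<^sup>+\<omega>. (\<integral>\<^sup>+t. ennreal \<bar>Y t \<omega>\<bar> \<partial>N) \<partial>M)"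
      by (intro nn_integral_cong) simp
    finally show ?thesis .
  qed
  also have "(\<integral>\<^sup>+\<omega>. (\<integral>\<^sup>+t. ennreal \<bar>Y t \<omega>\<bar> \<partial>N) \<partial>M) = (\<integral>\<^sup>+t. (\<integral>\<^sup>+\<omega>. ennreal \<bar>Y t \<omega>\<bar> \<partial>M) \<partial>N)"
    by (rule Fubini') measurable
  also have "\<dots> \<le> (\<integral>\<^sup>+t. ennreal r * ennreal (\<tau> t) + ennreal (16 / r) *
      (\<integral>\<^sup>+s\<in>S. Psi \<alpha> (step J (\<lambda>j. h j t) A s) (\<tau> t) (b s) \<partial>lborel) \<partial>N)"
  proof (intro nn_integral_mono)
    fix t
    have "(\<integral>\<^sup>+\<omega>. ennreal \<bar>Y t \<omega>\<bar> \<partial>M) \<le> ennreal (r * \<tau> t) +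
        ennreal (16 / r) * (\<Sum>\<sigma>\<in>?I. emeasure lborel (?B \<sigma>) * Psi \<alpha> (x \<sigma> t) (\<tau> t) (c \<sigma>))"
      unfolding Y_def by (rule truncated_sum_bound) (use I fb \<tau> r disjoint_atoms in auto)
    also have "(\<Sum>\<sigma>\<in>?I. emeasure lborel (?B \<sigma>) * Psi \<alpha> (x \<sigma> t) (\<tau> t) (c \<sigma>)) =
        (\<Sum>\<sigma>\<in>?I. \<integral>\<^sup>+s. Psi \<alpha> (x \<sigma> t) (\<tau> t) (c \<sigma>) * indicator (?B \<sigma>) s \<partial>lborel)"
      using finite_borelD(1)[OF fb]
      by (intro sum.cong refl, subst nn_integral_cmult_indicator) (auto simp: mult.commute)
    also have "\<dots> = (\<integral>\<^sup>+s. (\<Sum>\<sigma>\<in>?I. Psi \<alpha> (x \<sigma> t) (\<tau> t) (c \<sigma>) * indicator (?B \<sigma>) s) \<partial>lborel)"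
      using finite_borelD(1)[OF fb] by (intro nn_integral_sum[symmetric]) auto
    also have "\<dots> \<le> (\<integral>\<^sup>+s\<in>S. Psi \<alpha> (step J (\<lambda>j. h j t) A s) (\<tau> t) (b s) \<partial>lborel)"
    proof (intro nn_integral_mono)
      fix s
      let ?\<sigma> = "{j\<in>J. s \<in> A j}"
      have "(\<Sum>\<sigma>\<in>?I. Psi \<alpha> (x \<sigma> t) (\<tau> t) (c \<sigma>) * indicator (?B \<sigma>) s) =
        (\<Sum>\<sigma>\<in>?I. if \<sigma> = ?\<sigma> then Psi \<alpha> (x \<sigma> t) (\<tau> t) (c \<sigma>) else 0)"
        by (intro sum.cong) (auto simp: atom_def indicator_def)
      also have "\<dots> = (if ?\<sigma> \<in> ?I then Psi \<alpha> (x ?\<sigma> t) (\<tau> t) (c ?\<sigma>) else 0)"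
        using I by (subst sum.delta) auto
      also have "\<dots> \<le> Psi \<alpha> (step J (\<lambda>j. h j t) A s) (\<tau> t) (b s) * indicator S s"
      proof (cases "?\<sigma> \<in> ?I")
        case True
        have s: "s \<in> ?B ?\<sigma>" by (simp add: atom_def)
        have "s \<in> S" using True finite_borelD(2)[OF J(2)] by (auto simp: atom_ids_def)
        moreover have "x ?\<sigma> t = step J (\<lambda>j. h j t) A s"
          unfolding x_def using step_atom[OF s J(1), of "\<lambda>j. h j t"] by simp
        ultimately show ?thesis using True cb[OF True s] by simp
      qed auto
      finally show "(\<Sum>\<sigma>\<in>?I. Psi \<alpha> (x \<sigma> t) (\<tau> t) (c \<sigma>) * indicator (?B \<sigma>) s) \<le>
        Psi \<alpha> (step J (\<lambda>j. h j t) A s) (\<tau> t) (b s) * indicator S s" .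
    qed
    finally show "(\<integral>\<^sup>+\<omega>. ennreal \<bar>Y t \<omega>\<bar> \<partial>M) \<le> ennreal r * ennreal (\<tau> t) + ennreal (16 / r) *
      (\<integral>\<^sup>+s\<in>S. Psi \<alpha> (step J (\<lambda>j. h j t) A s) (\<tau> t) (b s) \<partial>lborel)"
      using r \<tau>[of t] by (simp add: ennreal_mult add_left_mono mult_left_mono)
  qed
  also have "\<dots> = ennreal r * (\<integral>\<^sup>+t. ennreal (\<tau> t) \<partial>N) +
        ennreal (16 / r) * (\<integral>\<^sup>+t. (\<integral>\<^sup>+s\<in>S. Psi \<alpha> (step J (\<lambda>j. h j t) A s) (\<tau> t) (b s) \<partial>lborel) \<partial>N)"
  proof -
    have [measurable]: "A j \<in> sets borel" if "j \<in> J" for j using J that finite_borelD(1) by blast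
    have st [measurable]: "(\<lambda>(t, s). step J (\<lambda>j. h j t) A s) \<in> borel_measurable (N \<Otimes>\<^sub>M lborel)"
      unfolding step_def case_prod_beta by (intro borel_measurable_sum) measurable
    have [measurable]: "(\<lambda>t. \<integral>\<^sup>+s\<in>S. Psi \<alpha> (step J (\<lambda>j. h j t) A s) (\<tau> t) (b s) \<partial>lborel) \<in> borel_measurable N"
      by measurable
    show ?thesis by (simp add: nn_integral_add nn_integral_cmult)
  qed
  finally show ?thesis by (simp add: add_left_mono mult_left_mono)
qed

end

section \<open>Density of step functions\<close>

definition grid :: "nat \<Rightarrow> 'a::euclidean_space \<Rightarrow> 'a" where
  "grid n s = (\<Sum>i\<in>Basis. (real_of_int \<lfloor>real (Suc n) * (s \<bullet> i)\<rfloor> / real (Suc n)) *\<^sub>R i)"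

lemma grid_measurable [measurable]: "grid n \<in> borel_measurable borel"
  unfolding grid_def by measurable

lemma grid_tendsto: "(\<lambda>n. grid n s) \<longlonglongrightarrow> s"
proof -
  have "(\<lambda>n. real_of_int \<lfloor>real (Suc n) * x\<rfloor> / real (Suc n)) \<longlonglongrightarrow> x" for x :: real
  proof (rule real_tendsto_sandwich)
    have "(\<lambda>n. x - inverse (real (Suc n))) \<longlonglongrightarrow> x - 0"
      by (intro tendsto_diff tendsto_const LIMSEQ_inverse_real_of_nat)
    then show "(\<lambda>n. x - inverse (real (Suc n))) \<longlonglongrightarrow> x" by simp
    show "\<forall>\<^sub>F n in sequentially. x - inverse (real (Suc n)) \<le> real_of_int \<lfloor>real (Suc n) * x\<rfloor> / real (Suc n)"
    proof (intro always_eventually allI)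
      fix n
      have "real (Suc n) * x - 1 \<le> real_of_int \<lfloor>real (Suc n) * x\<rfloor>" by linarith
      then have "(real (Suc n) * x - 1) / real (Suc n) \<le> real_of_int \<lfloor>real (Suc n) * x\<rfloor> / real (Suc n)"
        by (rule divide_right_mono) simp
      then show "x - inverse (real (Suc n)) \<le> real_of_int \<lfloor>real (Suc n) * x\<rfloor> / real (Suc n)"
        by (simp add: diff_divide_distrib inverse_eq_divide del: of_nat_Suc)
    qed
    show "\<forall>\<^sub>F n in sequentially. real_of_int \<lfloor>real (Suc n) * x\<rfloor> / real (Suc n) \<le> x"
    proof (intro always_eventually allI)
      fix n
      have "real_of_int \<lfloor>real (Suc n) * x\<rfloor> \<le> real (Suc n) * x" by linarith
      then show "real_of_int \<lfloor>real (Suc n) * x\<rfloor> / real (Suc n) \<le> x"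
        by (simp add: divide_le_eq mult.commute del: of_nat_Suc)
    qed
  qed (rule tendsto_const)
  then have "(\<lambda>n. grid n s) \<longlonglongrightarrow> (\<Sum>i\<in>Basis. (s \<bullet> i) *\<^sub>R i)"
    unfolding grid_def by (intro tendsto_sum tendsto_scaleR tendsto_const)
  then show ?thesis by (simp add: euclidean_representation)
qed

lemma finite_grid_image:
  assumes "bounded B"
  shows "finite (grid n ` B)"
proof -
  obtain b where b: "\<And>s. s \<in> B \<Longrightarrow> norm s \<le> b" using assms by (auto simp: bounded_iff)
  define K where "K = \<lceil>real (Suc n) * b\<rceil> + 1"
  let ?F = "\<lambda>z. \<Sum>i\<in>Basis. (real_of_int (z i) / real (Suc n)) *\<^sub>R i"
  have "grid n ` B \<subseteq> ?F ` (PiE Basis (\<lambda>_. {-K..K}))"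
  proof
    fix y assume "y \<in> grid n ` B"
    then obtain s where s: "s \<in> B" "y = grid n s" by auto
    let ?z = "\<lambda>i. if i \<in> Basis then \<lfloor>real (Suc n) * (s \<bullet> i)\<rfloor> else undefined"
    have "y = ?F ?z" unfolding s grid_def by (intro sum.cong) auto
    moreover have "\<lfloor>real (Suc n) * (s \<bullet> i)\<rfloor> \<in> {-K..K}" if "i \<in> Basis" for i
    proof -
      have "\<bar>s \<bullet> i\<bar> \<le> b" using Basis_le_norm[OF that, of s] b[OF s(1)] by linarith
      then have "\<bar>real (Suc n) * (s \<bullet> i)\<bar> \<le> real (Suc n) * b"
        unfolding abs_mult by (intro mult_mono) auto
      then show ?thesis unfolding K_def by (auto simp: le_floor_iff floor_le_iff simp del: of_nat_Suc) linarith+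
    qed
    then have "?z \<in> PiE Basis (\<lambda>_. {-K..K})" by auto
    ultimately show "y \<in> ?F ` (PiE Basis (\<lambda>_. {-K..K}))" by (rule image_eqI)
  qed
  then show ?thesis by (rule finite_subset) (intro finite_imageI finite_PiE; simp)
qed

lemma nn_integral_small:
  assumes "(\<lambda>k. nn_integral N (u k)) \<longlonglongrightarrow> 0" "e > (0::ennreal)"
  shows "\<exists>k::nat. nn_integral N (u k) < e"
  using order_tendstoD(2)[OF assms] by (auto dest: eventually_happens)

lemma step_density:
  fixes f :: "(real ^ 'n::finite) \<times> (real ^ 'n) \<Rightarrow> real"
    and G :: "(real ^ 'n) \<times> (real ^ 'n) \<Rightarrow> real \<Rightarrow> ennreal" and \<beta> :: "real ^ 'n \<Rightarrow> int"
  assumes f [measurable]: "f \<in> borel_measurable borel"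
    and Gm: "\<And>g. g \<in> borel_measurable borel \<Longrightarrow> (\<lambda>z. G z (g z)) \<in> borel_measurable borel"
    and Gmono: "\<And>z x y. \<bar>x\<bar> \<le> \<bar>y\<bar> \<Longrightarrow> G z x \<le> G z y"
    and Gadd: "\<And>z x y. G z (x + y) \<le> 4 * (G z x + G z y)"
    and G0: "\<And>z. G z 0 = 0"
    and GS: "\<And>z x. snd z \<notin> S \<Longrightarrow> G z x = 0"
    and Gcont: "\<And>z X. X \<longlonglongrightarrow> 0 \<Longrightarrow> (\<lambda>k. G z (X k)) \<longlonglongrightarrow> 0"
    and Tm: "\<And>m. Tm m \<in> sets borel" "incseq Tm" "(\<Union>m. Tm m) = UNIV"
    and Sm: "\<And>m. Sm m \<in> sets borel" "incseq Sm" "(\<Union>m. Sm m) = S" "\<And>m. bounded (Sm m)"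
    and \<beta> [measurable]: "\<beta> \<in> measurable borel (count_space UNIV)" and \<beta>fin: "\<And>m. finite (\<beta> ` Sm m)"
    and fin: "\<And>m. (\<integral>\<^sup>+z. G z (real m) * indicator (Tm m \<times> Sm m) z \<partial>lborel) < \<infinity>"
    and Gf: "(\<integral>\<^sup>+z. G z (f z) \<partial>lborel) < \<infinity>"
    and e: "e > 0"
  obtains J :: "((real ^ 'n) \<times> int) set" and A h where "finite J" "\<And>j. j \<in> J \<Longrightarrow> A j \<in> finite_borel S"
    "\<And>j. h j \<in> borel_measurable borel" "\<And>j. bounded (range (h j))"
    "\<And>j s. j \<in> J \<Longrightarrow> s \<in> A j \<Longrightarrow> \<beta> s = snd j"
    "(\<integral>\<^sup>+z. G z (f z - step J (\<lambda>j. h j (fst z)) A (snd z)) \<partial>lborel) < ennreal e"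
proof -
  define \<epsilon> where "\<epsilon> = ennreal (e / 64)"
  have \<epsilon>: "\<epsilon> > 0" using e by (simp add: \<epsilon>_def)
  note [measurable] = Tm(1) Sm(1)
  have fl [measurable]: "f \<in> borel_measurable lborel" by simp
  have GmI [measurable (raw)]: "(\<lambda>z. G z (g z)) \<in> borel_measurable lborel" if "g \<in> borel_measurable lborel" for g
    using Gm[of g] that by simp
  define E where "E m = {z. fst z \<in> Tm m \<and> snd z \<in> Sm m \<and> \<bar>f z\<bar> \<le> real m}" for m
  have Em [measurable]: "E m \<in> sets lborel" for m
  proof -
    have [measurable]: "fst \<in> borel_measurable (borel :: ((real ^ 'n) \<times> (real ^ 'n)) measure)"
      "snd \<in> borel_measurable (borel :: ((real ^ 'n) \<times> (real ^ 'n)) measure)"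
      by (metis borel_prod measurable_fst, metis borel_prod measurable_snd)
    have "{z \<in> space lborel. fst z \<in> Tm m \<and> snd z \<in> Sm m \<and> \<bar>f z\<bar> \<le> real m} \<in> sets lborel"
      by measurable
    then show ?thesis by (simp add: E_def)
  qed
  have TSm [measurable]: "Tm m \<times> Sm m \<in> sets lborel" for m
    by (simp add: borel_prod[symmetric])
  let ?fm = "\<lambda>m z. f z * indicator (E m) z"
  have m1: "(\<lambda>z. G z (f z - ?fm m z)) \<in> borel_measurable lborel" "(\<lambda>z. G z (f z)) \<in> borel_measurable lborel" for m
    by (rule GmI, measurable)+
  have "(\<lambda>m. \<integral>\<^sup>+z. G z (f z - ?fm m z) \<partial>lborel) \<longlonglongrightarrow> (\<integral>\<^sup>+z. 0 \<partial>(lborel :: ((real ^ 'n) \<times> (real ^ 'n)) measure))"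
  proof (rule nn_integral_dominated_convergence[where w="\<lambda>z. G z (f z)"])
    show "AE z in lborel. (\<lambda>m. G z (f z - ?fm m z)) \<longlonglongrightarrow> 0"
    proof (rule AE_I2)
      fix z
      show "(\<lambda>m. G z (f z - ?fm m z)) \<longlonglongrightarrow> 0"
      proof (cases "snd z \<in> S")
        case True
        then obtain m1 where m1: "snd z \<in> Sm m1" using Sm(3) by auto
        obtain m2 where m2: "fst z \<in> Tm m2" using Tm(3) by auto
        obtain m3 where m3: "\<bar>f z\<bar> \<le> real m3" using real_arch_simple by blast
        have "z \<in> E m" if "m \<ge> m1 + m2 + m3" for m
          using that m1 m2 m3 incseqD[OF Sm(2), of m1 m] incseqD[OF Tm(2), of m2 m] by (auto simp: E_def)
        then have "eventually (\<lambda>m. G z (f z - ?fm m z) = 0) sequentially"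
          by (auto simp: eventually_sequentially G0 intro!: exI[of _ "m1 + m2 + m3"])
        then show ?thesis by (rule tendsto_eventually)
      qed (simp add: GS)
    qed
    show "AE z in lborel. G z (f z - ?fm m z) \<le> G z (f z)" for m
      by (intro AE_I2 Gmono) (auto simp: indicator_def)
  qed (use Gf m1 in simp_all)
  then have "\<exists>m. (\<integral>\<^sup>+z. G z (f z - ?fm m z) \<partial>lborel) < \<epsilon>"
    using \<epsilon> by (intro nn_integral_small) auto
  then obtain m where m: "(\<integral>\<^sup>+z. G z (f z - ?fm m z) \<partial>lborel) < \<epsilon>" by auto
  let ?R = "Tm m \<times> Sm m"
  define w where "w z = 8 * (G z (real m) * indicator ?R z)" for z
  have wm [measurable]: "w \<in> borel_measurable lborel" unfolding w_def by measurable
  have wfin: "(\<integral>\<^sup>+z. w z \<partial>lborel) < \<infinity>"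
    unfolding w_def using fin[of m] by (subst nn_integral_cmult) (measurable, auto simp: ennreal_mult_less_top)
  have wdom: "G z (x - y) \<le> w z" if "\<bar>x\<bar> \<le> real m * indicator ?R z" "\<bar>y\<bar> \<le> real m * indicator ?R z" for x y z
  proof (cases "z \<in> ?R")
    case True
    have "G z (x - y) \<le> G z (real m + real m)" using that True by (intro Gmono) auto
    also have "\<dots> \<le> 4 * (G z (real m) + G z (real m))" by (rule Gadd)
    also have "\<dots> = w z"
    proof -
      have "4 * (a + a) = 8 * (a::ennreal)" for a by (simp add: distrib_left flip: distrib_right)
      then show ?thesis using True by (simp add: w_def)
    qed
    finally show ?thesis .
  qed (use that in \<open>auto simp: G0\<close>)
  have "?fm m \<in> borel_measurable lebesgue"
    using Em[of m] by (intro measurable_completion) measurable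
  then have "?fm m measurable_on UNIV"
    by (intro lebesgue_measurable_imp_measurable_on_real) auto
  then obtain N q where N: "negligible N" and q: "\<And>n. continuous_on UNIV (q n)"
    and ql: "\<And>z. z \<notin> N \<Longrightarrow> (\<lambda>n. q n z) \<longlonglongrightarrow> ?fm m z"
    unfolding measurable_on_def by auto
  define p where "p n z = max (- real m) (min (real m) (q n z))" for n z
  have p: "continuous_on UNIV (p n)" for n
    unfolding p_def by (intro continuous_intros q)
  then have [measurable]: "p n \<in> borel_measurable borel" for n
    by (rule borel_measurable_continuous_onI)
  have pb: "\<bar>p n z\<bar> \<le> real m" for n z by (auto simp: p_def)
  have fmb: "\<bar>?fm m z\<bar> \<le> real m * indicator ?R z" for z
    by (auto simp: indicator_def E_def mem_Times_iff)
  have m2: "(\<lambda>z. G z (?fm m z - p n z * indicator ?R z)) \<in> borel_measurable lborel" for n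
    by (rule GmI) measurable
  have "(\<lambda>n. \<integral>\<^sup>+z. G z (?fm m z - p n z * indicator ?R z) \<partial>lborel) \<longlonglongrightarrow> (\<integral>\<^sup>+z. 0 \<partial>(lborel :: ((real ^ 'n) \<times> (real ^ 'n)) measure))"
  proof (rule nn_integral_dominated_convergence[where w=w])
    show "AE z in lborel. (\<lambda>n. G z (?fm m z - p n z * indicator ?R z)) \<longlonglongrightarrow> 0"
    proof -
      have "AE z in lebesgue. z \<notin> N" using N by (simp add: negligible_iff_null_sets AE_not_in)
      then have "AE z in lborel. z \<notin> N" by (simp add: AE_completion_iff)
      then show ?thesis
      proof eventually_elim
        case (elim z)
        have "(\<lambda>n. p n z) \<longlonglongrightarrow> max (- real m) (min (real m) (?fm m z))"
          unfolding p_def by (intro tendsto_intros ql elim)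
        also have "max (- real m) (min (real m) (?fm m z)) = ?fm m z"
          by (auto simp: indicator_def E_def max_def min_def mem_Times_iff)
        finally have "(\<lambda>n. ?fm m z - p n z * indicator ?R z) \<longlonglongrightarrow> ?fm m z - ?fm m z * indicator ?R z"
          by (intro tendsto_intros)
        moreover have "?fm m z - ?fm m z * indicator ?R z = 0" by (auto simp: indicator_def E_def mem_Times_iff)
        ultimately show ?case by (intro Gcont) simp
      qed
    qed
    show "AE z in lborel. G z (?fm m z - p n z * indicator ?R z) \<le> w z" for n
      by (intro AE_I2 wdom fmb) (use pb in \<open>auto simp: indicator_def\<close>)
  qed (use wfin wm m2 in simp_all)
  then have "\<exists>n. (\<integral>\<^sup>+z. G z (?fm m z - p n z * indicator ?R z) \<partial>lborel) < \<epsilon>"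
    using \<epsilon> by (intro nn_integral_small) auto
  then obtain n where n: "(\<integral>\<^sup>+z. G z (?fm m z - p n z * indicator ?R z) \<partial>lborel) < \<epsilon>" by auto
  let ?g = "\<lambda>k z. p n (fst z, grid k (snd z)) * indicator ?R z"
  have gm [measurable]: "?g k \<in> borel_measurable lborel" for k
  proof -
    have "(\<lambda>z :: (real ^ 'n) \<times> (real ^ 'n). (fst z, grid k (snd z))) \<in> measurable (borel \<Otimes>\<^sub>M borel) (borel \<Otimes>\<^sub>M borel)" by measurable
    then have "(\<lambda>z :: (real ^ 'n) \<times> (real ^ 'n). (fst z, grid k (snd z))) \<in> measurable borel borel" by (simp only: borel_prod)
    from measurable_compose[OF this, of "p n" borel] have "(\<lambda>z. p n (fst z, grid k (snd z))) \<in> borel_measurable lborel" by simp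
    then show ?thesis by measurable
  qed
  have m3: "(\<lambda>z. G z (p n z * indicator ?R z - ?g k z)) \<in> borel_measurable lborel" for k
    by (rule GmI) measurable
  have "(\<lambda>k. \<integral>\<^sup>+z. G z (p n z * indicator ?R z - ?g k z) \<partial>lborel) \<longlonglongrightarrow> (\<integral>\<^sup>+z. 0 \<partial>(lborel :: ((real ^ 'n) \<times> (real ^ 'n)) measure))"
  proof (rule nn_integral_dominated_convergence[where w=w])
    show "AE z in lborel. (\<lambda>k. G z (p n z * indicator ?R z - ?g k z)) \<longlonglongrightarrow> 0"
    proof (intro AE_I2 Gcont)
      fix z :: "(real ^ 'n) \<times> (real ^ 'n)"
      have "(\<lambda>k. (fst z, grid k (snd z))) \<longlonglongrightarrow> (fst z, snd z)"
        by (intro tendsto_intros grid_tendsto)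
      then have "(\<lambda>k. (fst z, grid k (snd z))) \<longlonglongrightarrow> z" by simp
      then have "(\<lambda>k. p n (fst z, grid k (snd z))) \<longlonglongrightarrow> p n z"
        by (rule continuous_on_tendsto_compose[OF p]) auto
      then have "(\<lambda>k. p n z * indicator ?R z - ?g k z) \<longlonglongrightarrow> p n z * indicator ?R z - p n z * indicator ?R z"
        by (intro tendsto_intros)
      then show "(\<lambda>k. p n z * indicator ?R z - ?g k z) \<longlonglongrightarrow> 0" by simp
    qed
    show "AE z in lborel. G z (p n z * indicator ?R z - ?g k z) \<le> w z" for k
      by (intro AE_I2 wdom) (use pb in \<open>auto simp: indicator_def\<close>)
  qed (use wfin wm m3 in simp_all)
  then have "\<exists>k. (\<integral>\<^sup>+z. G z (p n z * indicator ?R z - ?g k z) \<partial>lborel) < \<epsilon>"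
    using \<epsilon> by (intro nn_integral_small) auto
  then obtain k where k: "(\<integral>\<^sup>+z. G z (p n z * indicator ?R z - ?g k z) \<partial>lborel) < \<epsilon>" by auto
  define J where "J = (\<lambda>s. (grid k s, \<beta> s)) ` Sm m"
  define A where "A j = {s \<in> Sm m. grid k s = fst j \<and> \<beta> s = snd j}" for j :: "(real ^ 'n) \<times> int"
  define h where "h j t = p n (t, fst j) * indicator (Tm m) t" for j :: "(real ^ 'n) \<times> int" and t
  have J: "finite J"
  proof (rule finite_subset)
    show "J \<subseteq> grid k ` Sm m \<times> \<beta> ` Sm m" by (auto simp: J_def)
    show "finite (grid k ` Sm m \<times> \<beta> ` Sm m)" using \<beta>fin finite_grid_image[OF Sm(4)] by blast
  qed
  have A: "A j \<in> finite_borel S" for j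
    unfolding finite_borel_def
  proof safe
    show "A j \<in> sets borel" unfolding A_def by measurable
    have "emeasure lborel (A j) \<le> emeasure lborel (Sm m)"
      by (intro emeasure_mono) (auto simp: A_def)
    also have "\<dots> < \<infinity>" using emeasure_bounded_finite[OF Sm(4)] .
    finally show "emeasure lborel (A j) < \<infinity>" .
    show "s \<in> S" if "s \<in> A j" for s using that Sm(3) by (auto simp: A_def)
  qed
  have hm: "h j \<in> borel_measurable borel" for j
  proof -
    have "(\<lambda>t :: real ^ 'n. (t, fst j)) \<in> measurable borel (borel \<Otimes>\<^sub>M borel)" by measurable
    then have "(\<lambda>t :: real ^ 'n. (t, fst j)) \<in> measurable borel borel" by (simp only: borel_prod)
    from measurable_compose[OF this, of "p n" borel] show ?thesis unfolding h_def by measurable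
  qed
  have hb: "bounded (range (h j))" for j
    unfolding bounded_iff using pb by (intro exI[of _ "real m"]) (auto simp: h_def indicator_def)
  have st: "step J (\<lambda>j. h j (fst z)) A (snd z) = ?g k z" for z
  proof -
    have "step J (\<lambda>j. h j (fst z)) A (snd z) =
        (\<Sum>j\<in>J. if j = (grid k (snd z), \<beta> (snd z)) then ?g k z else 0)"
      unfolding step_def by (intro sum.cong) (auto simp: h_def A_def indicator_def mem_Times_iff)
    also have "\<dots> = ?g k z"
      using J by (subst sum.delta) (auto simp: J_def indicator_def mem_Times_iff)
    finally show ?thesis .
  qed
  have "(\<integral>\<^sup>+z. G z (f z - step J (\<lambda>j. h j (fst z)) A (snd z)) \<partial>lborel) \<le>
      (\<integral>\<^sup>+z. 4 * (G z (f z - ?fm m z) + 4 * (G z (?fm m z - p n z * indicator ?R z) + G z (p n z * indicator ?R z - ?g k z))) \<partial>lborel)"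
    unfolding st
  proof (intro nn_integral_mono)
    fix z
    have "G z (f z - ?g k z) = G z ((f z - ?fm m z) + ((?fm m z - p n z * indicator ?R z) + (p n z * indicator ?R z - ?g k z)))"
      by (rule arg_cong[where f="G z"]) simp
    also have "\<dots> \<le> 4 * (G z (f z - ?fm m z) + G z ((?fm m z - p n z * indicator ?R z) + (p n z * indicator ?R z - ?g k z)))"
      by (rule Gadd)
    also have "\<dots> \<le> 4 * (G z (f z - ?fm m z) + 4 * (G z (?fm m z - p n z * indicator ?R z) + G z (p n z * indicator ?R z - ?g k z)))"
      by (intro mult_left_mono add_left_mono Gadd) auto
    finally show "G z (f z - ?g k z) \<le> \<dots>" .
  qed
  also have "\<dots> = 4 * ((\<integral>\<^sup>+z. G z (f z - ?fm m z) \<partial>lborel) + 4 * ((\<integral>\<^sup>+z. G z (?fm m z - p n z * indicator ?R z) \<partial>lborel) +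
      (\<integral>\<^sup>+z. G z (p n z * indicator ?R z - ?g k z) \<partial>lborel)))"
  proof -
    note [measurable] = m1(1)[of m] m2[of n] m3[of k]
    show ?thesis by (subst nn_integral_cmult, measurable, subst nn_integral_add, measurable, subst nn_integral_cmult, measurable,
      subst nn_integral_add, measurable)
  qed
  also have "\<dots> \<le> 4 * (\<epsilon> + 4 * (\<epsilon> + \<epsilon>))"
    using m n k by (intro mult_left_mono add_mono) auto
  also have "\<dots> = ennreal (36 * (e / 64))"
    using e by (simp add: \<epsilon>_def ennreal_plus[symmetric] ennreal_mult[symmetric] del: ennreal_plus flip: ennreal_numeral)
  also have "\<dots> < ennreal e" using e by (intro ennreal_lessI) auto
  finally have small: "(\<integral>\<^sup>+z. G z (f z - step J (\<lambda>j. h j (fst z)) A (snd z)) \<partial>lborel) < ennreal e" .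
  show thesis
    by (rule that[OF J A hm hb _ small]) (auto simp: A_def)
qed

section \<open>Stochastic Fubini theorem\<close>

lemma AE_tendsto_zero_of_suminf:
  fixes u :: "nat \<Rightarrow> 'a \<Rightarrow> ennreal"
  assumes [measurable]: "\<And>k. u k \<in> borel_measurable N" and fin: "(\<Sum>k. \<integral>\<^sup>+x. u k x \<partial>N) < \<infinity>"
  shows "AE x in N. (\<lambda>k. u k x) \<longlonglongrightarrow> 0"
proof -
  have "(\<integral>\<^sup>+x. (\<Sum>k. u k x) \<partial>N) = (\<Sum>k. \<integral>\<^sup>+x. u k x \<partial>N)"
    by (rule nn_integral_suminf) measurable
  then have "AE x in N. (\<Sum>k. u k x) \<noteq> \<infinity>"
    using fin by (intro nn_integral_PInf_AE) auto
  then show ?thesis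
  proof eventually_elim
    case (elim x)
    have "u k x \<noteq> \<top>" for k
    proof
      assume "u k x = \<top>"
      moreover have "u k x \<le> (\<Sum>k. u k x)" using sum_le_suminf[of "\<lambda>k. u k x" "{k}"] by simp
      ultimately show False using elim by (simp add: top_unique)
    qed
    then have r: "u k x = ennreal (enn2real (u k x))" for k by (simp add: less_top)
    have "summable (\<lambda>k. enn2real (u k x))"
      using elim r by (intro summable_suminf_not_top) auto
    then have "(\<lambda>k. ennreal (enn2real (u k x))) \<longlonglongrightarrow> ennreal 0"
      by (intro tendsto_ennrealI summable_LIMSEQ_zero)
    then show ?case using r by simp
  qed
qed

lemma AE_eventually_notin_of_suminf:
  fixes A :: "nat \<Rightarrow> 'a set"
  assumes [measurable]: "\<And>k. A k \<in> sets N" and fin: "(\<Sum>k. emeasure N (A k)) < \<infinity>"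
  shows "AE x in N. eventually (\<lambda>k. x \<notin> A k) sequentially"
proof -
  have "AE x in N. (\<lambda>k. indicator (A k) x :: ennreal) \<longlonglongrightarrow> 0"
    by (rule AE_tendsto_zero_of_suminf) (use fin in auto)
  then show ?thesis
  proof eventually_elim
    case (elim x)
    then have "eventually (\<lambda>k. (indicator (A k) x :: ennreal) < 1) sequentially"
      by (rule order_tendstoD) simp
    then show ?case by eventually_elim (auto simp: indicator_def split: if_splits)
  qed
qed

lemma suminf_geometric_finite:
  fixes a :: "nat \<Rightarrow> ennreal"
  assumes a: "\<And>k. a k \<le> C * ennreal (q ^ k)" and C: "C < \<infinity>" and q: "0 \<le> q" "q < 1"
  shows "(\<Sum>k. a k) < \<infinity>"
proof -
  have "(\<Sum>k. a k) \<le> (\<Sum>k. C * ennreal (q ^ k))" by (intro suminf_le a) auto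
  also have "\<dots> = C * (\<Sum>k. ennreal (q ^ k))" by (rule ennreal_suminf_cmult)
  also have "(\<Sum>k. ennreal (q ^ k)) = ennreal (\<Sum>k. q ^ k)"
    using q by (intro suminf_ennreal2 summable_geometric) auto
  finally show ?thesis using C by (auto simp: ennreal_mult_less_top intro: le_less_trans)
qed

lemma L1_limit_of_geometric:
  fixes X :: "nat \<Rightarrow> 'a \<Rightarrow> real"
  assumes [measurable]: "\<And>k. X k \<in> borel_measurable N" "Y \<in> borel_measurable N"
    and lim: "AE t in N. (\<lambda>k. X k t) \<longlonglongrightarrow> Y t"
    and inc: "\<And>k. k \<ge> K \<Longrightarrow> (\<integral>\<^sup>+t. ennreal \<bar>X (Suc k) t - X k t\<bar> \<partial>N) \<le> ennreal ((1 / 2) ^ k)"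
    and k: "k \<ge> K"
  shows "(\<integral>\<^sup>+t. ennreal \<bar>Y t - X k t\<bar> \<partial>N) \<le> ennreal (2 * (1 / 2) ^ k)"
proof -
  have step: "(\<integral>\<^sup>+t. ennreal \<bar>X (k + l) t - X k t\<bar> \<partial>N) \<le> ennreal (2 * (1 / 2) ^ k - 2 * (1 / 2) ^ (k + l))" for l
  proof (induction l)
    case (Suc l)
    have "(\<integral>\<^sup>+t. ennreal \<bar>X (k + Suc l) t - X k t\<bar> \<partial>N) \<le>
        (\<integral>\<^sup>+t. ennreal \<bar>X (Suc (k + l)) t - X (k + l) t\<bar> + ennreal \<bar>X (k + l) t - X k t\<bar> \<partial>N)"
      by (intro nn_integral_mono) (auto simp: ennreal_plus[symmetric] simp del: ennreal_plus intro!: ennreal_leI)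
    also have "\<dots> = (\<integral>\<^sup>+t. ennreal \<bar>X (Suc (k + l)) t - X (k + l) t\<bar> \<partial>N) + (\<integral>\<^sup>+t. ennreal \<bar>X (k + l) t - X k t\<bar> \<partial>N)"
      by (rule nn_integral_add) measurable
    also have "\<dots> \<le> ennreal ((1 / 2) ^ (k + l)) + ennreal (2 * (1 / 2) ^ k - 2 * (1 / 2) ^ (k + l))"
      using k by (intro add_mono inc Suc) auto
    also have "\<dots> = ennreal (2 * (1 / 2) ^ k - 2 * (1 / 2) ^ (k + Suc l))"
    proof -
      have "(1 / 2 :: real) ^ (k + l) \<le> (1 / 2) ^ k" by (intro power_decreasing) auto
      then show ?thesis by (subst ennreal_plus[symmetric]) auto
    qed
    finally show ?case .
  qed simp
  have "(\<integral>\<^sup>+t. ennreal \<bar>Y t - X k t\<bar> \<partial>N) \<le> (\<integral>\<^sup>+t. liminf (\<lambda>l. ennreal \<bar>X (k + l) t - X k t\<bar>) \<partial>N)"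
  proof (rule nn_integral_mono_AE)
    show "AE t in N. ennreal \<bar>Y t - X k t\<bar> \<le> liminf (\<lambda>l. ennreal \<bar>X (k + l) t - X k t\<bar>)"
      using lim
    proof eventually_elim
      case (elim t)
      then have "(\<lambda>l. X (l + k) t) \<longlonglongrightarrow> Y t" by (rule LIMSEQ_ignore_initial_segment)
      then have "(\<lambda>l. ennreal \<bar>X (k + l) t - X k t\<bar>) \<longlonglongrightarrow> ennreal \<bar>Y t - X k t\<bar>"
        by (intro tendsto_ennrealI tendsto_intros) (simp add: add.commute)
      from lim_imp_Liminf[OF _ this] show ?case by simp
    qed
  qed
  also have "\<dots> \<le> liminf (\<lambda>l. \<integral>\<^sup>+t. ennreal \<bar>X (k + l) t - X k t\<bar> \<partial>N)"
    by (rule nn_integral_liminf) measurable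
  also have "\<dots> \<le> liminf (\<lambda>l::nat. ennreal (2 * (1 / 2) ^ k))"
  proof (intro Liminf_mono always_eventually allI)
    fix l
    show "(\<integral>\<^sup>+t. ennreal \<bar>X (k + l) t - X k t\<bar> \<partial>N) \<le> ennreal (2 * (1 / 2) ^ k)"
      by (rule order_trans[OF step[of l]]) (auto intro!: ennreal_leI)
  qed
  also have "\<dots> = ennreal (2 * (1 / 2) ^ k)" by (simp add: Liminf_const)
  finally show ?thesis .
qed

lemma nn_integral_powr_from_0:
  fixes a c :: real assumes "a > -1" "c \<ge> 0"
  shows "(\<integral>\<^sup>+v\<in>{0..c}. ennreal (v powr a) \<partial>lborel) = ennreal (c powr (a + 1) / (a + 1))"
proof -
  have "(\<integral>\<^sup>+v. ennreal (indicator {0..c} v * v powr a) \<partial>lborel) = ennreal (c powr (a + 1) / (a + 1))"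
    by (rule nn_integral_has_integral_lebesgue[OF _ has_integral_powr_from_0[OF assms]]) auto
  moreover have "ennreal (v powr a) * indicator {0..c} v = ennreal (indicator {0..c} v * v powr a)" for v
    by (auto simp: indicator_def)
  ultimately show ?thesis by simp
qed

lemma Psi_le_square:
  assumes "a < 2" "\<tau> > 0" "b \<ge> 0"
  shows "Psi a x \<tau> b \<le> ennreal (x\<^sup>2 / \<tau> * (b powr (2 - a) / (2 - a)))"
proof -
  have "Psi a x \<tau> b \<le> (\<integral>\<^sup>+v. ennreal (x\<^sup>2 / \<tau>) * (ennreal (v powr (1 - a)) * indicator {0..b} v) \<partial>lborel)"
    unfolding Psi_def
  proof (intro nn_integral_mono)
    fix v :: real
    show "ennreal (min (x\<^sup>2 * v / \<tau>) \<bar>x\<bar> * v powr - a) * indicator {0..b} v \<le>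
        ennreal (x\<^sup>2 / \<tau>) * (ennreal (v powr (1 - a)) * indicator {0..b} v)"
    proof (cases "v \<in> {0<..b}")
      case True
      have "min (x\<^sup>2 * v / \<tau>) \<bar>x\<bar> * v powr - a \<le> x\<^sup>2 * v / \<tau> * v powr - a"
        by (intro mult_right_mono) auto
      also have "v * v powr - a = v powr (1 - a)"
        using True powr_add[of v 1 "-a"] by simp
      then have "x\<^sup>2 * v / \<tau> * v powr - a = x\<^sup>2 / \<tau> * v powr (1 - a)"
        by (metis mult.assoc times_divide_eq_left)
      finally show ?thesis using True assms by (simp add: ennreal_mult[symmetric] ennreal_leI)
    next
      case False
      then show ?thesis by (cases "v = 0") auto
    qed
  qed
  also have "\<dots> = ennreal (x\<^sup>2 / \<tau>) * ennreal (b powr (2 - a) / (2 - a))"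
    using assms nn_integral_powr_from_0[of "1 - a" b]
    by (subst nn_integral_cmult) (auto simp: algebra_simps)
  also have "\<dots> = ennreal (x\<^sup>2 / \<tau> * (b powr (2 - a) / (2 - a)))"
    using assms by (intro ennreal_mult[symmetric]) auto
  finally show ?thesis .
qed

lemma Psi_tendsto_zero:
  assumes "a < 2" "\<tau> > 0" "b \<ge> 0" "X \<longlonglongrightarrow> 0"
  shows "(\<lambda>k. Psi a (X k) \<tau> b) \<longlonglongrightarrow> 0"
proof (rule tendsto_sandwich[OF _ _ tendsto_const])
  have "(\<lambda>k. ennreal ((X k)\<^sup>2 / \<tau> * (b powr (2 - a) / (2 - a)))) \<longlonglongrightarrow> ennreal (0\<^sup>2 / \<tau> * (b powr (2 - a) / (2 - a)))"
    using assms by (intro tendsto_ennrealI tendsto_intros) auto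
  then show "(\<lambda>k. ennreal ((X k)\<^sup>2 / \<tau> * (b powr (2 - a) / (2 - a)))) \<longlonglongrightarrow> 0" by simp
qed (use Psi_le_square[OF assms(1-3)] in auto)

lemma nn_integral_lborel_pair:
  fixes F :: "'a::euclidean_space \<times> 'b::euclidean_space \<Rightarrow> ennreal"
  assumes "F \<in> borel_measurable borel"
  shows "(\<integral>\<^sup>+z. F z \<partial>lborel) = (\<integral>\<^sup>+t. (\<integral>\<^sup>+s. F (t, s) \<partial>lborel) \<partial>lborel)"
    and "(\<integral>\<^sup>+z. F z \<partial>lborel) = (\<integral>\<^sup>+s. (\<integral>\<^sup>+t. F (t, s) \<partial>lborel) \<partial>lborel)"
proof -
  have F: "F \<in> borel_measurable (lborel \<Otimes>\<^sub>M lborel)" using assms by (simp add: lborel_prod)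
  show "(\<integral>\<^sup>+z. F z \<partial>lborel) = (\<integral>\<^sup>+t. (\<integral>\<^sup>+s. F (t, s) \<partial>lborel) \<partial>lborel)"
    using lborel.nn_integral_fst[OF F] by (simp add: lborel_prod)
  show "(\<integral>\<^sup>+z. F z \<partial>lborel) = (\<integral>\<^sup>+s. (\<integral>\<^sup>+t. F (t, s) \<partial>lborel) \<partial>lborel)"
    using lborel_pair.nn_integral_snd[OF F] by (simp add: lborel_prod)
qed

definition pos_weight :: "'a::euclidean_space \<Rightarrow> ennreal" where
  "pos_weight = (SOME h. h \<in> borel_measurable lborel \<and> integral\<^sup>N lborel h \<noteq> \<infinity> \<and> (\<forall>x. 0 < h x \<and> h x < \<infinity>))"

lemma pos_weight:
  fixes x :: "'a::euclidean_space"
  shows "(pos_weight :: 'a \<Rightarrow> ennreal) \<in> borel_measurable borel" "integral\<^sup>N lborel (pos_weight :: 'a \<Rightarrow> ennreal) < \<infinity>"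
    "0 < pos_weight x" "pos_weight x < \<infinity>"
proof -
  have "\<exists>h. h \<in> borel_measurable lborel \<and> integral\<^sup>N lborel h \<noteq> \<infinity> \<and> (\<forall>x::'a. 0 < h x \<and> h x < \<infinity>)"
    using sigma_finite_measure.Ex_finite_integrable_function[OF sigma_finite_lborel] by auto
  from someI_ex[OF this] show "(pos_weight :: 'a \<Rightarrow> ennreal) \<in> borel_measurable borel"
    "integral\<^sup>N lborel (pos_weight :: 'a \<Rightarrow> ennreal) < \<infinity>" "0 < pos_weight x" "pos_weight x < \<infinity>"
    unfolding pos_weight_def by (auto simp: less_top)
qed

locale stochastic_fubini = stable_noise M \<alpha> S W
  for M :: "'w measure" and \<alpha> :: real and S :: "(real ^ 'n::finite) set"
    and W :: "(real ^ 'n) set \<Rightarrow> 'w \<Rightarrow> real" +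
  fixes f :: "(real ^ 'n) \<times> (real ^ 'n) \<Rightarrow> real" and \<phi> :: "real ^ 'n \<Rightarrow> real"
    and u :: "real ^ 'n \<Rightarrow> 'w \<Rightarrow> real" and \<tau> :: "real ^ 'n \<Rightarrow> real" and \<beta> :: "real ^ 'n \<Rightarrow> int"
  assumes f_measurable [measurable]: "f \<in> borel_measurable borel"
    and f_L: "\<And>t. (\<lambda>s. f (t, s)) \<in> L_space \<alpha> S"
    and f_phi: "\<And>s. integrable lborel (\<lambda>t. f (t, s) * \<phi> t)"
    and phi_int: "integrable lborel \<phi>" and phi_measurable [measurable]: "\<phi> \<in> borel_measurable borel"
    and u: "\<And>t. has_noise_integral M \<alpha> S W (\<lambda>s. f (t, s)) (u t)"
    and u_joint [measurable]: "(\<lambda>(t, \<omega>). u t \<omega>) \<in> borel_measurable (borel \<Otimes>\<^sub>M M)"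
    and tau_pos: "\<And>t. \<tau> t > 0" and tau_measurable [measurable]: "\<tau> \<in> borel_measurable borel"
    and tau_int: "(\<integral>\<^sup>+t. ennreal (\<tau> t * \<bar>\<phi> t\<bar>) \<partial>lborel) < \<infinity>"
    and beta_measurable [measurable]: "\<beta> \<in> measurable borel (count_space UNIV)"
    and beta_int: "(\<integral>\<^sup>+s\<in>S. ennreal ((2 powr real_of_int (\<beta> s)) powr (- \<alpha>)) \<partial>lborel) < \<infinity>"
    and Psi_int: "\<And>c. c > 0 \<Longrightarrow> (\<integral>\<^sup>+t. ennreal \<bar>\<phi> t\<bar> *
      (\<integral>\<^sup>+s\<in>S. Psi \<alpha> (f (t, s)) (\<tau> t) (c * 2 powr real_of_int (\<beta> s)) \<partial>lborel) \<partial>lborel) < \<infinity>"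
begin

lemma fst_borel [measurable]: "fst \<in> borel_measurable (borel :: ((real ^ 'n) \<times> (real ^ 'n)) measure)"
  by (metis borel_prod measurable_fst)

lemma snd_borel [measurable]: "snd \<in> borel_measurable (borel :: ((real ^ 'n) \<times> (real ^ 'n)) measure)"
  by (metis borel_prod measurable_snd)

lemma Pair_borel:
  fixes s t :: "real ^ 'n"
  shows "(\<lambda>s::real^'n. (t, s)) \<in> measurable borel borel" "(\<lambda>t::real^'n. (t, s)) \<in> measurable borel borel"
proof -
  have "(\<lambda>s::real^'n. (t, s)) \<in> measurable borel (borel \<Otimes>\<^sub>M borel)" by measurable
  then show "(\<lambda>s::real^'n. (t, s)) \<in> measurable borel borel" by (simp only: borel_prod)
  have "(\<lambda>t::real^'n. (t, s)) \<in> measurable borel (borel \<Otimes>\<^sub>M borel)" by measurable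
  then show "(\<lambda>t::real^'n. (t, s)) \<in> measurable borel borel" by (simp only: borel_prod)
qed

lemma f_section [measurable]:
  "(\<lambda>s. f (t, s)) \<in> borel_measurable borel" "(\<lambda>t. f (t, s)) \<in> borel_measurable borel"
  using measurable_compose[OF Pair_borel(1) f_measurable] measurable_compose[OF Pair_borel(2) f_measurable] by auto

lemma f_pair [measurable]: "f \<in> borel_measurable (borel \<Otimes>\<^sub>M borel)"
  by (simp add: borel_prod)

definition N :: "(real ^ 'n) measure" where
  "N = density lborel (\<lambda>t. ennreal \<bar>\<phi> t\<bar>)"

lemma sets_N [measurable_cong, simp]: "sets N = sets borel"
  by (simp add: N_def)

lemma nn_integral_N: "F \<in> borel_measurable borel \<Longrightarrow> (\<integral>\<^sup>+t. F t \<partial>N) = (\<integral>\<^sup>+t. ennreal \<bar>\<phi> t\<bar> * F t \<partial>lborel)"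
  unfolding N_def by (rule nn_integral_density) auto

lemma phi_nn_int: "(\<integral>\<^sup>+t. ennreal \<bar>\<phi> t\<bar> \<partial>lborel) < \<infinity>"
  using phi_int by (simp add: integrable_iff_bounded)

lemma finite_N: "finite_measure N"
proof
  have "emeasure N (space N) = (\<integral>\<^sup>+t. 1 \<partial>N)" by simp
  also have "\<dots> = (\<integral>\<^sup>+t. ennreal \<bar>\<phi> t\<bar> \<partial>lborel)" by (subst nn_integral_N) auto
  finally show "emeasure N (space N) \<noteq> \<infinity>" using phi_nn_int by simp
qed

definition wt :: "real ^ 'n \<Rightarrow> real" where
  "wt t = 1 / (1 + enn2real (La (\<lambda>s. f (t, s))))"

definition ws :: "real ^ 'n \<Rightarrow> real" where
  "ws s = enn2real (pos_weight s) / (1 + (LINT t|lborel. \<bar>f (t, s) * \<phi> t\<bar>))"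

lemma La_f_finite: "La (\<lambda>s. f (t, s)) < \<infinity>"
  using f_L[of t] by (simp add: L_space_def)

lemma wt_pos: "wt t > 0" "wt t \<le> 1"
  by (auto simp: wt_def add_pos_nonneg)

lemma ws_pos: "ws s > 0" "ennreal (ws s) \<le> pos_weight s"
proof -
  have F0: "(LINT t|lborel. \<bar>f (t, s) * \<phi> t\<bar>) \<ge> 0" by simp
  have w: "enn2real (pos_weight s) > 0" using pos_weight(3,4)[of s] by (simp add: enn2real_positive_iff)
  show "ws s > 0" unfolding ws_def using w F0 by (intro divide_pos_pos add_pos_nonneg) auto
  have "ws s \<le> enn2real (pos_weight s)" unfolding ws_def
    using w F0 by (simp add: divide_le_eq add_pos_nonneg mult_le_cancel_left1)
  then have "ennreal (ws s) \<le> ennreal (enn2real (pos_weight s))" by (rule ennreal_leI)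
  also have "\<dots> = pos_weight s" using pos_weight(4)[of s] by simp
  finally show "ennreal (ws s) \<le> pos_weight s" .
qed

lemma wt_measurable [measurable]: "wt \<in> borel_measurable borel"
  unfolding wt_def by measurable

lemma ws_measurable [measurable]: "ws \<in> borel_measurable borel"
proof -
  have [measurable]: "(pos_weight :: real ^ 'n \<Rightarrow> ennreal) \<in> borel_measurable borel" by (rule pos_weight)
  have [measurable]: "(\<lambda>s. LINT t|lborel. \<bar>f (t, s) * \<phi> t\<bar>) \<in> borel_measurable borel"
    by measurable
  show ?thesis unfolding ws_def by measurable
qed

text \<open>The first summand enters the weak type inequality. The other two make approximating step
  functions converge in \<open>L\<^sup>\<alpha>(S)\<close> for almost every \<open>t\<close> and in \<open>L\<^sup>1(\<bar>\<phi> t\<bar> dt)\<close> for almost every \<open>s\<close>.\<close>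

definition G :: "real \<Rightarrow> (real ^ 'n) \<times> (real ^ 'n) \<Rightarrow> real \<Rightarrow> ennreal" where
  "G c z x = ennreal \<bar>\<phi> (fst z)\<bar> * ((Psi \<alpha> x (\<tau> (fst z)) (c * 2 powr real_of_int (\<beta> (snd z))) +
     ennreal (wt (fst z) * \<bar>x\<bar> powr \<alpha>) + ennreal (ws (snd z) * \<bar>x\<bar>)) * indicator S (snd z))"

lemma beta_real_measurable [measurable]: "(\<lambda>s. real_of_int (\<beta> s)) \<in> borel_measurable borel"
  by measurable

lemma G_measurable [measurable (raw)]:
  assumes [measurable]: "g \<in> borel_measurable borel"
  shows "(\<lambda>z. G c z (g z)) \<in> borel_measurable borel"
  unfolding G_def by measurable

lemma G_mono:
  assumes "\<bar>x\<bar> \<le> \<bar>y\<bar>"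
  shows "G c z x \<le> G c z y"
proof -
  have "Psi \<alpha> x (\<tau> (fst z)) b \<le> Psi \<alpha> y (\<tau> (fst z)) b" for b
    using assms tau_pos by (intro Psi_mono) auto
  moreover have "ennreal (wt (fst z) * \<bar>x\<bar> powr \<alpha>) \<le> ennreal (wt (fst z) * \<bar>y\<bar> powr \<alpha>)"
    using assms wt_pos[of "fst z"] alpha by (intro ennreal_leI mult_left_mono powr_mono2) auto
  moreover have "ennreal (ws (snd z) * \<bar>x\<bar>) \<le> ennreal (ws (snd z) * \<bar>y\<bar>)"
    using assms ws_pos[of "snd z"] by (intro ennreal_leI mult_left_mono) auto
  ultimately show ?thesis
    unfolding G_def by (intro mult_left_mono mult_right_mono add_mono) auto
qed

lemma G_add: "G c z (x + y) \<le> 4 * (G c z x + G c z y)"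
proof -
  have 1: "ennreal (wt (fst z) * \<bar>x + y\<bar> powr \<alpha>) \<le> 4 * (ennreal (wt (fst z) * \<bar>x\<bar> powr \<alpha>) + ennreal (wt (fst z) * \<bar>y\<bar> powr \<alpha>))"
  proof -
    have "wt (fst z) * \<bar>x + y\<bar> powr \<alpha> \<le> wt (fst z) * (4 * (\<bar>x\<bar> powr \<alpha> + \<bar>y\<bar> powr \<alpha>))"
      using wt_pos[of "fst z"] alpha by (intro mult_left_mono abs_powr_add_le) auto
    from ennreal_leI[OF this] show ?thesis
      using wt_pos[of "fst z"]
      by (simp add: ennreal_mult[symmetric] ennreal_plus[symmetric] algebra_simps del: ennreal_plus flip: ennreal_numeral)
  qed
  have 2: "ennreal (ws (snd z) * \<bar>x + y\<bar>) \<le> 4 * (ennreal (ws (snd z) * \<bar>x\<bar>) + ennreal (ws (snd z) * \<bar>y\<bar>))"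
  proof -
    have "ws (snd z) * \<bar>x + y\<bar> \<le> ws (snd z) * (4 * (\<bar>x\<bar> + \<bar>y\<bar>))"
      using ws_pos[of "snd z"] by (intro mult_left_mono) auto
    from ennreal_leI[OF this] show ?thesis
      using ws_pos[of "snd z"]
      by (simp add: ennreal_mult[symmetric] ennreal_plus[symmetric] algebra_simps del: ennreal_plus flip: ennreal_numeral)
  qed
  have "G c z (x + y) \<le> ennreal \<bar>\<phi> (fst z)\<bar> * ((4 * (Psi \<alpha> x (\<tau> (fst z)) (c * 2 powr real_of_int (\<beta> (snd z))) + Psi \<alpha> y (\<tau> (fst z)) (c * 2 powr real_of_int (\<beta> (snd z)))) +
     4 * (ennreal (wt (fst z) * \<bar>x\<bar> powr \<alpha>) + ennreal (wt (fst z) * \<bar>y\<bar> powr \<alpha>)) +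
     4 * (ennreal (ws (snd z) * \<bar>x\<bar>) + ennreal (ws (snd z) * \<bar>y\<bar>))) * indicator S (snd z))"
    unfolding G_def by (intro mult_left_mono mult_right_mono add_mono Psi_add 1 2 tau_pos) auto
  also have "\<dots> = 4 * (G c z x + G c z y)"
    unfolding G_def by (simp add: algebra_simps)
  finally show ?thesis .
qed

lemma G_tendsto:
  assumes "c > 0" "X \<longlonglongrightarrow> 0"
  shows "(\<lambda>k. G c z (X k)) \<longlonglongrightarrow> 0"
proof -
  have "(\<lambda>k. (Psi \<alpha> (X k) (\<tau> (fst z)) (c * 2 powr real_of_int (\<beta> (snd z))) +
     ennreal (wt (fst z) * \<bar>X k\<bar> powr \<alpha>) + ennreal (ws (snd z) * \<bar>X k\<bar>))) \<longlonglongrightarrow>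
     0 + ennreal (wt (fst z) * \<bar>0\<bar> powr \<alpha>) + ennreal (ws (snd z) * \<bar>0\<bar>)"
    using assms alpha tau_pos
    by (intro tendsto_add Psi_tendsto_zero tendsto_ennrealI tendsto_mult tendsto_const tendsto_powr2 tendsto_rabs) auto
  then have "(\<lambda>k. (Psi \<alpha> (X k) (\<tau> (fst z)) (c * 2 powr real_of_int (\<beta> (snd z))) +
     ennreal (wt (fst z) * \<bar>X k\<bar> powr \<alpha>) + ennreal (ws (snd z) * \<bar>X k\<bar>))) \<longlonglongrightarrow> 0" by simp
  then have "(\<lambda>k. (ennreal \<bar>\<phi> (fst z)\<bar> * indicator S (snd z)) * (Psi \<alpha> (X k) (\<tau> (fst z)) (c * 2 powr real_of_int (\<beta> (snd z))) +
     ennreal (wt (fst z) * \<bar>X k\<bar> powr \<alpha>) + ennreal (ws (snd z) * \<bar>X k\<bar>))) \<longlonglongrightarrow> (ennreal \<bar>\<phi> (fst z)\<bar> * indicator S (snd z)) * 0"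
    by (intro ennreal_tendsto_cmult) (auto simp: indicator_def)
  then show ?thesis by (simp add: G_def mult_ac)
qed

lemma G_integral:
  assumes [measurable]: "g \<in> borel_measurable borel"
  shows "(\<integral>\<^sup>+z. G c z (g z) \<partial>lborel) =
    (\<integral>\<^sup>+t. ennreal \<bar>\<phi> t\<bar> * (\<integral>\<^sup>+s\<in>S. Psi \<alpha> (g (t, s)) (\<tau> t) (c * 2 powr real_of_int (\<beta> s)) \<partial>lborel) \<partial>lborel) +
    (\<integral>\<^sup>+t. ennreal \<bar>\<phi> t\<bar> * (ennreal (wt t) * La (\<lambda>s. g (t, s))) \<partial>lborel) +
    (\<integral>\<^sup>+s. ennreal (ws s) * (\<integral>\<^sup>+t. ennreal \<bar>g (t, s) * \<phi> t\<bar> \<partial>lborel) * indicator S s \<partial>lborel)"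
proof -
  have [measurable]: "g \<in> borel_measurable (borel \<Otimes>\<^sub>M borel)" by (simp add: borel_prod)
  have [measurable]: "(\<lambda>s. g (t, s)) \<in> borel_measurable borel" "(\<lambda>t. g (t, s)) \<in> borel_measurable borel" for t s
    using measurable_compose[OF Pair_borel(1) assms] measurable_compose[OF Pair_borel(2) assms] by auto
  let ?P = "\<lambda>z. ennreal \<bar>\<phi> (fst z)\<bar> * (Psi \<alpha> (g z) (\<tau> (fst z)) (c * 2 powr real_of_int (\<beta> (snd z))) * indicator S (snd z))"
  let ?Q = "\<lambda>z. ennreal \<bar>\<phi> (fst z)\<bar> * (ennreal (wt (fst z) * \<bar>g z\<bar> powr \<alpha>) * indicator S (snd z))"
  let ?R = "\<lambda>z. ennreal \<bar>\<phi> (fst z)\<bar> * (ennreal (ws (snd z) * \<bar>g z\<bar>) * indicator S (snd z))"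
  have "(\<integral>\<^sup>+z. G c z (g z) \<partial>lborel) = (\<integral>\<^sup>+z. ?P z + ?Q z + ?R z \<partial>lborel)"
    unfolding G_def by (intro nn_integral_cong) (simp add: algebra_simps)
  also have "\<dots> = (\<integral>\<^sup>+z. ?P z \<partial>lborel) + (\<integral>\<^sup>+z. ?Q z \<partial>lborel) + (\<integral>\<^sup>+z. ?R z \<partial>lborel)"
    by (subst nn_integral_add, measurable, subst nn_integral_add, measurable)
  also have "(\<integral>\<^sup>+z. ?P z \<partial>lborel) =
      (\<integral>\<^sup>+t. ennreal \<bar>\<phi> t\<bar> * (\<integral>\<^sup>+s\<in>S. Psi \<alpha> (g (t, s)) (\<tau> t) (c * 2 powr real_of_int (\<beta> s)) \<partial>lborel) \<partial>lborel)"
    by (subst nn_integral_lborel_pair(1), measurable, subst nn_integral_cmult[symmetric], measurable)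
  also have "(\<integral>\<^sup>+z. ?Q z \<partial>lborel) = (\<integral>\<^sup>+t. ennreal \<bar>\<phi> t\<bar> * (ennreal (wt t) * La (\<lambda>s. g (t, s))) \<partial>lborel)"
  proof -
    have "(\<integral>\<^sup>+z. ?Q z \<partial>lborel) = (\<integral>\<^sup>+t. (\<integral>\<^sup>+s. ennreal \<bar>\<phi> t\<bar> * (ennreal (wt t) * (ennreal (\<bar>g (t, s)\<bar> powr \<alpha>) * indicator S s)) \<partial>lborel) \<partial>lborel)"
      using wt_pos less_imp_le by (subst nn_integral_lborel_pair(1)) (auto simp: ennreal_mult mult.assoc less_imp_le)
    also have "\<dots> = (\<integral>\<^sup>+t. ennreal \<bar>\<phi> t\<bar> * (ennreal (wt t) * La (\<lambda>s. g (t, s))) \<partial>lborel)"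
      by (intro nn_integral_cong) (simp add: nn_integral_cmult)
    finally show ?thesis .
  qed
  also have "(\<integral>\<^sup>+z. ?R z \<partial>lborel) = (\<integral>\<^sup>+s. ennreal (ws s) * (\<integral>\<^sup>+t. ennreal \<bar>g (t, s) * \<phi> t\<bar> \<partial>lborel) * indicator S s \<partial>lborel)"
  proof -
    have "(\<integral>\<^sup>+z. ?R z \<partial>lborel) = (\<integral>\<^sup>+s. (\<integral>\<^sup>+t. (ennreal (ws s) * indicator S s) * ennreal \<bar>g (t, s) * \<phi> t\<bar> \<partial>lborel) \<partial>lborel)"
      using ws_pos less_imp_le
      by (subst nn_integral_lborel_pair(2)) (auto simp: ennreal_mult abs_mult mult_ac less_imp_le intro!: nn_integral_cong)
    also have "\<dots> = (\<integral>\<^sup>+s. ennreal (ws s) * (\<integral>\<^sup>+t. ennreal \<bar>g (t, s) * \<phi> t\<bar> \<partial>lborel) * indicator S s \<partial>lborel)"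
      by (intro nn_integral_cong, subst nn_integral_cmult) (auto simp: mult_ac)
    finally show ?thesis .
  qed
  finally show ?thesis .
qed

lemma G_f_finite: "c > 0 \<Longrightarrow> (\<integral>\<^sup>+z. G c z (f z) \<partial>lborel) < \<infinity>"
proof -
  assume c: "c > 0"
  have 2: "(\<integral>\<^sup>+t. ennreal \<bar>\<phi> t\<bar> * (ennreal (wt t) * La (\<lambda>s. f (t, s))) \<partial>lborel) \<le> (\<integral>\<^sup>+t. ennreal \<bar>\<phi> t\<bar> \<partial>lborel)"
  proof (intro nn_integral_mono)
    fix t
    have "ennreal (wt t) * La (\<lambda>s. f (t, s)) = ennreal (wt t) * ennreal (enn2real (La (\<lambda>s. f (t, s))))"
      using La_f_finite[of t] by simp
    also have "\<dots> = ennreal (wt t * enn2real (La (\<lambda>s. f (t, s))))"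
      using wt_pos[of t] by (intro ennreal_mult[symmetric]) auto
    also have "\<dots> \<le> ennreal 1"
      by (intro ennreal_leI) (simp add: wt_def divide_le_eq add_pos_nonneg)
    finally show "ennreal \<bar>\<phi> t\<bar> * (ennreal (wt t) * La (\<lambda>s. f (t, s))) \<le> ennreal \<bar>\<phi> t\<bar>"
      using mult_left_mono[of "ennreal (wt t) * La (\<lambda>s. f (t, s))" 1 "ennreal \<bar>\<phi> t\<bar>"] by simp
  qed
  have 3: "(\<integral>\<^sup>+s. ennreal (ws s) * (\<integral>\<^sup>+t. ennreal \<bar>f (t, s) * \<phi> t\<bar> \<partial>lborel) * indicator S s \<partial>lborel) \<le> integral\<^sup>N lborel (pos_weight :: real ^ 'n \<Rightarrow> ennreal)"
  proof (intro nn_integral_mono)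
    fix s
    let ?F = "LINT t|lborel. \<bar>f (t, s) * \<phi> t\<bar>"
    have F: "(\<integral>\<^sup>+t. ennreal \<bar>f (t, s) * \<phi> t\<bar> \<partial>lborel) = ennreal ?F"
      using f_phi[of s] by (intro nn_integral_eq_integral) auto
    have "ennreal (ws s) * ennreal ?F = ennreal (ws s * ?F)"
      using ws_pos[of s] by (intro ennreal_mult[symmetric]) auto
    also have "\<dots> \<le> ennreal (enn2real (pos_weight s))"
    proof (intro ennreal_leI)
      have "enn2real (pos_weight s) * (?F / (1 + ?F)) \<le> enn2real (pos_weight s) * 1"
        by (intro mult_left_mono) (auto simp: divide_le_eq add_pos_nonneg)
      then show "ws s * ?F \<le> enn2real (pos_weight s)" by (simp add: ws_def)
    qed
    also have "\<dots> = pos_weight s" using pos_weight(4)[of s] by simp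
    finally show "ennreal (ws s) * (\<integral>\<^sup>+t. ennreal \<bar>f (t, s) * \<phi> t\<bar> \<partial>lborel) * indicator S s \<le> pos_weight s"
      unfolding F by (auto simp: indicator_def)
  qed
  show ?thesis
    unfolding G_integral[OF f_measurable]
    using Psi_int[OF c] le_less_trans[OF 2 phi_nn_int] le_less_trans[OF 3 pos_weight(2)] by simp
qed

lemma step_approximation:
  assumes c: "c > 0" and e: "e > 0"
  obtains J :: "((real ^ 'n) \<times> int) set" and A h where "finite J" "\<And>j. j \<in> J \<Longrightarrow> A j \<in> finite_borel S"
    "\<And>j. h j \<in> borel_measurable borel" "\<And>j. bounded (range (h j))"
    "\<And>j s. j \<in> J \<Longrightarrow> s \<in> A j \<Longrightarrow> \<beta> s = snd j"
    "(\<integral>\<^sup>+z. G c z (f z - step J (\<lambda>j. h j (fst z)) A (snd z)) \<partial>lborel) < ennreal e"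
proof -
  define Tm where "Tm m = {t. \<tau> t \<ge> 1 / real (Suc m)}" for m
  define Sm where "Sm m = {s \<in> S. norm s \<le> real m \<and> \<bar>\<beta> s\<bar> \<le> int m}" for m
  have Tm_borel: "Tm m \<in> sets borel" for m
  proof -
    have "{t \<in> space borel. \<tau> t \<ge> 1 / real (Suc m)} \<in> sets borel" by measurable
    then show ?thesis by (simp add: Tm_def)
  qed
  have Tm_inc: "incseq Tm"
    unfolding incseq_def Tm_def
    by (auto intro: order_trans[rotated] simp del: of_nat_Suc intro!: divide_left_mono elim: order_trans[rotated])
  have Tm_UN: "(\<Union>m. Tm m) = UNIV"
  proof -
    have "\<exists>m. t \<in> Tm m" for t
      using reals_Archimedean[OF tau_pos[of t]] by (auto simp: Tm_def inverse_eq_divide intro: less_imp_le)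
    then show ?thesis by auto
  qed
  have Sm_borel: "Sm m \<in> sets borel" for m
  proof -
    have "{s \<in> space borel. s \<in> S \<and> norm s \<le> real m \<and> \<bar>real_of_int (\<beta> s)\<bar> \<le> real m} \<in> sets borel" by measurable
    moreover have "{s \<in> space borel. s \<in> S \<and> norm s \<le> real m \<and> \<bar>real_of_int (\<beta> s)\<bar> \<le> real m} = Sm m"
      unfolding Sm_def by auto
    ultimately show ?thesis by (simp only:)
  qed
  have Sm_inc: "incseq Sm" unfolding incseq_def Sm_def by auto
  have Sm_UN: "(\<Union>m. Sm m) = S"
  proof -
    have "\<exists>m. s \<in> Sm m" if "s \<in> S" for s
    proof -
      obtain m where m: "max (norm s) \<bar>real_of_int (\<beta> s)\<bar> \<le> real m" using real_arch_simple by blast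
      then have "s \<in> Sm m" using that by (auto simp: Sm_def)
      then show ?thesis ..
    qed
    then show ?thesis by (auto simp: Sm_def)
  qed
  have Sm_bd: "bounded (Sm m)" for m unfolding bounded_iff Sm_def by auto
  have Sm_beta: "finite (\<beta> ` Sm m)" for m
    by (rule finite_subset[of _ "{- int m..int m}"]) (auto simp: Sm_def)
  have fin: "(\<integral>\<^sup>+z. G c z (real m) * indicator (Tm m \<times> Sm m) z \<partial>lborel) < \<infinity>" for m
  proof -
    define C where "C = (real m)\<^sup>2 * real (Suc m) * ((c * 2 powr real m) powr (2 - \<alpha>) / (2 - \<alpha>)) + real m powr \<alpha>"
    have C0: "C \<ge> 0" using alpha by (auto simp: C_def)
    let ?H = "\<lambda>t s. ennreal \<bar>\<phi> t\<bar> * (ennreal C * indicator (Sm m) s + ennreal (real m) * pos_weight s)"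
    have [measurable]: "(pos_weight :: real ^ 'n \<Rightarrow> ennreal) \<in> borel_measurable borel" by (rule pos_weight)
    note [measurable] = Sm_borel
    have "(\<integral>\<^sup>+z. G c z (real m) * indicator (Tm m \<times> Sm m) z \<partial>lborel) \<le> (\<integral>\<^sup>+z. ?H (fst z) (snd z) \<partial>lborel)"
    proof (intro nn_integral_mono)
      fix z :: "(real ^ 'n) \<times> (real ^ 'n)"
      show "G c z (real m) * indicator (Tm m \<times> Sm m) z \<le> ?H (fst z) (snd z)"
      proof (cases "z \<in> Tm m \<times> Sm m")
        case True
        then obtain t s where z: "z = (t, s)" and t: "t \<in> Tm m" and s: "s \<in> Sm m" by auto
        have b: "c * 2 powr real_of_int (\<beta> s) \<le> c * 2 powr real m"
          using s c by (intro mult_left_mono powr_mono) (auto simp: Sm_def)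
        have "Psi \<alpha> (real m) (\<tau> t) (c * 2 powr real_of_int (\<beta> s)) \<le> Psi \<alpha> (real m) (\<tau> t) (c * 2 powr real m)"
          using b tau_pos by (intro Psi_mono) auto
        also have "\<dots> \<le> ennreal ((real m)\<^sup>2 / \<tau> t * ((c * 2 powr real m) powr (2 - \<alpha>) / (2 - \<alpha>)))"
          using alpha c tau_pos by (intro Psi_le_square) auto
        also have "\<dots> \<le> ennreal ((real m)\<^sup>2 * real (Suc m) * ((c * 2 powr real m) powr (2 - \<alpha>) / (2 - \<alpha>)))"
        proof (intro ennreal_leI mult_right_mono)
          have "1 / \<tau> t \<le> real (Suc m)"
            using t tau_pos[of t] by (simp add: Tm_def field_simps del: of_nat_Suc)
          then have "(real m)\<^sup>2 * (1 / \<tau> t) \<le> (real m)\<^sup>2 * real (Suc m)" by (intro mult_left_mono) auto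
          then show "(real m)\<^sup>2 / \<tau> t \<le> (real m)\<^sup>2 * real (Suc m)" by simp
        qed (use alpha in auto)
        finally have 1: "Psi \<alpha> (real m) (\<tau> t) (c * 2 powr real_of_int (\<beta> s)) \<le> \<dots>" .
        have "wt t * real m powr \<alpha> \<le> 1 * real m powr \<alpha>" using wt_pos[of t] by (intro mult_right_mono) auto
        then have 2: "ennreal (wt t * \<bar>real m\<bar> powr \<alpha>) \<le> ennreal (real m powr \<alpha>)" by (intro ennreal_leI) simp
        have 3: "ennreal (ws s * \<bar>real m\<bar>) \<le> ennreal (real m) * pos_weight s"
        proof -
          have "ennreal (ws s * \<bar>real m\<bar>) = ennreal (real m) * ennreal (ws s)"
            using ws_pos(1)[of s] by (simp add: ennreal_mult mult.commute)
          also have "\<dots> \<le> ennreal (real m) * pos_weight s" by (intro mult_left_mono ws_pos) auto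
          finally show ?thesis .
        qed
        have "G c z (real m) \<le> ennreal \<bar>\<phi> t\<bar> * ((ennreal ((real m)\<^sup>2 * real (Suc m) * ((c * 2 powr real m) powr (2 - \<alpha>) / (2 - \<alpha>))) +
            ennreal (real m powr \<alpha>) + ennreal (real m) * pos_weight s) * 1)"
          unfolding G_def z fst_conv snd_conv
          by (intro mult_left_mono mult_mono add_mono 1 2 3) (auto simp: indicator_def)
        also have "\<dots> = ?H (fst z) (snd z)"
          using s alpha unfolding C_def z by (subst ennreal_plus) auto
        finally show ?thesis using True by simp
      qed auto
    qed
    also have "\<dots> = (\<integral>\<^sup>+t. (\<integral>\<^sup>+s. ?H t s \<partial>lborel) \<partial>lborel)"
      by (subst nn_integral_lborel_pair(1)) auto
    also have "\<dots> = (\<integral>\<^sup>+t. ennreal \<bar>\<phi> t\<bar> * (ennreal C * emeasure lborel (Sm m) + ennreal (real m) * integral\<^sup>N lborel (pos_weight :: real ^ 'n \<Rightarrow> ennreal)) \<partial>lborel)"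
      by (intro nn_integral_cong) (simp add: nn_integral_cmult nn_integral_add)
    also have "\<dots> = (\<integral>\<^sup>+t. ennreal \<bar>\<phi> t\<bar> \<partial>lborel) * (ennreal C * emeasure lborel (Sm m) + ennreal (real m) * integral\<^sup>N lborel (pos_weight :: real ^ 'n \<Rightarrow> ennreal))"
      by (rule nn_integral_multc) measurable
    also have "\<dots> < \<infinity>"
      using phi_nn_int pos_weight(2) emeasure_bounded_finite[OF Sm_bd, of m] by (auto simp: ennreal_mult_less_top)
    finally show ?thesis .
  qed
  show thesis
  proof (rule step_density[where f=f and G="G c" and S=S and Tm=Tm and Sm=Sm and \<beta>=\<beta> and e=e])
    show "G c z 0 = 0" for z using alpha by (simp add: G_def)
    show "G c z x = 0" if "snd z \<notin> S" for z x using that by (simp add: G_def)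
  qed (fact f_measurable G_measurable G_mono G_add G_tendsto[OF c] Tm_borel Tm_inc Tm_UN Sm_borel Sm_inc Sm_UN Sm_bd
      beta_measurable Sm_beta fin G_f_finite[OF c] e that)+
qed

end

context stochastic_fubini
begin

lemma
  shows AE_integrable: "AE \<omega> in M. integrable lborel (\<lambda>t. u t \<omega> * \<phi> t)"
    and noise_integral_pairing: "has_noise_integral M \<alpha> S W (\<lambda>s. LINT t|lborel. f (t, s) * \<phi> t)
      (\<lambda>\<omega>. LINT t|lborel. u t \<omega> * \<phi> t)"
proof -
  define lam where "lam k = 2 powr (real k / \<alpha>)" for k :: nat
  have lam_pos: "lam k > 0" for k by (simp add: lam_def)
  have lam_mono: "lam k \<le> lam (Suc k)" for k
    using alpha unfolding lam_def by (intro powr_mono divide_right_mono) auto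
  define P where "P k = (\<lambda>(J :: ((real ^ 'n) \<times> int) set, A, h). finite J \<and> (\<forall>j\<in>J. A j \<in> finite_borel S) \<and>
    (\<forall>j. h j \<in> borel_measurable borel) \<and> (\<forall>j. bounded (range (h j))) \<and>
    (\<forall>j\<in>J. \<forall>s\<in>A j. \<beta> s = snd j) \<and>
    (\<integral>\<^sup>+z. G (lam k) z (f z - step J (\<lambda>j. h j (fst z)) A (snd z)) \<partial>lborel) < ennreal ((1 / 64) ^ k))" for k
  have "\<exists>x. P k x" for k
  proof -
    have "(0::real) < (1 / 64) ^ k" by simp
    then obtain J :: "((real ^ 'n) \<times> int) set" and A h where "finite J" "\<And>j. j \<in> J \<Longrightarrow> A j \<in> finite_borel S"
      "\<And>j. h j \<in> borel_measurable borel" "\<And>j. bounded (range (h j))"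
      "\<And>j s. j \<in> J \<Longrightarrow> s \<in> A j \<Longrightarrow> \<beta> s = snd j"
      "(\<integral>\<^sup>+z. G (lam k) z (f z - step J (\<lambda>j. h j (fst z)) A (snd z)) \<partial>lborel) < ennreal ((1 / 64) ^ k)"
      by (rule step_approximation[OF lam_pos[of k]]) blast
    then have "P k (J, A, h)" by (simp add: P_def)
    then show ?thesis ..
  qed
  then obtain Q where Q: "\<And>k. P k (Q k)" by metis
  define J where "J k = fst (Q k)" for k
  define A where "A k = fst (snd (Q k))" for k
  define h where "h k = snd (snd (Q k))" for k
  have "P k (J k, A k, h k)" for k using Q[of k] by (simp add: J_def A_def h_def)
  then have J: "\<And>k. finite (J k)" and A: "\<And>k j. j \<in> J k \<Longrightarrow> A k j \<in> finite_borel S"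
    and hm [measurable]: "\<And>k j. h k j \<in> borel_measurable borel" and hb: "\<And>k j. bounded (range (h k j))"
    and hbeta: "\<And>k j s. j \<in> J k \<Longrightarrow> s \<in> A k j \<Longrightarrow> \<beta> s = snd j"
    and Gk: "\<And>k. (\<integral>\<^sup>+z. G (lam k) z (f z - step (J k) (\<lambda>j. h k j (fst z)) (A k) (snd z)) \<partial>lborel) < ennreal ((1 / 64) ^ k)"
    unfolding P_def by auto
  define X where "X k t \<omega> = noise_sum W (J k) (\<lambda>j. h k j t) (A k) \<omega>" for k t \<omega>
  define g where "g k t s = step (J k) (\<lambda>j. h k j t) (A k) s" for k t s
  have WA [measurable]: "W (A k j) \<in> borel_measurable M" if "j \<in> J k" for k j using A that by auto
  have Ab [measurable]: "A k j \<in> sets borel" if "j \<in> J k" for k j using A that finite_borelD(1) by blast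
  have Xm [measurable]: "(\<lambda>(t, \<omega>). X k t \<omega>) \<in> borel_measurable (borel \<Otimes>\<^sub>M M)" for k
    unfolding X_def noise_sum_def case_prod_beta by (intro borel_measurable_sum) measurable
  have Xt [measurable]: "(\<lambda>t. X k t \<omega>) \<in> borel_measurable borel" for k \<omega>
    unfolding X_def noise_sum_def by measurable
  have gm [measurable]: "(\<lambda>(t, s). g k t s) \<in> borel_measurable (borel \<Otimes>\<^sub>M borel)" for k
    unfolding g_def step_def case_prod_beta by (intro borel_measurable_sum) measurable
  have gm' [measurable]: "(\<lambda>z. g k (fst z) (snd z)) \<in> borel_measurable borel" for k
    using gm[of k] by (simp add: borel_prod case_prod_beta)
  have gs [measurable]: "g k t \<in> borel_measurable borel" for k t
    using measurable_compose[OF Pair_borel(1)[of t] gm'[of k]] by simp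
  have gt [measurable]: "(\<lambda>t. g k t s) \<in> borel_measurable borel" for k s
    using measurable_compose[OF Pair_borel(2)[of s] gm'[of k]] by simp
  have u_t: "(\<lambda>t. u t \<omega>) \<in> borel_measurable borel" if "\<omega> \<in> space M" for \<omega>
    using measurable_Pair1[OF u_joint that] by simp
  have u_m [measurable]: "u t \<in> borel_measurable M" for t
    using u[of t] by (simp add: has_noise_integral_def)

  interpret N: finite_measure N by (rule finite_N)
  interpret NM: pair_sigma_finite N M ..

  have Gsplit: "(\<integral>\<^sup>+t. ennreal \<bar>\<phi> t\<bar> * (\<integral>\<^sup>+s\<in>S. Psi \<alpha> (f (t, s) - g k t s) (\<tau> t) (lam k * 2 powr real_of_int (\<beta> s)) \<partial>lborel) \<partial>lborel) +
    (\<integral>\<^sup>+t. ennreal \<bar>\<phi> t\<bar> * (ennreal (wt t) * La (\<lambda>s. f (t, s) - g k t s)) \<partial>lborel) +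
    (\<integral>\<^sup>+s. ennreal (ws s) * (\<integral>\<^sup>+t. ennreal \<bar>(f (t, s) - g k t s) * \<phi> t\<bar> \<partial>lborel) * indicator S s \<partial>lborel) \<le> ennreal ((1 / 64) ^ k)" for k
  proof -
    have "(\<lambda>z. f z - g k (fst z) (snd z)) \<in> borel_measurable borel" by measurable
    from G_integral[OF this, of "lam k"] show ?thesis
      using Gk[of k] by (simp add: g_def[symmetric] less_imp_le)
  qed
  have I1: "(\<integral>\<^sup>+t. ennreal \<bar>\<phi> t\<bar> * (\<integral>\<^sup>+s\<in>S. Psi \<alpha> (f (t, s) - g k t s) (\<tau> t) (lam k * 2 powr real_of_int (\<beta> s)) \<partial>lborel) \<partial>lborel) \<le> ennreal ((1 / 64) ^ k)"
    and I2: "(\<integral>\<^sup>+t. ennreal \<bar>\<phi> t\<bar> * (ennreal (wt t) * La (\<lambda>s. f (t, s) - g k t s)) \<partial>lborel) \<le> ennreal ((1 / 64) ^ k)"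
    and I3: "(\<integral>\<^sup>+s. ennreal (ws s) * (\<integral>\<^sup>+t. ennreal \<bar>(f (t, s) - g k t s) * \<phi> t\<bar> \<partial>lborel) * indicator S s \<partial>lborel) \<le> ennreal ((1 / 64) ^ k)" for k
    by (rule order_trans[OF _ Gsplit[of k]], simp add: add_increasing2 add.assoc)
       (rule order_trans[OF _ Gsplit[of k]], simp add: add_increasing add_increasing2 add.assoc,
        rule order_trans[OF _ Gsplit[of k]], simp add: add_increasing)

  define D where "D k = {\<omega> \<in> space M. ennreal ((1 / 2) ^ k) \<le> (\<integral>\<^sup>+t. ennreal \<bar>X (Suc k) t \<omega> - X k t \<omega>\<bar> \<partial>N)}" for k
  have Dm: "D k \<in> sets M" for k unfolding D_def by measurable
  have D_bound: "emeasure M (D k) \<le>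
    (8 * (\<integral>\<^sup>+s\<in>S. ennreal ((2 powr real_of_int (\<beta> s)) powr (- \<alpha>)) \<partial>lborel) + (\<integral>\<^sup>+t. ennreal (\<tau> t * \<bar>\<phi> t\<bar>) \<partial>lborel) + 128) *
      ennreal ((1 / 2) ^ k)" for k
  proof -
    define hh where "hh = case_sum (\<lambda>j t. h (Suc k) j t) (\<lambda>j t. - h k j t)"
    let ?J = "J (Suc k) <+> J k" and ?A = "case_sum (A (Suc k)) (A k)"
    have hh: "(\<lambda>j. hh j t) = case_sum (\<lambda>j. h (Suc k) j t) (\<lambda>j. - h k j t)" for t
      by (rule ext) (simp add: hh_def split: sum.split)
    have Xd: "X (Suc k) t \<omega> - X k t \<omega> = noise_sum W ?J (\<lambda>j. hh j t) ?A \<omega>" for t \<omega>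
      unfolding X_def hh by (rule noise_sum_diff[OF J J])
    have gd: "step ?J (\<lambda>j. hh j t) ?A s = g (Suc k) t s - g k t s" for t s
      unfolding g_def hh by (rule step_diff[OF J J, symmetric])
    let ?b = "\<lambda>k s. lam k * 2 powr real_of_int (\<beta> s)"
    have "emeasure M (D k) \<le> 8 * (\<integral>\<^sup>+s\<in>S. ennreal (?b k s powr (- \<alpha>)) \<partial>lborel) +
      ennreal (1 / (1 / 2) ^ k) * (ennreal ((1 / 4) ^ k) * (\<integral>\<^sup>+t. ennreal (\<tau> t) \<partial>N) +
        ennreal (16 / (1 / 4) ^ k) * (\<integral>\<^sup>+t. (\<integral>\<^sup>+s\<in>S. Psi \<alpha> (step ?J (\<lambda>j. hh j t) ?A s) (\<tau> t) (?b k s) \<partial>lborel) \<partial>N))"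
      unfolding D_def Xd
    proof (rule weak_type)
      show "finite ?J" using J by simp
      show "?A j \<in> finite_borel S" if "j \<in> ?J" for j using that A by auto
      show "hh j \<in> borel_measurable N" if "j \<in> ?J" for j
        using that by (auto simp: hh_def split: sum.split)
      show "?b k s = ?b k s'" if "j \<in> ?J" "s \<in> ?A j" "s' \<in> ?A j" for j s s'
        using that hbeta by auto
      show "(1 / 4 :: real) ^ k \<le> 1" by (simp add: power_le_one)
    qed (use lam_pos tau_pos N.sigma_finite_measure_axioms in auto)
    also have "(\<integral>\<^sup>+s\<in>S. ennreal (?b k s powr (- \<alpha>)) \<partial>lborel) =
        ennreal ((1 / 2) ^ k) * (\<integral>\<^sup>+s\<in>S. ennreal ((2 powr real_of_int (\<beta> s)) powr (- \<alpha>)) \<partial>lborel)"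
    proof -
      have "lam k powr (- \<alpha>) = (1 / 2) ^ k"
        using alpha by (simp add: lam_def powr_powr powr_minus powr_realpow inverse_eq_divide power_divide)
      then have "ennreal (?b k s powr (- \<alpha>)) = ennreal ((1 / 2) ^ k) * ennreal ((2 powr real_of_int (\<beta> s)) powr (- \<alpha>))" for s
        using lam_pos[of k] by (subst powr_mult) (auto simp: ennreal_mult)
      then show ?thesis by (simp add: mult.assoc nn_integral_cmult)
    qed
    also have "(\<integral>\<^sup>+t. ennreal (\<tau> t) \<partial>N) = (\<integral>\<^sup>+t. ennreal (\<tau> t * \<bar>\<phi> t\<bar>) \<partial>lborel)"
      using tau_pos by (subst nn_integral_N) (auto simp: ennreal_mult less_imp_le mult.commute)
    also have "(\<integral>\<^sup>+t. (\<integral>\<^sup>+s\<in>S. Psi \<alpha> (step ?J (\<lambda>j. hh j t) ?A s) (\<tau> t) (?b k s) \<partial>lborel) \<partial>N) \<le> ennreal (8 * (1 / 64) ^ k)"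
    proof -
      let ?I = "\<lambda>l t. \<integral>\<^sup>+s\<in>S. Psi \<alpha> (f (t, s) - g l t s) (\<tau> t) (?b l s) \<partial>lborel"
      have Im [measurable]: "?I l \<in> borel_measurable borel" for l by measurable
      have pw: "Psi \<alpha> (g (Suc k) t s - g k t s) (\<tau> t) (?b k s) \<le>
          4 * (Psi \<alpha> (f (t, s) - g (Suc k) t s) (\<tau> t) (?b (Suc k) s) + Psi \<alpha> (f (t, s) - g k t s) (\<tau> t) (?b k s))" for t s
      proof -
        have "Psi \<alpha> (g (Suc k) t s - g k t s) (\<tau> t) (?b k s) = Psi \<alpha> ((g (Suc k) t s - f (t, s)) + (f (t, s) - g k t s)) (\<tau> t) (?b k s)"
          by (rule arg_cong[where f="\<lambda>x. Psi \<alpha> x (\<tau> t) (?b k s)"]) simp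
        also have "\<dots> \<le> 4 * (Psi \<alpha> (g (Suc k) t s - f (t, s)) (\<tau> t) (?b k s) + Psi \<alpha> (f (t, s) - g k t s) (\<tau> t) (?b k s))"
          by (rule Psi_add[OF tau_pos])
        also have "Psi \<alpha> (g (Suc k) t s - f (t, s)) (\<tau> t) (?b k s) \<le> Psi \<alpha> (f (t, s) - g (Suc k) t s) (\<tau> t) (?b (Suc k) s)"
          using lam_mono by (intro Psi_mono tau_pos mult_right_mono) auto
        finally show ?thesis by (simp add: mult_left_mono add_right_mono)
      qed
      have "(\<integral>\<^sup>+t. (\<integral>\<^sup>+s\<in>S. Psi \<alpha> (step ?J (\<lambda>j. hh j t) ?A s) (\<tau> t) (?b k s) \<partial>lborel) \<partial>N) \<le> (\<integral>\<^sup>+t. 4 * (?I (Suc k) t + ?I k t) \<partial>N)"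
      proof (intro nn_integral_mono)
        fix t
        have "(\<integral>\<^sup>+s\<in>S. Psi \<alpha> (step ?J (\<lambda>j. hh j t) ?A s) (\<tau> t) (?b k s) \<partial>lborel) \<le>
          (\<integral>\<^sup>+s. 4 * (Psi \<alpha> (f (t, s) - g (Suc k) t s) (\<tau> t) (?b (Suc k) s) * indicator S s + Psi \<alpha> (f (t, s) - g k t s) (\<tau> t) (?b k s) * indicator S s) \<partial>lborel)"
          unfolding gd using pw by (intro nn_integral_mono) (auto simp: indicator_def)
        also have "\<dots> = 4 * (?I (Suc k) t + ?I k t)"
          by (subst nn_integral_cmult, measurable, subst nn_integral_add, measurable)
        finally show "(\<integral>\<^sup>+s\<in>S. Psi \<alpha> (step ?J (\<lambda>j. hh j t) ?A s) (\<tau> t) (?b k s) \<partial>lborel) \<le> 4 * (?I (Suc k) t + ?I k t)" .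
      qed
      also have "\<dots> = 4 * ((\<integral>\<^sup>+t. ?I (Suc k) t \<partial>N) + (\<integral>\<^sup>+t. ?I k t \<partial>N))"
        by (subst nn_integral_cmult, measurable, subst nn_integral_add, measurable)
      also have "\<dots> \<le> 4 * (ennreal ((1 / 64) ^ Suc k) + ennreal ((1 / 64) ^ k))"
        unfolding nn_integral_N[OF Im] by (intro mult_left_mono add_mono I1) auto
      also have "\<dots> \<le> 4 * (ennreal ((1 / 64) ^ k) + ennreal ((1 / 64) ^ k))"
        by (intro mult_left_mono add_mono ennreal_leI power_decreasing) auto
      also have "\<dots> = ennreal (8 * (1 / 64) ^ k)"
        by (simp add: ennreal_mult[symmetric] ennreal_plus[symmetric] del: ennreal_plus flip: ennreal_numeral)
      finally show ?thesis .
    qed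
    also have "8 * (ennreal ((1 / 2) ^ k) * (\<integral>\<^sup>+s\<in>S. ennreal ((2 powr real_of_int (\<beta> s)) powr (- \<alpha>)) \<partial>lborel)) +
        ennreal (1 / (1 / 2) ^ k) * (ennreal ((1 / 4) ^ k) * (\<integral>\<^sup>+t. ennreal (\<tau> t * \<bar>\<phi> t\<bar>) \<partial>lborel) +
        ennreal (16 / (1 / 4) ^ k) * ennreal (8 * (1 / 64) ^ k)) \<le>
      (8 * (\<integral>\<^sup>+s\<in>S. ennreal ((2 powr real_of_int (\<beta> s)) powr (- \<alpha>)) \<partial>lborel) + (\<integral>\<^sup>+t. ennreal (\<tau> t * \<bar>\<phi> t\<bar>) \<partial>lborel) + 128) *
      ennreal ((1 / 2) ^ k)" (is "8 * (?h * ?B) + ?p * (?q * ?T + ?s * ?v) \<le> _")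
    proof -
      have pq: "?p * ?q = ?h"
        by (simp add: ennreal_mult[symmetric] power_divide power_mult_distrib[symmetric] field_simps)
      have "?p * (?s * ?v) = ennreal (128 * (1 / 8) ^ k)"
      proof -
        have "(1 / (1 / 2) ^ k) * ((16 / (1 / 4) ^ k) * (8 * (1 / 64) ^ k)) = 128 * (1 / 8 :: real) ^ k"
          by (simp add: power_divide power_mult_distrib[symmetric] field_simps)
        then show ?thesis by (simp add: ennreal_mult[symmetric])
      qed
      also have "\<dots> \<le> ennreal (128 * (1 / 2) ^ k)"
        by (intro ennreal_leI mult_left_mono power_mono) auto
      also have "\<dots> = 128 * ?h" by (simp add: ennreal_mult)
      finally have psv: "?p * (?s * ?v) \<le> 128 * ?h" .
      have "?p * (?q * ?T + ?s * ?v) = ?h * ?T + ?p * (?s * ?v)"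
        by (simp only: distrib_left mult.assoc[symmetric] pq)
      also have "\<dots> \<le> ?h * ?T + 128 * ?h" by (rule add_left_mono[OF psv])
      finally have "8 * (?h * ?B) + ?p * (?q * ?T + ?s * ?v) \<le> 8 * (?h * ?B) + (?h * ?T + 128 * ?h)"
        by (rule add_left_mono)
      also have "\<dots> = (8 * ?B + ?T + 128) * ?h"
        by (simp only: distrib_right mult.assoc add.assoc mult.commute[of ?h])
      finally show ?thesis .
    qed
    finally show ?thesis by (simp add: add_left_mono mult_left_mono)
  qed
  have "AE \<omega> in M. eventually (\<lambda>k. \<omega> \<notin> D k) sequentially"
  proof (rule AE_eventually_notin_of_suminf[OF Dm])
    show "(\<Sum>k. emeasure M (D k)) < \<infinity>"
      by (rule suminf_geometric_finite[OF D_bound]) (use beta_int tau_int in \<open>auto simp: ennreal_mult_less_top\<close>)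
  qed
  then have inc: "AE \<omega> in M. \<exists>K. \<forall>k\<ge>K. (\<integral>\<^sup>+t. ennreal \<bar>X (Suc k) t \<omega> - X k t \<omega>\<bar> \<partial>N) \<le> ennreal ((1 / 2) ^ k)"
    using AE_space
  proof eventually_elim
    case (elim \<omega>)
    then show ?case unfolding eventually_sequentially D_def by (auto simp: not_le intro: less_imp_le)
  qed

  have "AE t in N. AE \<omega> in M. \<exists>K. \<forall>k. k \<ge> K \<longrightarrow> \<bar>u t \<omega> - X k t \<omega>\<bar> < (1 / 2) ^ k"
  proof -
    have fin: "(\<Sum>k. \<integral>\<^sup>+t. ennreal (4 ^ k) * (ennreal (wt t) * La (\<lambda>s. f (t, s) - g k t s)) \<partial>N) < \<infinity>"
    proof (rule suminf_geometric_finite[where C=1 and q="1/16"])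
      fix k
      have "(\<integral>\<^sup>+t. ennreal (4 ^ k) * (ennreal (wt t) * La (\<lambda>s. f (t, s) - g k t s)) \<partial>N) =
          ennreal (4 ^ k) * (\<integral>\<^sup>+t. ennreal (wt t) * La (\<lambda>s. f (t, s) - g k t s) \<partial>N)"
        by (rule nn_integral_cmult) measurable
      also have "\<dots> \<le> ennreal (4 ^ k) * ennreal ((1 / 64) ^ k)"
        by (subst nn_integral_N, measurable) (intro mult_left_mono I2, simp)
      also have "\<dots> = 1 * ennreal ((1 / 16) ^ k)"
        by (simp add: ennreal_mult[symmetric] power_mult_distrib[symmetric])
      finally show "(\<integral>\<^sup>+t. ennreal (4 ^ k) * (ennreal (wt t) * La (\<lambda>s. f (t, s) - g k t s)) \<partial>N) \<le> 1 * ennreal ((1 / 16) ^ k)" .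
    qed auto
    have "(\<integral>\<^sup>+t. (\<Sum>k. ennreal (4 ^ k) * (ennreal (wt t) * La (\<lambda>s. f (t, s) - g k t s))) \<partial>N) =
        (\<Sum>k. \<integral>\<^sup>+t. ennreal (4 ^ k) * (ennreal (wt t) * La (\<lambda>s. f (t, s) - g k t s)) \<partial>N)"
      by (rule nn_integral_suminf) measurable
    moreover have "(\<lambda>t. \<Sum>k. ennreal (4 ^ k) * (ennreal (wt t) * La (\<lambda>s. f (t, s) - g k t s))) \<in> borel_measurable N"
      by measurable
    ultimately have "AE t in N. (\<Sum>k. ennreal (4 ^ k) * (ennreal (wt t) * La (\<lambda>s. f (t, s) - g k t s))) \<noteq> \<infinity>"
      using fin by (intro nn_integral_PInf_AE) simp_all
    then show ?thesis
    proof eventually_elim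
      case (elim t)
      define E where "E k = {\<omega> \<in> space M. \<bar>u t \<omega> - noise_sum W (J k) (\<lambda>j. h k j t) (A k) \<omega>\<bar> \<ge> (1 / 2) ^ k}" for k
      have Xk [measurable]: "noise_sum W (J k) (\<lambda>j. h k j t) (A k) \<in> borel_measurable M" for k
        using A by auto
      have Em: "E k \<in> sets M" for k unfolding E_def by measurable
      have Eb: "emeasure M (E k) \<le> ennreal (128 / wt t) * (ennreal (4 ^ k) * (ennreal (wt t) * La (\<lambda>s. f (t, s) - g k t s)))" for k
      proof -
        have "emeasure M (E k) \<le> ennreal (128 * ((1 / 2) ^ k) powr (- \<alpha>)) * La (\<lambda>s. f (t, s) - g k t s)"
          unfolding E_def g_def by (rule noise_integral_tail[OF u]) (use J A in auto)
        also have "ennreal (128 * ((1 / 2) ^ k) powr (- \<alpha>)) \<le> ennreal (128 / wt t) * (ennreal (4 ^ k) * ennreal (wt t))"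
        proof -
          have "((1 / 2) ^ k) powr (- \<alpha>) = 2 powr (real k * \<alpha>)"
            by (simp add: powr_realpow[symmetric] powr_powr powr_divide powr_minus inverse_eq_divide)
          also have "\<dots> \<le> 2 powr (real (2 * k))" using alpha by (intro powr_mono) (auto simp: mult.commute[of _ "real k"] intro: mult_left_mono)
          also have "\<dots> = 4 ^ k" by (subst powr_realpow) (auto simp: power_mult)
          finally have "128 * ((1 / 2) ^ k) powr (- \<alpha>) \<le> 128 / wt t * (4 ^ k * wt t)"
            using wt_pos[of t] by simp
          from ennreal_leI[OF this]
          have "ennreal (128 * ((1 / 2) ^ k) powr (- \<alpha>)) \<le> ennreal (128 / wt t * (4 ^ k * wt t))" .
          also have "\<dots> = ennreal (128 / wt t) * ennreal (4 ^ k * wt t)"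
            using wt_pos[of t] by (intro ennreal_mult) auto
          also have "ennreal (4 ^ k * wt t) = ennreal (4 ^ k) * ennreal (wt t)"
            using wt_pos[of t] by (intro ennreal_mult) auto
          finally show ?thesis .
        qed
        finally show ?thesis by (simp add: mult_right_mono mult.assoc)
      qed
      have "(\<Sum>k. emeasure M (E k)) \<le> (\<Sum>k. ennreal (128 / wt t) * (ennreal (4 ^ k) * (ennreal (wt t) * La (\<lambda>s. f (t, s) - g k t s))))"
        by (intro suminf_le Eb) auto
      also have "\<dots> = ennreal (128 / wt t) * (\<Sum>k. ennreal (4 ^ k) * (ennreal (wt t) * La (\<lambda>s. f (t, s) - g k t s)))"
        by (rule ennreal_suminf_cmult)
      also have "\<dots> < \<infinity>" using elim by (simp add: ennreal_mult_less_top less_top)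
      finally have "AE \<omega> in M. eventually (\<lambda>k. \<omega> \<notin> E k) sequentially"
        by (rule AE_eventually_notin_of_suminf[OF Em])
      then show ?case using AE_space
      proof eventually_elim
        case (elim \<omega>)
        then show ?case unfolding eventually_sequentially E_def X_def by (auto simp: not_le)
      qed
    qed
  qed
  then have conv: "AE \<omega> in M. AE t in N. \<exists>K. \<forall>k. k \<ge> K \<longrightarrow> \<bar>u t \<omega> - X k t \<omega>\<bar> < (1 / 2) ^ k"
  proof (subst (asm) NM.AE_commute)
    have [measurable]: "(\<lambda>z. u (fst z) (snd z)) \<in> borel_measurable (N \<Otimes>\<^sub>M M)"
        "\<And>k. (\<lambda>z. X k (fst z) (snd z)) \<in> borel_measurable (N \<Otimes>\<^sub>M M)"
      using u_joint Xm by (auto simp: case_prod_beta cong: measurable_cong_sets)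
    show "{x \<in> space (N \<Otimes>\<^sub>M M). \<exists>K. \<forall>k. k \<ge> K \<longrightarrow> \<bar>u (fst x) (snd x) - X k (fst x) (snd x)\<bar> < (1 / 2) ^ k} \<in> sets (N \<Otimes>\<^sub>M M)"
      by measurable
  qed

  have hphi: "integrable lborel (\<lambda>t. h k j t * \<phi> t)" for k j
  proof -
    obtain B where B: "\<And>t. \<bar>h k j t\<bar> \<le> B" using hb[of k j] by (auto simp: bounded_iff)
    show ?thesis
    proof (rule Bochner_Integration.integrable_bound[of _ "\<lambda>t. B * \<bar>\<phi> t\<bar>"])
      show "AE t in lborel. norm (h k j t * \<phi> t) \<le> norm (B * \<bar>\<phi> t\<bar>)"
        using B by (intro AE_I2) (auto simp: abs_mult intro!: mult_right_mono order_trans[OF B abs_ge_self])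
    qed (use phi_int in auto)
  qed
  define c where "c k j = (LINT t|lborel. h k j t * \<phi> t)" for k j
  have Xphi: "integrable lborel (\<lambda>t. X k t \<omega> * \<phi> t)" for k \<omega>
  proof -
    have "integrable lborel (\<lambda>t. \<Sum>j\<in>J k. (h k j t * \<phi> t) * W (A k j) \<omega>)"
      by (intro Bochner_Integration.integrable_sum integrable_mult_left hphi)
    then show ?thesis by (simp add: X_def noise_sum_def sum_distrib_left sum_distrib_right mult_ac)
  qed
  have Zk: "noise_sum W (J k) (c k) (A k) \<omega> = (LINT t|lborel. X k t \<omega> * \<phi> t)" for k \<omega>
  proof -
    have "(LINT t|lborel. X k t \<omega> * \<phi> t) = (LINT t|lborel. (\<Sum>j\<in>J k. (h k j t * \<phi> t) * W (A k j) \<omega>))"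
      by (simp add: X_def noise_sum_def sum_distrib_left sum_distrib_right mult_ac)
    also have "\<dots> = (\<Sum>j\<in>J k. c k j * W (A k j) \<omega>)"
      unfolding c_def by (subst Bochner_Integration.integral_sum) (auto intro!: integrable_mult_left hphi)
    finally show ?thesis by (simp add: noise_sum_def)
  qed
  have gphi: "integrable lborel (\<lambda>t. g k t s * \<phi> t)" for k s
  proof -
    have "integrable lborel (\<lambda>t. \<Sum>j\<in>J k. (h k j t * \<phi> t) * indicator (A k j) s)"
      by (intro Bochner_Integration.integrable_sum integrable_mult_left hphi)
    then show ?thesis by (simp add: g_def step_def sum_distrib_left sum_distrib_right mult_ac del: sum_mult_indicator)
  qed
  have pk: "step (J k) (c k) (A k) s = (LINT t|lborel. g k t s * \<phi> t)" for k s
  proof -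
    have "(LINT t|lborel. g k t s * \<phi> t) = (LINT t|lborel. (\<Sum>j\<in>J k. (h k j t * \<phi> t) * indicator (A k j) s))"
      by (simp add: g_def step_def sum_distrib_left sum_distrib_right mult_ac del: sum_mult_indicator)
    also have "\<dots> = (\<Sum>j\<in>J k. c k j * indicator (A k j) s)"
      unfolding c_def by (subst Bochner_Integration.integral_sum) (auto intro!: integrable_mult_left hphi)
    finally show ?thesis by (simp add: step_def)
  qed

  have main: "AE \<omega> in M. integrable lborel (\<lambda>t. u t \<omega> * \<phi> t) \<and>
      (\<lambda>k. noise_sum W (J k) (c k) (A k) \<omega>) \<longlonglongrightarrow> (LINT t|lborel. u t \<omega> * \<phi> t)"
    using inc conv AE_space
  proof eventually_elim
    case (elim \<omega>)
    note [measurable] = u_t[OF elim(3)]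
    obtain K where K: "\<And>k. k \<ge> K \<Longrightarrow> (\<integral>\<^sup>+t. ennreal \<bar>X (Suc k) t \<omega> - X k t \<omega>\<bar> \<partial>N) \<le> ennreal ((1 / 2) ^ k)"
      using elim(1) by auto
    have lim: "AE t in N. (\<lambda>k. X k t \<omega>) \<longlonglongrightarrow> u t \<omega>"
      using elim(2)
    proof eventually_elim
      case (elim t)
      then obtain K where K: "\<And>k. k \<ge> K \<Longrightarrow> \<bar>u t \<omega> - X k t \<omega>\<bar> < (1 / 2) ^ k" by auto
      have "(\<lambda>k. X k t \<omega> - u t \<omega>) \<longlonglongrightarrow> 0"
      proof (rule Lim_null_comparison)
        show "\<forall>\<^sub>F k in sequentially. norm (X k t \<omega> - u t \<omega>) \<le> (1 / 2) ^ k"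
          using K by (auto simp: eventually_sequentially abs_minus_commute intro!: exI[of _ K] less_imp_le)
        show "(\<lambda>k. (1 / 2 :: real) ^ k) \<longlonglongrightarrow> 0" by (rule LIMSEQ_power_zero) simp
      qed
      then show ?case by (simp add: LIM_zero_iff)
    qed
    have L1: "(\<integral>\<^sup>+t. ennreal \<bar>(u t \<omega> - X k t \<omega>) * \<phi> t\<bar> \<partial>lborel) \<le> ennreal (2 * (1 / 2) ^ k)" if "k \<ge> K" for k
    proof -
      have "(\<integral>\<^sup>+t. ennreal \<bar>u t \<omega> - X k t \<omega>\<bar> \<partial>N) \<le> ennreal (2 * (1 / 2) ^ k)"
        by (rule L1_limit_of_geometric[OF _ _ lim K that]) measurable
      then show ?thesis by (subst (asm) nn_integral_N) (auto simp: abs_mult ennreal_mult mult.commute)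
    qed
    have diff: "integrable lborel (\<lambda>t. (u t \<omega> - X K t \<omega>) * \<phi> t)"
      by (rule integrableI_bounded) (use le_less_trans[OF L1[of K]] in auto)
    have "integrable lborel (\<lambda>t. (u t \<omega> - X K t \<omega>) * \<phi> t + X K t \<omega> * \<phi> t)"
      by (intro Bochner_Integration.integrable_add diff Xphi)
    then have int: "integrable lborel (\<lambda>t. u t \<omega> * \<phi> t)" by (simp add: algebra_simps)
    have "(\<lambda>k. noise_sum W (J k) (c k) (A k) \<omega> - (LINT t|lborel. u t \<omega> * \<phi> t)) \<longlonglongrightarrow> 0"
    proof (rule Lim_null_comparison)
      have "norm (noise_sum W (J k) (c k) (A k) \<omega> - (LINT t|lborel. u t \<omega> * \<phi> t)) \<le> 2 * (1 / 2) ^ k" if "k \<ge> K" for k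
      proof -
        have d: "integrable lborel (\<lambda>t. (u t \<omega> - X k t \<omega>) * \<phi> t)"
          using Bochner_Integration.integrable_diff[OF int Xphi[of k \<omega>]] by (simp add: algebra_simps)
        have "noise_sum W (J k) (c k) (A k) \<omega> - (LINT t|lborel. u t \<omega> * \<phi> t) = - (LINT t|lborel. (u t \<omega> - X k t \<omega>) * \<phi> t)"
          unfolding Zk left_diff_distrib using int Xphi by simp
        then have "ennreal (norm (noise_sum W (J k) (c k) (A k) \<omega> - (LINT t|lborel. u t \<omega> * \<phi> t))) =
            ennreal (norm (LINT t|lborel. (u t \<omega> - X k t \<omega>) * \<phi> t))" by simp
        also have "\<dots> \<le> (\<integral>\<^sup>+t. ennreal (norm ((u t \<omega> - X k t \<omega>) * \<phi> t)) \<partial>lborel)"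
          by (rule integral_norm_bound_ennreal[OF d])
        also have "\<dots> \<le> ennreal (2 * (1 / 2) ^ k)" using L1[OF that] by simp
        finally show ?thesis by (simp add: ennreal_le_iff)
      qed
      then show "\<forall>\<^sub>F k in sequentially. norm (noise_sum W (J k) (c k) (A k) \<omega> - (LINT t|lborel. u t \<omega> * \<phi> t)) \<le> 2 * (1 / 2) ^ k"
        by (auto simp: eventually_sequentially)
      show "(\<lambda>k. 2 * (1 / 2 :: real) ^ k) \<longlonglongrightarrow> 0"
        by (rule tendsto_mult_right_zero) (rule LIMSEQ_power_zero, simp)
    qed
    then show ?case using int by (simp add: LIM_zero_iff)
  qed
  then show "AE \<omega> in M. integrable lborel (\<lambda>t. u t \<omega> * \<phi> t)" by eventually_elim auto

  have pw: "AE s in lborel. s \<in> S \<longrightarrow> (\<lambda>k. step (J k) (c k) (A k) s) \<longlonglongrightarrow> (LINT t|lborel. f (t, s) * \<phi> t)"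
  proof -
    have "AE s in lborel. (\<lambda>k. ennreal (ws s) * (\<integral>\<^sup>+t. ennreal \<bar>(f (t, s) - g k t s) * \<phi> t\<bar> \<partial>lborel) * indicator S s) \<longlonglongrightarrow> 0"
    proof (rule AE_tendsto_zero_of_suminf)
      show "(\<Sum>k. \<integral>\<^sup>+s. ennreal (ws s) * (\<integral>\<^sup>+t. ennreal \<bar>(f (t, s) - g k t s) * \<phi> t\<bar> \<partial>lborel) * indicator S s \<partial>lborel) < \<infinity>"
        by (rule suminf_geometric_finite[where C=1 and q="1 / 64"]) (use I3 in auto)
    qed measurable
    then show ?thesis
    proof (eventually_elim, intro impI)
      fix s
      let ?d = "\<lambda>k. \<integral>\<^sup>+t. ennreal \<bar>(f (t, s) - g k t s) * \<phi> t\<bar> \<partial>lborel"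
      assume *: "(\<lambda>k. ennreal (ws s) * ?d k * indicator S s) \<longlonglongrightarrow> 0" and s: "s \<in> S"
      from * s have "(\<lambda>k. ennreal (1 / ws s) * (ennreal (ws s) * ?d k)) \<longlonglongrightarrow> ennreal (1 / ws s) * 0"
        by (intro ennreal_tendsto_cmult) auto
      moreover have "ennreal (1 / ws s) * (ennreal (ws s) * ?d k) = ?d k" for k
        using ws_pos(1)[of s] by (simp add: mult.assoc[symmetric] ennreal_mult[symmetric])
      ultimately have d0: "?d \<longlonglongrightarrow> 0" by simp
      have "(\<lambda>k. ennreal \<bar>step (J k) (c k) (A k) s - (LINT t|lborel. f (t, s) * \<phi> t)\<bar>) \<longlonglongrightarrow> 0"
      proof (rule tendsto_sandwich[OF _ _ tendsto_const d0])
        have "ennreal \<bar>step (J k) (c k) (A k) s - (LINT t|lborel. f (t, s) * \<phi> t)\<bar> \<le> ?d k" for k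
        proof -
          have d: "integrable lborel (\<lambda>t. (f (t, s) - g k t s) * \<phi> t)"
            using Bochner_Integration.integrable_diff[OF f_phi gphi[of k s]] by (simp add: algebra_simps)
          have "step (J k) (c k) (A k) s - (LINT t|lborel. f (t, s) * \<phi> t) = - (LINT t|lborel. (f (t, s) - g k t s) * \<phi> t)"
            unfolding pk left_diff_distrib using f_phi gphi by simp
          then have "ennreal \<bar>step (J k) (c k) (A k) s - (LINT t|lborel. f (t, s) * \<phi> t)\<bar> =
              ennreal (norm (LINT t|lborel. (f (t, s) - g k t s) * \<phi> t))" by simp
          also have "\<dots> \<le> ?d k" using integral_norm_bound_ennreal[OF d] by simp
          finally show ?thesis .
        qed
        then show "\<forall>\<^sub>F k in sequentially. ennreal \<bar>step (J k) (c k) (A k) s - (LINT t|lborel. f (t, s) * \<phi> t)\<bar> \<le> ?d k" by simp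
      qed simp
      then have "(\<lambda>k. \<bar>step (J k) (c k) (A k) s - (LINT t|lborel. f (t, s) * \<phi> t)\<bar>) \<longlonglongrightarrow> 0"
        by (subst (asm) ennreal_0[symmetric], subst (asm) tendsto_ennreal_iff) auto
      then show "(\<lambda>k. step (J k) (c k) (A k) s) \<longlonglongrightarrow> (LINT t|lborel. f (t, s) * \<phi> t)"
        by (simp add: tendsto_rabs_zero_iff LIM_zero_iff)
    qed
  qed
  show "has_noise_integral M \<alpha> S W (\<lambda>s. LINT t|lborel. f (t, s) * \<phi> t) (\<lambda>\<omega>. LINT t|lborel. u t \<omega> * \<phi> t)"
  proof (rule noise_integral_from_AE_limits[OF J A _ pw])
    show "(\<lambda>s. LINT t|lborel. f (t, s) * \<phi> t) \<in> borel_measurable borel" by measurable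
    show "(\<lambda>\<omega>. LINT t|lborel. u t \<omega> * \<phi> t) \<in> borel_measurable M" by measurable
    show "AE \<omega> in M. (\<lambda>k. noise_sum W (J k) (c k) (A k) \<omega>) \<longlonglongrightarrow> (LINT t|lborel. u t \<omega> * \<phi> t)"
      using main by eventually_elim auto
  qed
qed

end

section \<open>Test functions\<close>

lemma partials_Nil [simp]: "partials [] f = f"
  by (simp add: partials_def)

lemma partials_Cons: "partials (i # I) f = partial i (partials I f)"
  by (simp add: partials_def)

lemma smoothD: "smooth f \<Longrightarrow> partials I f differentiable (at x)"
  by (simp add: smooth_def differentiable_on_def)

lemma partial_eq: "(f has_derivative D) (at x) \<Longrightarrow> partial i f x = D (axis i 1)"
  unfolding partial_def by (simp add: frechet_derivative_at[symmetric])

lemma partial_linear: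
  assumes "f differentiable (at x)" "g differentiable (at x)"
  shows "partial i (\<lambda>x. a * f x + b * g x) x = a * partial i f x + b * partial i g x"
proof -
  have "(f has_derivative frechet_derivative f (at x)) (at x)" "(g has_derivative frechet_derivative g (at x)) (at x)"
    using assms frechet_derivative_works by blast+
  then have "((\<lambda>x. a * f x + b * g x) has_derivative
      (\<lambda>y. a * frechet_derivative f (at x) y + b * frechet_derivative g (at x) y)) (at x)"
    by (auto intro!: derivative_eq_intros)
  then show ?thesis unfolding partial_def by (simp add: frechet_derivative_at[symmetric])
qed

lemma partials_linear:
  assumes "smooth f" "smooth g"
  shows "partials I (\<lambda>x. a * f x + b * g x) = (\<lambda>x. a * partials I f x + b * partials I g x)"
proof (induction I)
  case (Cons i I)
  show ?case unfolding partials_Cons Cons.IH by (rule ext) (intro partial_linear smoothD assms)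
qed simp

lemma smooth_linear: "smooth f \<Longrightarrow> smooth g \<Longrightarrow> smooth (\<lambda>x. a * f x + b * g x)"
  unfolding smooth_def[of "\<lambda>x. a * f x + b * g x"]
  by (auto simp: partials_linear differentiable_on_def intro!: differentiable_add differentiable_cmult_left_iff[THEN iffD2] smoothD)

lemma partial_shift:
  assumes "f differentiable (at (s + x))"
  shows "partial i (\<lambda>x. f (s + x)) x = partial i f (s + x)"
proof -
  have "(f has_derivative frechet_derivative f (at (s + x))) (at (s + x))"
    using assms frechet_derivative_works by blast
  then have "((\<lambda>x. f (s + x)) has_derivative (\<lambda>y. frechet_derivative f (at (s + x)) y)) (at x)"
    by (rule has_derivative_compose[where f="\<lambda>x. s + x", rotated]) (auto intro!: derivative_eq_intros)
  then show ?thesis unfolding partial_def by (simp add: frechet_derivative_at[symmetric])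
qed

lemma partials_shift:
  assumes "smooth f"
  shows "partials I (\<lambda>x. f (s + x)) = (\<lambda>x. partials I f (s + x))"
proof (induction I)
  case (Cons i I)
  show ?case unfolding partials_Cons Cons.IH by (rule ext) (intro partial_shift smoothD assms)
qed simp

lemma smooth_shift: "smooth f \<Longrightarrow> smooth (\<lambda>x. f (s + x))"
proof -
  assume f: "smooth f"
  have "(\<lambda>x. partials I f (s + x)) differentiable (at x)" for I x
  proof -
    have "(partials I f \<circ> (\<lambda>x. s + x)) differentiable (at x)"
      by (rule differentiable_chain_at) (auto intro!: smoothD f)
    then show ?thesis by (simp add: comp_def)
  qed
  then show ?thesis
    unfolding smooth_def[of "\<lambda>x. f (s + x)"] by (auto simp: partials_shift[OF f] differentiable_on_def)
qed

lemma test_fun_smooth: "\<phi> \<in> test_funs \<Longrightarrow> smooth \<phi>"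
  by (simp add: test_funs_def)

lemma test_fun_continuous: "\<phi> \<in> test_funs \<Longrightarrow> continuous_on UNIV \<phi>"
  using smoothD[OF test_fun_smooth, of \<phi> "[]"]
  by (auto intro!: continuous_at_imp_continuous_on differentiable_imp_continuous_within)

lemma test_fun_measurable: "\<phi> \<in> test_funs \<Longrightarrow> \<phi> \<in> borel_measurable borel"
  using borel_measurable_continuous_onI[OF test_fun_continuous] .

lemma test_fun_bound:
  assumes "\<phi> \<in> test_funs"
  obtains K B where "compact K" "\<And>x. \<bar>\<phi> x\<bar> \<le> B * indicator K x"
proof -
  let ?K = "closure {x. \<phi> x \<noteq> 0}"
  have K: "compact ?K" using assms by (simp add: test_funs_def)
  have "compact (\<phi> ` ?K)"
    by (rule compact_continuous_image[OF _ K]) (rule continuous_on_subset[OF test_fun_continuous[OF assms]], simp)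
  then obtain B where "\<forall>y\<in>\<phi> ` ?K. norm y \<le> B"
    using compact_imp_bounded bounded_iff by metis
  then have B: "\<And>x. x \<in> ?K \<Longrightarrow> \<bar>\<phi> x\<bar> \<le> B" by auto
  have "\<bar>\<phi> x\<bar> \<le> B * indicator ?K x" for x
  proof (cases "x \<in> ?K")
    case False
    then have "\<phi> x = 0" using closure_subset[of "{x. \<phi> x \<noteq> 0}"] by auto
    then show ?thesis using False by simp
  qed (use B in auto)
  then show thesis using that[OF K] by blast
qed

lemma test_fun_integrable:
  assumes "\<phi> \<in> test_funs" shows "integrable lborel \<phi>"
proof -
  obtain K B where K: "compact K" and B: "\<And>x. \<bar>\<phi> x\<bar> \<le> B * indicator K x" by (rule test_fun_bound[OF assms]) blast
  show ?thesis
  proof (rule Bochner_Integration.integrable_bound[of _ "\<lambda>x. B * indicator K x"])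
    show "integrable lborel (\<lambda>x. B * indicator K x :: real)"
      using K by (intro integrable_mult_right integrable_real_indicator)
        (auto simp: emeasure_bounded_finite[OF compact_imp_bounded[OF K], unfolded infinity_ennreal_def] borel_compact)
    show "AE x in lborel. norm (\<phi> x) \<le> norm (B * indicator K x)"
      using B by (intro AE_I2) (auto intro: order_trans[OF B abs_ge_self])
  qed (use test_fun_measurable[OF assms] in simp)
qed

lemma test_funs_linear:
  assumes "\<phi> \<in> test_funs" "\<psi> \<in> test_funs"
  shows "(\<lambda>x. a * \<phi> x + b * \<psi> x) \<in> test_funs"
proof -
  let ?g = "\<lambda>x. a * \<phi> x + b * \<psi> x"
  have "compact (closure {x. \<phi> x \<noteq> 0} \<union> closure {x. \<psi> x \<noteq> 0})"
    using assms by (intro compact_Un) (auto simp: test_funs_def)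
  moreover have "{x. ?g x \<noteq> 0} \<subseteq> {x. \<phi> x \<noteq> 0} \<union> {x. \<psi> x \<noteq> 0}" by auto
  then have "closure {x. ?g x \<noteq> 0} \<subseteq> closure {x. \<phi> x \<noteq> 0} \<union> closure {x. \<psi> x \<noteq> 0}"
    unfolding closure_Un[symmetric] by (rule closure_mono)
  ultimately have "compact (closure {x. ?g x \<noteq> 0})"
    by (meson bounded_subset closed_closure compact_eq_bounded_closed)
  then show ?thesis using assms by (auto simp: test_funs_def smooth_linear)
qed

lemma test_funs_shift:
  assumes "\<phi> \<in> test_funs"
  shows "(\<lambda>x. \<phi> (s + x)) \<in> test_funs"
proof -
  have "{x. \<phi> (s + x) \<noteq> 0} = (\<lambda>x. - s + x) ` {x. \<phi> x \<noteq> 0}"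
    by (auto simp: image_iff intro!: exI[of _ "s + _"])
  then have "closure {x. \<phi> (s + x) \<noteq> 0} = (\<lambda>x. - s + x) ` closure {x. \<phi> x \<noteq> 0}"
    by (simp only: closure_translation)
  moreover have "compact ((\<lambda>x. - s + x) ` closure {x. \<phi> x \<noteq> 0})"
    using assms by (intro compact_translation) (simp add: test_funs_def)
  ultimately have "compact (closure {x. \<phi> (s + x) \<noteq> 0})" by simp
  then show ?thesis using assms by (auto simp: test_funs_def smooth_shift)
qed

definition flat_exp :: "nat \<Rightarrow> real \<Rightarrow> real" where
  "flat_exp n y = (if y > 0 then (1 / y) ^ n * exp (- (1 / y)) else 0)"

lemma flat_exp_div_tendsto: "((\<lambda>y. flat_exp n y / y) \<longlongrightarrow> 0) (at 0)"
proof (rule filterlim_split_at_real)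
  have "((\<lambda>y. y ^ Suc n / exp y) \<longlongrightarrow> (0::real)) at_top" by (rule tendsto_power_div_exp_0)
  then have "((\<lambda>y. inverse y ^ Suc n / exp (inverse y)) \<longlongrightarrow> (0::real)) (at_right 0)"
    by (rule filterlim_compose[OF _ filterlim_inverse_at_top_right])
  moreover have "eventually (\<lambda>y. inverse y ^ Suc n / exp (inverse y) = flat_exp n y / y) (at_right 0)"
    using eventually_at_right_less[of 0]
    by eventually_elim (auto simp: flat_exp_def exp_minus field_simps)
  ultimately show "((\<lambda>y. flat_exp n y / y) \<longlongrightarrow> 0) (at_right 0)" by (rule Lim_transform_eventually)
  have "eventually (\<lambda>y. flat_exp n y / y = 0) (at_left 0)"
    by (auto simp: flat_exp_def eventually_at_filter)
  then show "((\<lambda>y. flat_exp n y / y) \<longlongrightarrow> 0) (at_left 0)" by (rule tendsto_eventually)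
qed

lemma DERIV_flat_exp: "DERIV (flat_exp n) y :> flat_exp (n + 2) y - real n * flat_exp (n + 1) y"
proof (cases "y = 0")
  case True
  show ?thesis using flat_exp_div_tendsto[of n] unfolding True by (simp add: DERIV_def flat_exp_def)
next
  case False
  show ?thesis
  proof (cases "y > 0")
    case True
    have "DERIV (\<lambda>y. (1 / y) ^ n * exp (- (1 / y))) y :> flat_exp (n + 2) y - real n * flat_exp (n + 1) y"
    proof -
      define z where "z = 1 / y"
      have D1: "DERIV (\<lambda>y. 1 / y) y :> - (z * z)"
        using True by (auto intro!: derivative_eq_intros simp: z_def)
      have "DERIV (\<lambda>y. exp (- (1 / y))) y :> exp (- z) * (z * z)"
        using DERIV_fun_exp[OF DERIV_minus[OF D1]] by (simp add: z_def)
      from DERIV_mult[OF DERIV_power[OF D1, of n] this]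
      have "DERIV (\<lambda>y. (1 / y) ^ n * exp (- (1 / y))) y :>
          real n * (- (z * z) * z ^ (n - Suc 0)) * exp (- z) + exp (- z) * (z * z) * z ^ n"
        by (simp add: z_def[symmetric])
      also have "real n * (- (z * z) * z ^ (n - Suc 0)) * exp (- z) + exp (- z) * (z * z) * z ^ n =
          flat_exp (n + 2) y - real n * flat_exp (n + 1) y"
        using True by (cases n) (simp_all add: flat_exp_def z_def[symmetric] algebra_simps)
      finally show ?thesis .
    qed
    then show ?thesis
    proof (rule has_field_derivative_transform_within_open[of _ _ _ "{0<..}"])
      show "(1 / x) ^ n * exp (- (1 / x)) = flat_exp n x" if "x \<in> {0<..}" for x using that by (simp add: flat_exp_def)
    qed (use True in auto)
  next
    case neg: False
    have "DERIV (\<lambda>y. 0) y :> flat_exp (n + 2) y - real n * flat_exp (n + 1) y" using neg by (simp add: flat_exp_def)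
    then show ?thesis
    proof (rule has_field_derivative_transform_within_open[of _ _ _ "{..<0}"])
      show "0 = flat_exp n x" if "x \<in> {..<0}" for x using that by (simp add: flat_exp_def)
    qed (use False neg in auto)
  qed
qed

text \<open>Closure under partial derivatives replaces a formula for the iterated derivatives of the bump
  \<open>flat_exp 0 (R - x \<bullet> x)\<close>.\<close>

inductive bump_algebra :: "real \<Rightarrow> (real ^ 'n::finite \<Rightarrow> real) \<Rightarrow> bool" for R where
  "bump_algebra R (\<lambda>x. c)"
| "bump_algebra R (\<lambda>x. x $ i)"
| "bump_algebra R (\<lambda>x. flat_exp n (R - x \<bullet> x))"
| "bump_algebra R f \<Longrightarrow> bump_algebra R g \<Longrightarrow> bump_algebra R (\<lambda>x. f x + g x)"
| "bump_algebra R f \<Longrightarrow> bump_algebra R g \<Longrightarrow> bump_algebra R (\<lambda>x. f x * g x)"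

lemma bump_algebra_partial:
  fixes f :: "real ^ 'n::finite \<Rightarrow> real"
  assumes "bump_algebra R f"
  shows "(\<forall>x. f differentiable (at x)) \<and> (\<forall>i. bump_algebra R (partial i f))"
  using assms
proof (induction rule: bump_algebra.induct)
  case (1 c)
  have "partial i (\<lambda>x. c) = (\<lambda>x. 0)" for i :: 'n by (rule ext) (simp add: partial_eq[where D="\<lambda>_. 0"])
  then show ?case by (auto intro: bump_algebra.intros)
next
  case (2 j)
  have d: "((\<lambda>x. x $ j) has_derivative (\<lambda>y. y $ j)) (at x)" for x :: "real ^ 'n"
    by (rule bounded_linear_imp_has_derivative[OF bounded_linear_vec_nth])
  have "partial i (\<lambda>x. x $ j) = (\<lambda>x. axis i 1 $ j)" for i :: 'n by (rule ext) (simp add: partial_eq[OF d])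
  then show ?case using d by (auto intro: bump_algebra.intros simp: differentiable_def)
next
  case (3 n)
  have d: "((\<lambda>x. flat_exp n (R - x \<bullet> x)) has_derivative
      (\<lambda>y. (flat_exp (n + 2) (R - x \<bullet> x) - real n * flat_exp (n + 1) (R - x \<bullet> x)) * (- 2 * (x \<bullet> y)))) (at x)" for x :: "real ^ 'n"
  proof -
    have "((\<lambda>x. R - x \<bullet> x) has_derivative (\<lambda>y. - 2 * (x \<bullet> y))) (at x)"
      by (auto intro!: derivative_eq_intros simp: inner_commute)
    from has_derivative_compose[OF this, OF has_field_derivative_imp_has_derivative[OF DERIV_flat_exp]]
    show ?thesis by simp
  qed
  have "partial i (\<lambda>x. flat_exp n (R - x \<bullet> x)) =
      (\<lambda>x. (flat_exp (n + 2) (R - x \<bullet> x) + (- real n) * flat_exp (n + 1) (R - x \<bullet> x)) * (- 2 * x $ i))" for i :: 'n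
    by (rule ext) (simp add: partial_eq[OF d] inner_axis)
  moreover have "bump_algebra R (\<lambda>x. (flat_exp (n + 2) (R - x \<bullet> x) + (- real n) * flat_exp (n + 1) (R - x \<bullet> x)) * (- 2 * x $ i))" for i :: 'n
    by (intro bump_algebra.intros)
  ultimately show ?case using d by (auto simp: differentiable_def)
next
  case (4 f g)
  have "partial i (\<lambda>x. f x + g x) = (\<lambda>x. partial i f x + partial i g x)" for i
    using 4 partial_linear[of f _ g i 1 1] by (auto simp: fun_eq_iff)
  then show ?case using 4 by (auto intro: bump_algebra.intros)
next
  case (5 f g)
  have "partial i (\<lambda>x. f x * g x) = (\<lambda>x. f x * partial i g x + partial i f x * g x)" for i
  proof
    fix x
    have "(f has_derivative frechet_derivative f (at x)) (at x)" "(g has_derivative frechet_derivative g (at x)) (at x)"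
      using 5 frechet_derivative_works by blast+
    from has_derivative_mult[OF this] show "partial i (\<lambda>x. f x * g x) x = f x * partial i g x + partial i f x * g x"
      by (subst partial_eq, assumption) (simp add: partial_def)
  qed
  then show ?case using 5 by (auto intro!: bump_algebra.intros differentiable_mult)
qed

lemma bump_algebra_smooth: "bump_algebra R f \<Longrightarrow> smooth f"
proof -
  assume f: "bump_algebra R f"
  have "bump_algebra R (partials I f)" for I
    by (induction I) (auto simp: f partials_Cons bump_algebra_partial)
  then show ?thesis using bump_algebra_partial by (auto simp: smooth_def differentiable_on_def)
qed

lemma bump_exists:
  obtains \<phi> :: "real ^ 'n::finite \<Rightarrow> real" where "\<phi> \<in> test_funs" "\<And>x. norm x \<le> r \<Longrightarrow> \<phi> x \<ge> exp (- 1)"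
proof
  let ?R = "r\<^sup>2 + 1"
  let ?\<phi> = "\<lambda>x::real ^ 'n. flat_exp 0 (?R - x \<bullet> x)"
  have "smooth ?\<phi>" by (rule bump_algebra_smooth[of ?R]) (rule bump_algebra.intros)
  moreover have "bounded {x. ?\<phi> x \<noteq> 0}"
    unfolding bounded_iff
  proof (intro exI ballI)
    fix x assume "x \<in> {x. ?\<phi> x \<noteq> 0}"
    then have "x \<bullet> x \<le> ?R" by (auto simp: flat_exp_def split: if_splits)
    then show "norm x \<le> sqrt ?R" by (simp add: norm_eq_sqrt_inner)
  qed
  then have "compact (closure {x. ?\<phi> x \<noteq> 0})" by (simp add: compact_closure)
  ultimately show "?\<phi> \<in> test_funs" by (simp add: test_funs_def)
  fix x :: "real ^ 'n" assume "norm x \<le> r"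
  then have "(norm x)\<^sup>2 \<le> r\<^sup>2" by (intro power_mono) auto
  then have "?R - x \<bullet> x \<ge> 1" by (simp add: power2_norm_eq_inner)
  then show "?\<phi> x \<ge> exp (- 1)" by (simp add: flat_exp_def)
qed

section \<open>The three integrability conditions\<close>

lemma Psi_le_split:
  assumes a: "0 < a" "a < 2" and \<tau>: "\<tau> > 0" and x: "x \<noteq> 0"
  shows "Psi a x \<tau> b \<le> ennreal (\<bar>x\<bar> powr a * \<tau> powr (1 - a) / (2 - a)) +
    ennreal \<bar>x\<bar> * (\<integral>\<^sup>+v\<in>{\<tau> / \<bar>x\<bar>..b}. ennreal (v powr (- a)) \<partial>lborel)"
proof -
  define c where "c = \<tau> / \<bar>x\<bar>"
  have c: "c > 0" using \<tau> x by (simp add: c_def)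
  have "Psi a x \<tau> b \<le> (\<integral>\<^sup>+v. ennreal (min (x\<^sup>2 * v / \<tau>) \<bar>x\<bar> * v powr (- a)) * indicator {0..c} v +
      ennreal \<bar>x\<bar> * (ennreal (v powr (- a)) * indicator {c..b} v) \<partial>lborel)"
    unfolding Psi_def
  proof (intro nn_integral_mono)
    fix v :: real
    have "min (x\<^sup>2 * v / \<tau>) \<bar>x\<bar> * v powr (- a) \<le> \<bar>x\<bar> * v powr (- a)"
      by (intro mult_right_mono) auto
    then have "ennreal (min (x\<^sup>2 * v / \<tau>) \<bar>x\<bar> * v powr (- a)) \<le> ennreal \<bar>x\<bar> * ennreal (v powr (- a))"
      by (subst ennreal_mult[symmetric]) (auto intro: ennreal_leI)
    then show "ennreal (min (x\<^sup>2 * v / \<tau>) \<bar>x\<bar> * v powr (- a)) * indicator {0..b} v \<le>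
      ennreal (min (x\<^sup>2 * v / \<tau>) \<bar>x\<bar> * v powr (- a)) * indicator {0..c} v +
      ennreal \<bar>x\<bar> * (ennreal (v powr (- a)) * indicator {c..b} v)"
      by (auto simp: indicator_def)
  qed
  also have "\<dots> = Psi a x \<tau> c + ennreal \<bar>x\<bar> * (\<integral>\<^sup>+v\<in>{c..b}. ennreal (v powr (- a)) \<partial>lborel)"
    unfolding Psi_def by (subst nn_integral_add, measurable, subst nn_integral_cmult, measurable)
  also have "Psi a x \<tau> c \<le> ennreal (x\<^sup>2 / \<tau> * (c powr (2 - a) / (2 - a)))"
    using a \<tau> c by (intro Psi_le_square) auto
  also have "x\<^sup>2 / \<tau> * (c powr (2 - a) / (2 - a)) = \<bar>x\<bar> powr a * \<tau> powr (1 - a) / (2 - a)"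
  proof -
    have "c powr (2 - a) = \<tau> * \<tau> powr (1 - a) / (x\<^sup>2 / \<bar>x\<bar> powr a)"
      using \<tau> x powr_add[of \<tau> 1 "1 - a"]
      by (simp add: c_def powr_divide powr_diff powr_numeral)
    then show ?thesis using \<tau> x by simp
  qed
  finally show ?thesis by (simp add: c_def add_right_mono)
qed

lemma Psi_gt1:
  assumes a: "1 < a" "a < 2" and \<tau>: "\<tau> > 0"
  shows "Psi a x \<tau> b \<le> ennreal ((1 / (2 - a) + 1 / (a - 1)) * (\<bar>x\<bar> powr a * \<tau> powr (1 - a)))"
proof (cases "x = 0")
  case x: False
  define c where "c = \<tau> / \<bar>x\<bar>"
  have c: "c > 0" using \<tau> x by (simp add: c_def)
  have int: "(\<integral>\<^sup>+v\<in>{c..b}. ennreal (v powr (- a)) \<partial>lborel) \<le> ennreal (c powr (1 - a) / (a - 1))"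
  proof (cases "c \<le> b")
    case True
    have "(\<integral>\<^sup>+v\<in>{c..b}. ennreal (v powr (- a)) \<partial>lborel) =
        ennreal ((- (b powr (1 - a) / (a - 1))) - (- (c powr (1 - a) / (a - 1))))"
    proof (rule nn_integral_FTC_Icc[where F="\<lambda>v. - (v powr (1 - a) / (a - 1))"])
      fix v assume "v \<in> {c..b}"
      then have v: "c \<le> v" "v \<le> b" by auto
      have "((\<lambda>v. - (v powr (1 - a) / (a - 1))) has_real_derivative - ((1 - a) * v powr (1 - a - 1) / (a - 1))) (at v)"
        using v c a by (intro DERIV_minus DERIV_cdivide has_real_derivative_powr) auto
      moreover have "- ((1 - a) * v powr (1 - a - 1) / (a - 1)) = v powr (- a)"
        using a by (simp add: field_simps)
      ultimately show "((\<lambda>v. - (v powr (1 - a) / (a - 1))) has_real_derivative v powr (- a)) (at v)" by simp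
    qed (use True in auto)
    also have "\<dots> \<le> ennreal (c powr (1 - a) / (a - 1))" using a by (intro ennreal_leI) auto
    finally show ?thesis .
  qed auto
  have "Psi a x \<tau> b \<le> ennreal (\<bar>x\<bar> powr a * \<tau> powr (1 - a) / (2 - a)) + ennreal \<bar>x\<bar> * ennreal (c powr (1 - a) / (a - 1))"
    using Psi_le_split[of a \<tau> x b] a \<tau> x mult_left_mono[OF int, of "ennreal \<bar>x\<bar>"]
    by (auto simp: c_def intro: order_trans add_left_mono)
  also have "ennreal \<bar>x\<bar> * ennreal (c powr (1 - a) / (a - 1)) = ennreal (\<bar>x\<bar> powr a * \<tau> powr (1 - a) / (a - 1))"
  proof -
    have "\<bar>x\<bar> * c powr (1 - a) = \<bar>x\<bar> powr a * \<tau> powr (1 - a)"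
      using \<tau> x by (simp add: c_def powr_divide powr_diff)
    then show ?thesis using a by (simp add: ennreal_mult[symmetric])
  qed
  also have "ennreal (\<bar>x\<bar> powr a * \<tau> powr (1 - a) / (2 - a)) + ennreal (\<bar>x\<bar> powr a * \<tau> powr (1 - a) / (a - 1)) =
      ennreal ((1 / (2 - a) + 1 / (a - 1)) * (\<bar>x\<bar> powr a * \<tau> powr (1 - a)))"
    using a by (subst ennreal_plus[symmetric]) (auto simp: distrib_right)
  finally show ?thesis .
qed simp

lemma log_plus_nonneg: "log_plus x \<ge> 0"
  by (simp add: log_plus_def)

lemma log_plus_mono: "0 < x \<Longrightarrow> x \<le> y \<Longrightarrow> log_plus x \<le> log_plus y"
  by (auto simp: log_plus_def max_def)

lemma log_plus_mult: "0 < x \<Longrightarrow> 0 < y \<Longrightarrow> log_plus (x * y) \<le> log_plus x + log_plus y"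
proof -
  assume "0 < x" "0 < y"
  then have "ln (x * y) = ln x + ln y" by (simp add: ln_mult)
  then show ?thesis unfolding log_plus_def by linarith
qed

lemma log_plus_measurable [measurable]: "log_plus \<in> borel_measurable borel"
  unfolding log_plus_def by measurable

lemma Psi_eq1:
  assumes \<tau>: "\<tau> > 0" and b: "b > 0"
  shows "Psi 1 x \<tau> b \<le> ennreal (\<bar>x\<bar> * (1 + log_plus (b * \<bar>x\<bar> / \<tau>)))"
proof (cases "x = 0")
  case x: False
  define c where "c = \<tau> / \<bar>x\<bar>"
  have c: "c > 0" using \<tau> x by (simp add: c_def)
  have int: "(\<integral>\<^sup>+v\<in>{c..b}. ennreal (v powr (- 1)) \<partial>lborel) \<le> ennreal (log_plus (b * \<bar>x\<bar> / \<tau>))"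
  proof (cases "c \<le> b")
    case True
    have "(\<integral>\<^sup>+v\<in>{c..b}. ennreal (v powr (- 1)) \<partial>lborel) = ennreal (ln b - ln c)"
    proof (rule nn_integral_FTC_Icc[where F=ln])
      fix v assume "v \<in> {c..b}"
      then have v: "c \<le> v" "v \<le> b" by auto
      then have "v > 0" using c by simp
      then show "(ln has_real_derivative v powr (- 1)) (at v)"
        by (auto intro!: derivative_eq_intros simp: powr_minus inverse_eq_divide)
    qed (use True in auto)
    also have "ln b - ln c = ln (b * \<bar>x\<bar> / \<tau>)" using b x \<tau> by (simp add: c_def ln_div ln_mult)
    also have "ennreal \<dots> \<le> ennreal (log_plus (b * \<bar>x\<bar> / \<tau>))"
      by (intro ennreal_leI) (simp add: log_plus_def)
    finally show ?thesis .
  qed auto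
  have "Psi 1 x \<tau> b \<le> ennreal \<bar>x\<bar> + ennreal \<bar>x\<bar> * ennreal (log_plus (b * \<bar>x\<bar> / \<tau>))"
    using Psi_le_split[of 1 \<tau> x b] \<tau> x mult_left_mono[OF int, of "ennreal \<bar>x\<bar>"]
    by (auto simp: c_def intro: order_trans add_left_mono)
  also have "\<dots> = ennreal (\<bar>x\<bar> * (1 + log_plus (b * \<bar>x\<bar> / \<tau>)))"
    using log_plus_nonneg by (simp add: distrib_left ennreal_mult)
  finally show ?thesis .
qed simp

lemma Psi_lt1:
  assumes a: "0 < a" "a < 1" and \<tau>: "\<tau> > 0" and b: "b \<ge> 0"
  shows "Psi a x \<tau> b \<le> ennreal (\<bar>x\<bar> * (b powr (1 - a) / (1 - a)))"
proof -
  have "Psi a x \<tau> b \<le> (\<integral>\<^sup>+v. ennreal \<bar>x\<bar> * (ennreal (v powr (- a)) * indicator {0..b} v) \<partial>lborel)"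
    unfolding Psi_def
  proof (intro nn_integral_mono)
    fix v :: real
    have "min (x\<^sup>2 * v / \<tau>) \<bar>x\<bar> * v powr (- a) \<le> \<bar>x\<bar> * v powr (- a)"
      by (intro mult_right_mono) auto
    then show "ennreal (min (x\<^sup>2 * v / \<tau>) \<bar>x\<bar> * v powr (- a)) * indicator {0..b} v \<le>
      ennreal \<bar>x\<bar> * (ennreal (v powr (- a)) * indicator {0..b} v)"
      by (auto simp: indicator_def ennreal_mult[symmetric] intro!: ennreal_leI)
  qed
  also have "\<dots> = ennreal \<bar>x\<bar> * ennreal (b powr (1 - a) / (1 - a))"
    using nn_integral_powr_from_0[of "- a" b] a b by (subst nn_integral_cmult) auto
  also have "\<dots> = ennreal (\<bar>x\<bar> * (b powr (1 - a) / (1 - a)))"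
    using a by (intro ennreal_mult[symmetric]) auto
  finally show ?thesis .
qed

locale mild_setting = stable_noise M \<alpha> S W
  for M :: "'w measure" and \<alpha> :: real and S :: "(real ^ 'n::finite) set"
    and W :: "(real ^ 'n) set \<Rightarrow> 'w \<Rightarrow> real" +
  fixes \<rho> :: "real ^ 'n \<Rightarrow> real" and u :: "real ^ 'n \<Rightarrow> 'w \<Rightarrow> real"
  assumes rho_measurable [measurable]: "\<rho> \<in> borel_measurable borel"
    and rho_loc: "locally_integrable \<rho>"
    and rho_L: "\<And>t. (\<lambda>s. \<rho> (t - s)) \<in> L_space \<alpha> S"
    and mild: "\<And>t. has_noise_integral M \<alpha> S W (\<lambda>s. \<rho> (t - s)) (u t)"
    and joint: "(\<lambda>(t, \<omega>). u t \<omega>) \<in> borel_measurable (borel \<Otimes>\<^sub>M M)"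
begin

lemma rho_phi_integrable:
  assumes \<phi>: "\<phi> \<in> test_funs"
  shows "integrable lborel (\<lambda>t. \<rho> (t - s) * \<phi> t)"
proof -
  obtain K B where K: "compact K" and B: "\<And>x. \<bar>\<phi> x\<bar> \<le> B * indicator K x"
    by (rule test_fun_bound[OF \<phi>]) blast
  have [measurable]: "\<phi> \<in> borel_measurable borel" "K \<in> sets borel"
    using test_fun_measurable[OF \<phi>] K by (auto simp: borel_compact)
  let ?K = "(\<lambda>x. - s + x) ` K"
  have K': "compact ?K" by (rule compact_translation[OF K])
  then have [measurable]: "?K \<in> sets borel" by (rule borel_compact)
  have "integrable lborel (\<lambda>x. indicator ?K x * \<rho> x)"
    using K' rho_loc by (simp add: locally_integrable_def set_integrable_def)
  then have "integrable (distr lborel borel ((+) (- s))) (\<lambda>x. indicator ?K x * \<rho> x)"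
    by (simp add: lborel_distr_plus)
  then have "integrable lborel (\<lambda>t. indicator ?K (- s + t) * \<rho> (- s + t))"
    by (subst (asm) integrable_distr_eq) measurable
  moreover have "indicator ?K (- s + t) = (indicator K t :: real)" for t
    by (auto simp: indicator_def)
  ultimately have i: "integrable lborel (\<lambda>t. B * (indicator K t * \<rho> (t - s)))"
    by (intro integrable_mult_right) simp
  show ?thesis
  proof (rule Bochner_Integration.integrable_bound[OF i])
    show "AE t in lborel. norm (\<rho> (t - s) * \<phi> t) \<le> norm (B * (indicator K t * \<rho> (t - s)))"
    proof (intro AE_I2)
      fix t
      have "\<bar>\<phi> t\<bar> * \<bar>\<rho> (t - s)\<bar> \<le> (B * indicator K t) * \<bar>\<rho> (t - s)\<bar>"
        by (intro mult_right_mono B) auto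
      also have "\<dots> \<le> \<bar>B * indicator K t\<bar> * \<bar>\<rho> (t - s)\<bar>" by (intro mult_right_mono) auto
      finally show "norm (\<rho> (t - s) * \<phi> t) \<le> norm (B * (indicator K t * \<rho> (t - s)))"
        by (simp add: abs_mult mult_ac)
    qed
  qed measurable
qed

lemma fubini_case:
  assumes \<phi>: "\<phi> \<in> test_funs"
    and \<tau>: "\<And>t. \<tau> t > 0" and [measurable]: "\<tau> \<in> borel_measurable borel"
    and \<tau>i: "(\<integral>\<^sup>+t. ennreal (\<tau> t * \<bar>\<phi> t\<bar>) \<partial>lborel) < \<infinity>"
    and b: "\<And>s. b s > 0" and [measurable]: "b \<in> borel_measurable borel"
    and bi: "(\<integral>\<^sup>+s\<in>S. ennreal (b s powr (- \<alpha>)) \<partial>lborel) < \<infinity>"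
    and Psi: "\<And>c. c > 0 \<Longrightarrow> (\<integral>\<^sup>+t. ennreal \<bar>\<phi> t\<bar> *
      (\<integral>\<^sup>+s\<in>S. Psi \<alpha> (\<rho> (t - s)) (\<tau> t) (c * b s) \<partial>lborel) \<partial>lborel) < \<infinity>"
  shows "(AE \<omega> in M. integrable lborel (\<lambda>t. u t \<omega> * \<phi> t)) \<and>
    has_noise_integral M \<alpha> S W (\<lambda>s. LINT t|lborel. \<rho> (t - s) * \<phi> t) (pairing u \<phi>)"
proof -
  define \<beta> where "\<beta> s = \<lfloor>log 2 (b s)\<rfloor>" for s
  have le: "2 powr real_of_int (\<beta> s) \<le> b s" for s
  proof -
    have "2 powr real_of_int (\<beta> s) \<le> 2 powr log 2 (b s)"
      by (intro powr_mono) (auto simp: \<beta>_def)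
    then show ?thesis using b[of s] by simp
  qed
  have ge: "b s / 2 \<le> 2 powr real_of_int (\<beta> s)" for s
  proof -
    have "log 2 (b s) - 1 \<le> real_of_int (\<beta> s)" unfolding \<beta>_def by linarith
    then have "2 powr (log 2 (b s) - 1) \<le> 2 powr real_of_int (\<beta> s)" by (intro powr_mono) auto
    then show ?thesis using b[of s] by (simp add: powr_diff)
  qed
  have pair: "(\<lambda>z. \<rho> (fst z - snd z)) \<in> borel_measurable (borel :: ((real ^ 'n) \<times> (real ^ 'n)) measure)"
  proof -
    have "(\<lambda>z. \<rho> (fst z - snd z)) \<in> borel_measurable ((borel :: (real ^ 'n) measure) \<Otimes>\<^sub>M borel)" by measurable
    then show ?thesis by (simp only: borel_prod)
  qed
  interpret stochastic_fubini M \<alpha> S W "\<lambda>z. \<rho> (fst z - snd z)" \<phi> u \<tau> \<beta>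
  proof unfold_locales
    show "\<beta> \<in> measurable borel (count_space UNIV)" unfolding \<beta>_def by measurable
    have "(\<integral>\<^sup>+s\<in>S. ennreal ((2 powr real_of_int (\<beta> s)) powr (- \<alpha>)) \<partial>lborel) \<le>
        (\<integral>\<^sup>+s. 4 * (ennreal (b s powr (- \<alpha>)) * indicator S s) \<partial>lborel)"
    proof (intro nn_integral_mono)
      fix s
      have "(2 powr real_of_int (\<beta> s)) powr (- \<alpha>) \<le> (b s / 2) powr (- \<alpha>)"
        using alpha b[of s] ge[of s] by (intro powr_mono2') auto
      also have "\<dots> = 2 powr \<alpha> * b s powr (- \<alpha>)"
        using b[of s] by (simp add: powr_divide powr_minus field_simps)
      also have "\<dots> \<le> 4 * b s powr (- \<alpha>)"
        using powr_mono[of \<alpha> 2 "2::real"] alpha by (intro mult_right_mono) auto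
      finally have "ennreal ((2 powr real_of_int (\<beta> s)) powr (- \<alpha>)) \<le> ennreal (4 * b s powr (- \<alpha>))" by (rule ennreal_leI)
      then show "ennreal ((2 powr real_of_int (\<beta> s)) powr (- \<alpha>)) * indicator S s \<le> 4 * (ennreal (b s powr (- \<alpha>)) * indicator S s)"
        by (auto simp: indicator_def ennreal_mult)
    qed
    also have "\<dots> = 4 * (\<integral>\<^sup>+s\<in>S. ennreal (b s powr (- \<alpha>)) \<partial>lborel)"
      by (rule nn_integral_cmult) measurable
    also have "\<dots> < \<infinity>" using bi by (simp add: ennreal_mult_less_top)
    finally show "(\<integral>\<^sup>+s\<in>S. ennreal ((2 powr real_of_int (\<beta> s)) powr (- \<alpha>)) \<partial>lborel) < \<infinity>" .
    fix c :: real assume c: "c > 0"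
    have "(\<integral>\<^sup>+t. ennreal \<bar>\<phi> t\<bar> * (\<integral>\<^sup>+s\<in>S. Psi \<alpha> (\<rho> (fst (t, s) - snd (t, s))) (\<tau> t) (c * 2 powr real_of_int (\<beta> s)) \<partial>lborel) \<partial>lborel) \<le>
        (\<integral>\<^sup>+t. ennreal \<bar>\<phi> t\<bar> * (\<integral>\<^sup>+s\<in>S. Psi \<alpha> (\<rho> (t - s)) (\<tau> t) (c * b s) \<partial>lborel) \<partial>lborel)"
      using c le \<tau> by (intro nn_integral_mono mult_left_mono mult_right_mono Psi_mono) auto
    also have "\<dots> < \<infinity>" by (rule Psi[OF c])
    finally show "(\<integral>\<^sup>+t. ennreal \<bar>\<phi> t\<bar> * (\<integral>\<^sup>+s\<in>S. Psi \<alpha> (\<rho> (fst (t, s) - snd (t, s))) (\<tau> t) (c * 2 powr real_of_int (\<beta> s)) \<partial>lborel) \<partial>lborel) < \<infinity>" .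
  qed (use pair rho_L rho_phi_integrable[OF \<phi>] test_fun_integrable[OF \<phi>] test_fun_measurable[OF \<phi>] mild joint \<tau> \<tau>i in auto)
  show ?thesis
    using AE_integrable noise_integral_pairing by (simp add: pairing_def[abs_def])
qed

definition mass :: "real ^ 'n \<Rightarrow> real" where
  "mass t = enn2real (La (\<lambda>s. \<rho> (t - s)))"

lemma mass: "La (\<lambda>s. \<rho> (t - s)) = ennreal (mass t)" "mass t \<ge> 0"
  using rho_L[of t] by (auto simp: mass_def L_space_def)

lemma mass_measurable [measurable]: "mass \<in> borel_measurable borel"
  unfolding mass_def by measurable

lemma mass_eq: "(LINT s:S|lborel. \<bar>\<rho> (t - s)\<bar> powr \<alpha>) = mass t"
  unfolding mass_def set_lebesgue_integral_def
  by (subst integral_eq_nn_integral)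
    (auto intro!: arg_cong[where f=enn2real] nn_integral_cong simp: indicator_def)

lemma nn_integral_mu:
  assumes "\<phi> \<in> test_funs" and "g \<in> borel_measurable borel"
  shows "(\<integral>\<^sup>+t. g t \<partial>\<mu> \<phi>) = (\<integral>\<^sup>+t. ennreal \<bar>\<phi> t\<bar> * g t \<partial>lborel)"
proof -
  note [measurable] = assms(2) test_fun_measurable[OF assms(1)]
  show ?thesis unfolding \<mu>_def by (rule nn_integral_density) measurable
qed

definition pot :: "(real ^ 'n \<Rightarrow> real) \<Rightarrow> real ^ 'n \<Rightarrow> real" where
  "pot \<phi> s = (LINT r|\<mu> \<phi>. \<bar>\<rho> (r - s)\<bar>)"

lemma pot:
  assumes \<phi>: "\<phi> \<in> test_funs"
  shows "pot \<phi> s \<ge> 0" "(\<integral>\<^sup>+t. ennreal \<bar>\<phi> t\<bar> * ennreal \<bar>\<rho> (t - s)\<bar> \<partial>lborel) = ennreal (pot \<phi> s)"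
    "pot \<phi> \<in> borel_measurable borel"
proof -
  have [measurable]: "\<phi> \<in> borel_measurable borel" by (rule test_fun_measurable[OF \<phi>])
  show "pot \<phi> s \<ge> 0" by (simp add: pot_def)
  have eq: "pot \<phi> s = (LINT t|lborel. \<bar>\<phi> t\<bar> * \<bar>\<rho> (t - s)\<bar>)" for s
    unfolding pot_def \<mu>_def by (subst integral_density) auto
  then show "pot \<phi> \<in> borel_measurable borel" by (subst measurable_cong[OF eq]) measurable
  have "integrable lborel (\<lambda>t. \<bar>\<phi> t\<bar> * \<bar>\<rho> (t - s)\<bar>)"
    using integrable_abs[OF rho_phi_integrable[OF \<phi>, of s]] by (simp add: abs_mult mult.commute)
  then show "(\<integral>\<^sup>+t. ennreal \<bar>\<phi> t\<bar> * ennreal \<bar>\<rho> (t - s)\<bar> \<partial>lborel) = ennreal (pot \<phi> s)"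
    unfolding eq by (subst nn_integral_eq_integral[symmetric]) (auto simp: ennreal_mult)
qed

lemma swap_integrals:
  assumes \<phi>: "\<phi> \<in> test_funs" and [measurable]: "g \<in> borel_measurable borel" and g: "\<And>s. g s \<ge> 0"
  shows "(\<integral>\<^sup>+t. ennreal \<bar>\<phi> t\<bar> * (\<integral>\<^sup>+s\<in>S. ennreal (\<bar>\<rho> (t - s)\<bar> * g s) \<partial>lborel) \<partial>lborel) =
    (\<integral>\<^sup>+s\<in>S. ennreal (pot \<phi> s * g s) \<partial>lborel)"
proof -
  have [measurable]: "\<phi> \<in> borel_measurable borel" by (rule test_fun_measurable[OF \<phi>])
  have "(\<integral>\<^sup>+t. ennreal \<bar>\<phi> t\<bar> * (\<integral>\<^sup>+s\<in>S. ennreal (\<bar>\<rho> (t - s)\<bar> * g s) \<partial>lborel) \<partial>lborel) =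
      (\<integral>\<^sup>+t. (\<integral>\<^sup>+s. ennreal \<bar>\<phi> t\<bar> * (ennreal (\<bar>\<rho> (t - s)\<bar> * g s) * indicator S s) \<partial>lborel) \<partial>lborel)"
    by (intro nn_integral_cong nn_integral_cmult[symmetric]) measurable
  also have "\<dots> = (\<integral>\<^sup>+s. (\<integral>\<^sup>+t. ennreal \<bar>\<phi> t\<bar> * (ennreal (\<bar>\<rho> (t - s)\<bar> * g s) * indicator S s) \<partial>lborel) \<partial>lborel)"
    by (rule lborel_pair.Fubini') measurable
  also have "\<dots> = (\<integral>\<^sup>+s\<in>S. ennreal (pot \<phi> s * g s) \<partial>lborel)"
  proof (intro nn_integral_cong)
    fix s
    have "(\<integral>\<^sup>+t. ennreal \<bar>\<phi> t\<bar> * (ennreal (\<bar>\<rho> (t - s)\<bar> * g s) * indicator S s) \<partial>lborel) =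
        (\<integral>\<^sup>+t. (ennreal (g s) * indicator S s) * (ennreal \<bar>\<phi> t\<bar> * ennreal \<bar>\<rho> (t - s)\<bar>) \<partial>lborel)"
      using g[of s] by (intro nn_integral_cong) (auto simp: ennreal_mult mult_ac)
    also have "\<dots> = (ennreal (g s) * indicator S s) * ennreal (pot \<phi> s)"
      by (subst nn_integral_cmult) (auto simp: pot(2)[OF \<phi>])
    finally show "(\<integral>\<^sup>+t. ennreal \<bar>\<phi> t\<bar> * (ennreal (\<bar>\<rho> (t - s)\<bar> * g s) * indicator S s) \<partial>lborel) =
        ennreal (pot \<phi> s * g s) * indicator S s"
      using g[of s] pot(1)[OF \<phi>, of s] by (simp add: ennreal_mult mult_ac)
  qed
  finally show ?thesis .
qed

lemma fubini_gt1:
  assumes \<phi>: "\<phi> \<in> test_funs" and a: "\<alpha> > 1"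
    and fin: "(\<integral>\<^sup>+t. ennreal ((LINT s:S|lborel. \<bar>\<rho> (t - s)\<bar> powr \<alpha>) powr (1 / \<alpha>)) \<partial>\<mu> \<phi>) < \<infinity>"
  shows "(AE \<omega> in M. integrable lborel (\<lambda>t. u t \<omega> * \<phi> t)) \<and>
    has_noise_integral M \<alpha> S W (\<lambda>s. LINT t|lborel. \<rho> (t - s) * \<phi> t) (pairing u \<phi>)"
proof (rule fubini_case[OF \<phi>, where \<tau>="\<lambda>t. mass t powr (1 / \<alpha>) + 1" and b="\<lambda>s. enn2real (pos_weight s) powr (- 1 / \<alpha>)"])
  have [measurable]: "\<phi> \<in> borel_measurable borel" "(pos_weight :: real ^ 'n \<Rightarrow> ennreal) \<in> borel_measurable borel"
    using test_fun_measurable[OF \<phi>] pos_weight by auto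
  have w: "enn2real (pos_weight s) > 0" for s :: "real ^ 'n" using pos_weight(3,4)[of s] by (simp add: enn2real_positive_iff)
  have fin': "(\<integral>\<^sup>+t. ennreal \<bar>\<phi> t\<bar> * ennreal (mass t powr (1 / \<alpha>)) \<partial>lborel) < \<infinity>"
    using fin unfolding mass_eq by (subst (asm) nn_integral_mu[OF \<phi>]) auto
  show "mass t powr (1 / \<alpha>) + 1 > 0" for t by (simp add: add_nonneg_pos)
  show "enn2real (pos_weight s) powr (- 1 / \<alpha>) > 0" for s :: "real ^ 'n" using w[of s] by simp
  show "(\<lambda>t. mass t powr (1 / \<alpha>) + 1) \<in> borel_measurable borel"
    "(\<lambda>s::real ^ 'n. enn2real (pos_weight s) powr (- 1 / \<alpha>)) \<in> borel_measurable borel" by measurable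
  have "(\<integral>\<^sup>+t. ennreal ((mass t powr (1 / \<alpha>) + 1) * \<bar>\<phi> t\<bar>) \<partial>lborel) =
      (\<integral>\<^sup>+t. ennreal \<bar>\<phi> t\<bar> * ennreal (mass t powr (1 / \<alpha>)) + ennreal \<bar>\<phi> t\<bar> \<partial>lborel)"
    by (intro nn_integral_cong) (simp add: distrib_left distrib_right ennreal_mult mult.commute)
  also have "\<dots> = (\<integral>\<^sup>+t. ennreal \<bar>\<phi> t\<bar> * ennreal (mass t powr (1 / \<alpha>)) \<partial>lborel) + (\<integral>\<^sup>+t. ennreal \<bar>\<phi> t\<bar> \<partial>lborel)"
    by (rule nn_integral_add) measurable
  also have "\<dots> < \<infinity>"
    using fin' test_fun_integrable[OF \<phi>] by (simp add: integrable_iff_bounded)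
  finally show "(\<integral>\<^sup>+t. ennreal ((mass t powr (1 / \<alpha>) + 1) * \<bar>\<phi> t\<bar>) \<partial>lborel) < \<infinity>" .
  have "(\<integral>\<^sup>+s\<in>S. ennreal ((enn2real (pos_weight s) powr (- 1 / \<alpha>)) powr (- \<alpha>)) \<partial>lborel) \<le> integral\<^sup>N lborel (pos_weight :: real ^ 'n \<Rightarrow> ennreal)"
  proof (intro nn_integral_mono)
    fix s :: "real ^ 'n"
    have "(enn2real (pos_weight s) powr (- 1 / \<alpha>)) powr (- \<alpha>) = enn2real (pos_weight s)"
      using w[of s] alpha by (simp add: powr_powr)
    then show "ennreal ((enn2real (pos_weight s) powr (- 1 / \<alpha>)) powr (- \<alpha>)) * indicator S s \<le> pos_weight s"
      using pos_weight(4)[of s] by (auto simp: indicator_def)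
  qed
  also have "\<dots> < \<infinity>" by (rule pos_weight)
  finally show "(\<integral>\<^sup>+s\<in>S. ennreal ((enn2real (pos_weight s) powr (- 1 / \<alpha>)) powr (- \<alpha>)) \<partial>lborel) < \<infinity>" .
  fix c :: real assume "c > 0"
  let ?C = "1 / (2 - \<alpha>) + 1 / (\<alpha> - 1)"
  have C: "?C \<ge> 0" using alpha a by simp
  have "(\<integral>\<^sup>+t. ennreal \<bar>\<phi> t\<bar> * (\<integral>\<^sup>+s\<in>S. Psi \<alpha> (\<rho> (t - s)) (mass t powr (1 / \<alpha>) + 1) (c * enn2real (pos_weight s) powr (- 1 / \<alpha>)) \<partial>lborel) \<partial>lborel) \<le>
      (\<integral>\<^sup>+t. ennreal ?C * (ennreal \<bar>\<phi> t\<bar> * ennreal (mass t powr (1 / \<alpha>))) \<partial>lborel)"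
  proof (intro nn_integral_mono)
    fix t
    let ?\<tau> = "mass t powr (1 / \<alpha>) + 1"
    have \<tau>: "?\<tau> > 0" by (simp add: add_nonneg_pos)
    have "(\<integral>\<^sup>+s\<in>S. Psi \<alpha> (\<rho> (t - s)) ?\<tau> (c * enn2real (pos_weight s) powr (- 1 / \<alpha>)) \<partial>lborel) \<le>
        (\<integral>\<^sup>+s. ennreal (?C * ?\<tau> powr (1 - \<alpha>)) * (ennreal (\<bar>\<rho> (t - s)\<bar> powr \<alpha>) * indicator S s) \<partial>lborel)"
    proof (intro nn_integral_mono)
      fix s
      have "Psi \<alpha> (\<rho> (t - s)) ?\<tau> (c * enn2real (pos_weight s) powr (- 1 / \<alpha>)) \<le> ennreal (?C * (\<bar>\<rho> (t - s)\<bar> powr \<alpha> * ?\<tau> powr (1 - \<alpha>)))"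
        by (rule Psi_gt1[OF a alpha(2) \<tau>])
      also have "\<dots> = ennreal (?C * ?\<tau> powr (1 - \<alpha>)) * ennreal (\<bar>\<rho> (t - s)\<bar> powr \<alpha>)"
        using C by (subst ennreal_mult[symmetric]) (auto simp: mult_ac)
      finally show "Psi \<alpha> (\<rho> (t - s)) ?\<tau> (c * enn2real (pos_weight s) powr (- 1 / \<alpha>)) * indicator S s \<le>
          ennreal (?C * ?\<tau> powr (1 - \<alpha>)) * (ennreal (\<bar>\<rho> (t - s)\<bar> powr \<alpha>) * indicator S s)"
        by (auto simp: indicator_def)
    qed
    also have "\<dots> = ennreal (?C * ?\<tau> powr (1 - \<alpha>)) * ennreal (mass t)"
      by (subst nn_integral_cmult) (auto simp: mass)
    also have "\<dots> = ennreal (?C * (?\<tau> powr (1 - \<alpha>) * mass t))"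
      using C mass(2) by (subst ennreal_mult[symmetric]) (auto simp: mult_ac)
    also have "\<dots> \<le> ennreal (?C * mass t powr (1 / \<alpha>))"
    proof (intro ennreal_leI mult_left_mono C)
      show "?\<tau> powr (1 - \<alpha>) * mass t \<le> mass t powr (1 / \<alpha>)"
      proof (cases "mass t = 0")
        case False
        then have m: "mass t > 0" using mass(2)[of t] by simp
        have "?\<tau> powr (1 - \<alpha>) \<le> (mass t powr (1 / \<alpha>)) powr (1 - \<alpha>)"
          using a m by (intro powr_mono2') auto
        then have "?\<tau> powr (1 - \<alpha>) * mass t \<le> (mass t powr (1 / \<alpha>)) powr (1 - \<alpha>) * mass t powr 1"
          using m by (intro mult_mono) auto
        also have "\<dots> = mass t powr (1 / \<alpha>)"
          using alpha by (simp only: powr_powr powr_add[symmetric]) (simp add: field_simps)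
        finally show ?thesis .
      qed simp
    qed
    also have "\<dots> = ennreal ?C * ennreal (mass t powr (1 / \<alpha>))" using C by (intro ennreal_mult) auto
    finally show "ennreal \<bar>\<phi> t\<bar> * (\<integral>\<^sup>+s\<in>S. Psi \<alpha> (\<rho> (t - s)) ?\<tau> (c * enn2real (pos_weight s) powr (- 1 / \<alpha>)) \<partial>lborel) \<le>
        ennreal ?C * (ennreal \<bar>\<phi> t\<bar> * ennreal (mass t powr (1 / \<alpha>)))"
      by (subst mult.left_commute) (rule mult_left_mono, auto)
  qed
  also have "\<dots> = ennreal ?C * (\<integral>\<^sup>+t. ennreal \<bar>\<phi> t\<bar> * ennreal (mass t powr (1 / \<alpha>)) \<partial>lborel)"
    by (rule nn_integral_cmult) measurable
  also have "\<dots> < \<infinity>" using fin' by (simp add: ennreal_mult_less_top)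
  finally show "(\<integral>\<^sup>+t. ennreal \<bar>\<phi> t\<bar> * (\<integral>\<^sup>+s\<in>S. Psi \<alpha> (\<rho> (t - s)) (mass t powr (1 / \<alpha>) + 1) (c * enn2real (pos_weight s) powr (- 1 / \<alpha>)) \<partial>lborel) \<partial>lborel) < \<infinity>" .
qed

lemma fubini_lt1:
  assumes \<phi>: "\<phi> \<in> test_funs" and a: "\<alpha> < 1"
    and fin: "(\<integral>\<^sup>+s\<in>S. ennreal ((LINT t|\<mu> \<phi>. \<bar>\<rho> (t - s)\<bar>) powr \<alpha>) \<partial>lborel) < \<infinity>"
  shows "(AE \<omega> in M. integrable lborel (\<lambda>t. u t \<omega> * \<phi> t)) \<and>
    has_noise_integral M \<alpha> S W (\<lambda>s. LINT t|lborel. \<rho> (t - s) * \<phi> t) (pairing u \<phi>)"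
proof -
  have [measurable]: "\<phi> \<in> borel_measurable borel" "(pos_weight :: real ^ 'n \<Rightarrow> ennreal) \<in> borel_measurable borel"
    "pot \<phi> \<in> borel_measurable borel"
    using test_fun_measurable[OF \<phi>] pos_weight pot[OF \<phi>] by auto
  have w: "enn2real (pos_weight s) > 0" for s :: "real ^ 'n" using pos_weight(3,4)[of s] by (simp add: enn2real_positive_iff)
  define d where "d s = pot \<phi> s + enn2real (pos_weight s) powr (1 / \<alpha>)" for s
  have d: "d s > 0" "pot \<phi> s \<le> d s" for s
    using w[of s] pot(1)[OF \<phi>, of s] by (auto simp: d_def add_nonneg_pos)
  have [measurable]: "d \<in> borel_measurable borel" unfolding d_def by measurable
  show ?thesis
  proof (rule fubini_case[OF \<phi>, where \<tau>="\<lambda>t. 1" and b="\<lambda>s. 1 / d s"])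
    show "(\<integral>\<^sup>+t. ennreal (1 * \<bar>\<phi> t\<bar>) \<partial>lborel) < \<infinity>"
      using test_fun_integrable[OF \<phi>] by (simp add: integrable_iff_bounded)
    show "1 / d s > 0" for s using d by simp
    have "(\<integral>\<^sup>+s\<in>S. ennreal ((1 / d s) powr (- \<alpha>)) \<partial>lborel) \<le>
        (\<integral>\<^sup>+s. 4 * (ennreal (pot \<phi> s powr \<alpha>) * indicator S s + pos_weight s) \<partial>lborel)"
    proof (intro nn_integral_mono)
      fix s
      have "(1 / d s) powr (- \<alpha>) = \<bar>d s\<bar> powr \<alpha>"
        using d(1)[of s] by (simp add: powr_divide powr_minus)
      also have "\<dots> \<le> 4 * (\<bar>pot \<phi> s\<bar> powr \<alpha> + \<bar>enn2real (pos_weight s) powr (1 / \<alpha>)\<bar> powr \<alpha>)"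
        unfolding d_def using alpha by (intro abs_powr_add_le) auto
      also have "\<dots> = 4 * (pot \<phi> s powr \<alpha> + enn2real (pos_weight s))"
        using pot(1)[OF \<phi>, of s] alpha w[of s] by (simp add: powr_powr)
      finally have "ennreal ((1 / d s) powr (- \<alpha>)) \<le> 4 * (ennreal (pot \<phi> s powr \<alpha>) + ennreal (enn2real (pos_weight s)))"
        by (simp add: ennreal_mult[symmetric] ennreal_plus[symmetric] ennreal_leI del: ennreal_plus flip: ennreal_numeral)
      also have "ennreal (enn2real (pos_weight s)) = pos_weight s" using pos_weight(4)[of s] by simp
      finally show "ennreal ((1 / d s) powr (- \<alpha>)) * indicator S s \<le> 4 * (ennreal (pot \<phi> s powr \<alpha>) * indicator S s + pos_weight s)"
        by (auto simp: indicator_def)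
    qed
    also have "\<dots> = 4 * ((\<integral>\<^sup>+s\<in>S. ennreal (pot \<phi> s powr \<alpha>) \<partial>lborel) + integral\<^sup>N lborel (pos_weight :: real ^ 'n \<Rightarrow> ennreal))"
      by (subst nn_integral_cmult, measurable, subst nn_integral_add, measurable)
    also have "\<dots> < \<infinity>"
      using fin pos_weight(2) by (auto simp: pot_def ennreal_mult_less_top)
    finally show "(\<integral>\<^sup>+s\<in>S. ennreal ((1 / d s) powr (- \<alpha>)) \<partial>lborel) < \<infinity>" .
    fix c :: real assume c: "c > 0"
    let ?K = "c powr (1 - \<alpha>) / (1 - \<alpha>)"
    have K: "?K \<ge> 0" using a by simp
    have "(\<integral>\<^sup>+t. ennreal \<bar>\<phi> t\<bar> * (\<integral>\<^sup>+s\<in>S. Psi \<alpha> (\<rho> (t - s)) 1 (c * (1 / d s)) \<partial>lborel) \<partial>lborel) \<le>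
      (\<integral>\<^sup>+t. ennreal \<bar>\<phi> t\<bar> * (\<integral>\<^sup>+s\<in>S. ennreal (\<bar>\<rho> (t - s)\<bar> * ((c * (1 / d s)) powr (1 - \<alpha>) / (1 - \<alpha>))) \<partial>lborel) \<partial>lborel)"
      using alpha a c d(1) by (intro nn_integral_mono mult_left_mono mult_right_mono Psi_lt1) (auto simp: less_imp_le)
    also have "\<dots> = (\<integral>\<^sup>+s\<in>S. ennreal (pot \<phi> s * ((c * (1 / d s)) powr (1 - \<alpha>) / (1 - \<alpha>))) \<partial>lborel)"
    proof (rule swap_integrals[OF \<phi>])
      show "(\<lambda>s. (c * (1 / d s)) powr (1 - \<alpha>) / (1 - \<alpha>)) \<in> borel_measurable borel" by measurable
    qed (use a in auto)
    also have "\<dots> \<le> (\<integral>\<^sup>+s. ennreal ?K * (ennreal (pot \<phi> s powr \<alpha>) * indicator S s) \<partial>lborel)"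
    proof (intro nn_integral_mono)
      fix s
      have "pot \<phi> s * ((c * (1 / d s)) powr (1 - \<alpha>) / (1 - \<alpha>)) = ?K * (pot \<phi> s * d s powr (\<alpha> - 1))"
      proof -
        have "(c * (1 / d s)) powr (1 - \<alpha>) = c powr (1 - \<alpha>) * d s powr (\<alpha> - 1)"
          using c d(1)[of s] powr_minus[of "d s" "1 - \<alpha>"] by (simp add: powr_mult powr_divide inverse_eq_divide)
        then show ?thesis by simp
      qed
      also have "\<dots> \<le> ?K * pot \<phi> s powr \<alpha>"
      proof (intro mult_left_mono K)
        show "pot \<phi> s * d s powr (\<alpha> - 1) \<le> pot \<phi> s powr \<alpha>"
        proof (cases "pot \<phi> s = 0")
          case False
          then have p: "pot \<phi> s > 0" using pot(1)[OF \<phi>, of s] by simp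
          have "d s powr (\<alpha> - 1) \<le> pot \<phi> s powr (\<alpha> - 1)"
            using p d(2)[of s] a by (intro powr_mono2') auto
          then have "pot \<phi> s * d s powr (\<alpha> - 1) \<le> pot \<phi> s * pot \<phi> s powr (\<alpha> - 1)"
            using p by (intro mult_left_mono) auto
          also have "\<dots> = pot \<phi> s powr \<alpha>" using p by (simp add: powr_diff)
          finally show ?thesis .
        qed simp
      qed
      finally have "ennreal (pot \<phi> s * ((c * (1 / d s)) powr (1 - \<alpha>) / (1 - \<alpha>))) \<le> ennreal (?K * pot \<phi> s powr \<alpha>)" by (rule ennreal_leI)
      also have "\<dots> = ennreal ?K * ennreal (pot \<phi> s powr \<alpha>)" using K by (intro ennreal_mult) auto
      finally show "ennreal (pot \<phi> s * ((c * (1 / d s)) powr (1 - \<alpha>) / (1 - \<alpha>))) * indicator S s \<le>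
          ennreal ?K * (ennreal (pot \<phi> s powr \<alpha>) * indicator S s)"
        by (auto simp: indicator_def)
    qed
    also have "\<dots> = ennreal ?K * (\<integral>\<^sup>+s\<in>S. ennreal (pot \<phi> s powr \<alpha>) \<partial>lborel)"
      by (rule nn_integral_cmult) measurable
    also have "\<dots> < \<infinity>" using fin by (simp add: pot_def ennreal_mult_less_top)
    finally show "(\<integral>\<^sup>+t. ennreal \<bar>\<phi> t\<bar> * (\<integral>\<^sup>+s\<in>S. Psi \<alpha> (\<rho> (t - s)) 1 (c * (1 / d s)) \<partial>lborel) \<partial>lborel) < \<infinity>" .
  qed auto
qed

lemma fubini_eq1:
  assumes \<phi>: "\<phi> \<in> test_funs" and a: "\<alpha> = 1"
    and fin: "(\<integral>\<^sup>+t. (\<integral>\<^sup>+s\<in>S. ennreal (\<bar>\<rho> (t - s)\<bar> * log_bracket S \<rho> \<phi> t s) \<partial>lborel) \<partial>\<mu> \<phi>) < \<infinity>"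
  shows "(AE \<omega> in M. integrable lborel (\<lambda>t. u t \<omega> * \<phi> t)) \<and>
    has_noise_integral M \<alpha> S W (\<lambda>s. LINT t|lborel. \<rho> (t - s) * \<phi> t) (pairing u \<phi>)"
proof -
  have [measurable]: "\<phi> \<in> borel_measurable borel" "(pos_weight :: real ^ 'n \<Rightarrow> ennreal) \<in> borel_measurable borel"
    "pot \<phi> \<in> borel_measurable borel"
    using test_fun_measurable[OF \<phi>] pos_weight pot[OF \<phi>] by auto
  have w: "enn2real (pos_weight s) > 0" for s :: "real ^ 'n" using pos_weight(3,4)[of s] by (simp add: enn2real_positive_iff)
  have mass1: "mass t = (LINT v:S|lborel. \<bar>\<rho> (t - v)\<bar>)" for t
    unfolding mass_eq[symmetric] by (simp add: a)
  have mass_La: "(\<integral>\<^sup>+s\<in>S. ennreal \<bar>\<rho> (t - s)\<bar> \<partial>lborel) = ennreal (mass t)" for t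
    using mass(1)[of t] by (simp add: a)
  define T where "T = (LINT r|\<mu> \<phi>. mass r)"
  define y where "y t s = \<bar>\<rho> (t - s)\<bar> * T / (mass t * pot \<phi> s)" for t s
  have bracket: "log_bracket S \<rho> \<phi> t s = 1 + log_plus (y t s)" for t s
    by (simp add: log_bracket_def y_def T_def pot_def mass1)
  have [measurable]: "(\<lambda>(t, s). y t s) \<in> borel_measurable (borel \<Otimes>\<^sub>M borel)"
    unfolding y_def by measurable
  let ?H = "\<lambda>t. \<integral>\<^sup>+s\<in>S. ennreal (\<bar>\<rho> (t - s)\<bar> * (1 + log_plus (y t s))) \<partial>lborel"
  have H: "(\<integral>\<^sup>+t. ?H t \<partial>\<mu> \<phi>) < \<infinity>" using fin by (simp add: bracket)
  have massT: "(\<integral>\<^sup>+t. ennreal (mass t) \<partial>\<mu> \<phi>) = ennreal T" "T \<ge> 0"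
  proof -
    have "(\<integral>\<^sup>+t. ennreal (mass t) \<partial>\<mu> \<phi>) \<le> (\<integral>\<^sup>+t. ?H t \<partial>\<mu> \<phi>)"
    proof (intro nn_integral_mono)
      fix t
      have "ennreal \<bar>\<rho> (t - s)\<bar> \<le> ennreal (\<bar>\<rho> (t - s)\<bar> * (1 + log_plus (y t s)))" for s
        using log_plus_nonneg[of "y t s"] by (intro ennreal_leI) (simp add: distrib_left)
      then show "ennreal (mass t) \<le> ?H t"
        unfolding mass_La[symmetric] by (intro nn_integral_mono) (auto simp: indicator_def)
    qed
    then have "(\<integral>\<^sup>+t. ennreal (mass t) \<partial>\<mu> \<phi>) < \<infinity>" using H by (rule le_less_trans)
    then have "integrable (\<mu> \<phi>) mass"
      using mass(2) by (intro integrableI_bounded) (auto simp: \<mu>_def)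
    then show "(\<integral>\<^sup>+t. ennreal (mass t) \<partial>\<mu> \<phi>) = ennreal T"
      unfolding T_def using mass(2) by (intro nn_integral_eq_integral) auto
    show "T \<ge> 0" unfolding T_def using mass(2) by (intro integral_nonneg_AE) auto
  qed
  have massT': "(\<integral>\<^sup>+t. ennreal \<bar>\<phi> t\<bar> * ennreal (mass t) \<partial>lborel) = ennreal T"
    using massT(1) by (subst (asm) nn_integral_mu[OF \<phi>]) auto
  have potT: "(\<integral>\<^sup>+s\<in>S. ennreal (pot \<phi> s) \<partial>lborel) = ennreal T"
    using swap_integrals[OF \<phi>, of "\<lambda>_. 1"] massT' mass_La by simp
  define d where "d s = pot \<phi> s + enn2real (pos_weight s)" for s
  have d: "d s > 0" "pot \<phi> s \<le> d s" for s
    using w[of s] pot(1)[OF \<phi>, of s] by (auto simp: d_def add_nonneg_pos)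
  have [measurable]: "d \<in> borel_measurable borel" unfolding d_def by measurable
  define \<tau> where "\<tau> t = mass t / T + 1" for t
  have \<tau>: "\<tau> t > 0" "mass t / T \<le> \<tau> t" for t
    using mass(2)[of t] massT(2) by (auto simp: \<tau>_def add_nonneg_pos)
  have [measurable]: "\<tau> \<in> borel_measurable borel" unfolding \<tau>_def by measurable

  have ae: "AE t in \<mu> \<phi>. AE s in lborel. s \<in> S \<longrightarrow> \<rho> (t - s) \<noteq> 0 \<longrightarrow> pot \<phi> s > 0 \<and> mass t > 0 \<and> T > 0"
  proof -
    have 1: "AE s in lborel. s \<in> S \<longrightarrow> \<rho> (t - s) = 0" if "mass t = 0" for t
    proof -
      have "(\<integral>\<^sup>+s\<in>S. ennreal \<bar>\<rho> (t - s)\<bar> \<partial>lborel) = 0" by (simp add: mass_La that)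
      then have "AE s in lborel. ennreal \<bar>\<rho> (t - s)\<bar> * indicator S s = 0"
        by (subst (asm) nn_integral_0_iff_AE) auto
      then show ?thesis by eventually_elim (auto simp: indicator_def)
    qed
    have 2: "AE t in \<mu> \<phi>. T = 0 \<longrightarrow> mass t = 0"
    proof (cases "T = 0")
      case True
      then have "(\<integral>\<^sup>+t. ennreal (mass t) \<partial>\<mu> \<phi>) = 0" using massT(1) by simp
      then have "AE t in \<mu> \<phi>. ennreal (mass t) = 0"
        by (subst (asm) nn_integral_0_iff_AE) (simp_all add: \<mu>_def)
      then show ?thesis by eventually_elim (use mass(2) in \<open>auto simp: ennreal_eq_0_iff intro: antisym\<close>)
    qed simp
    let ?g = "\<lambda>s. indicator {s. pot \<phi> s = 0} s :: real"
    have gm [measurable]: "?g \<in> borel_measurable borel"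
      unfolding indicator_def mem_Collect_eq by measurable
    have "(\<integral>\<^sup>+t. ennreal \<bar>\<phi> t\<bar> * (\<integral>\<^sup>+s\<in>S. ennreal (\<bar>\<rho> (t - s)\<bar> * ?g s) \<partial>lborel) \<partial>lborel) =
        (\<integral>\<^sup>+s\<in>S. ennreal (pot \<phi> s * ?g s) \<partial>lborel)"
      by (rule swap_integrals[OF \<phi> gm]) auto
    also have "\<dots> = (\<integral>\<^sup>+s. 0 \<partial>(lborel :: (real ^ 'n) measure))" by (intro nn_integral_cong) (auto simp: indicator_def)
    finally have "(\<integral>\<^sup>+t. (\<integral>\<^sup>+s\<in>S. ennreal (\<bar>\<rho> (t - s)\<bar> * ?g s) \<partial>lborel) \<partial>\<mu> \<phi>) = 0"
      by (subst nn_integral_mu[OF \<phi>]) simp_all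
    then have "AE t in \<mu> \<phi>. (\<integral>\<^sup>+s\<in>S. ennreal (\<bar>\<rho> (t - s)\<bar> * ?g s) \<partial>lborel) = 0"
      by (subst (asm) nn_integral_0_iff_AE) (simp_all add: \<mu>_def)
    then have 3: "AE t in \<mu> \<phi>. AE s in lborel. s \<in> S \<longrightarrow> pot \<phi> s = 0 \<longrightarrow> \<rho> (t - s) = 0"
    proof eventually_elim
      case (elim t)
      then have "AE s in lborel. ennreal (\<bar>\<rho> (t - s)\<bar> * ?g s) * indicator S s = 0"
        by (subst (asm) nn_integral_0_iff_AE) auto
      then show ?case by eventually_elim (auto simp: indicator_def split: if_splits)
    qed
    from 2 3 show ?thesis
    proof eventually_elim
      case (elim t)
      show ?case
      proof (cases "mass t = 0")
        case True
        from 1[OF this] show ?thesis by eventually_elim auto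
      next
        case False
        then have pos: "mass t > 0" "T > 0" using elim(1) mass(2)[of t] massT(2) by (auto simp: less_le)
        from elim(2) show ?thesis
        proof (eventually_elim, intro impI)
          fix s assume "s \<in> S \<longrightarrow> pot \<phi> s = 0 \<longrightarrow> \<rho> (t - s) = 0" "s \<in> S" "\<rho> (t - s) \<noteq> 0"
          then have "pot \<phi> s \<noteq> 0" by auto
          then show "pot \<phi> s > 0 \<and> mass t > 0 \<and> T > 0"
            using pos pot(1)[OF \<phi>, of s] by (simp add: less_le)
        qed
      qed
    qed
  qed
  show ?thesis
  proof (rule fubini_case[OF \<phi>, where \<tau>=\<tau> and b="\<lambda>s. 1 / d s"])
    show "\<tau> t > 0" for t by (rule \<tau>)
    show "1 / d s > 0" for s using d by simp
    have "(\<integral>\<^sup>+t. ennreal (\<tau> t * \<bar>\<phi> t\<bar>) \<partial>lborel) =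
        (\<integral>\<^sup>+t. ennreal (1 / T) * (ennreal \<bar>\<phi> t\<bar> * ennreal (mass t)) + ennreal \<bar>\<phi> t\<bar> \<partial>lborel)"
    proof (intro nn_integral_cong)
      fix t
      have "\<tau> t * \<bar>\<phi> t\<bar> = 1 / T * (\<bar>\<phi> t\<bar> * mass t) + \<bar>\<phi> t\<bar>"
        by (simp add: \<tau>_def distrib_left mult_ac)
      then show "ennreal (\<tau> t * \<bar>\<phi> t\<bar>) = ennreal (1 / T) * (ennreal \<bar>\<phi> t\<bar> * ennreal (mass t)) + ennreal \<bar>\<phi> t\<bar>"
        using mass(2)[of t] massT(2) by (simp only: ennreal_plus ennreal_mult[symmetric] zero_le_mult_iff zero_le_divide_1_iff abs_ge_zero mult_nonneg_nonneg simp_thms)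
    qed
    also have "\<dots> = ennreal (1 / T) * ennreal T + (\<integral>\<^sup>+t. ennreal \<bar>\<phi> t\<bar> \<partial>lborel)"
      by (subst nn_integral_add, measurable, subst nn_integral_cmult, measurable, subst massT', rule refl)
    also have "\<dots> < \<infinity>"
      using test_fun_integrable[OF \<phi>] by (simp add: integrable_iff_bounded ennreal_mult_less_top)
    finally show "(\<integral>\<^sup>+t. ennreal (\<tau> t * \<bar>\<phi> t\<bar>) \<partial>lborel) < \<infinity>" .
    have "(\<integral>\<^sup>+s\<in>S. ennreal ((1 / d s) powr (- \<alpha>)) \<partial>lborel) \<le>
        (\<integral>\<^sup>+s. ennreal (pot \<phi> s) * indicator S s + pos_weight s \<partial>lborel)"
    proof (intro nn_integral_mono)
      fix s
      have "(1 / d s) powr (- \<alpha>) = d s" using d(1)[of s] by (simp add: a powr_minus)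
      then have "ennreal ((1 / d s) powr (- \<alpha>)) = ennreal (pot \<phi> s) + ennreal (enn2real (pos_weight s))"
        using pot(1)[OF \<phi>, of s] by (simp add: d_def)
      also have "ennreal (enn2real (pos_weight s)) = pos_weight s" using pos_weight(4)[of s] by simp
      finally show "ennreal ((1 / d s) powr (- \<alpha>)) * indicator S s \<le> ennreal (pot \<phi> s) * indicator S s + pos_weight s"
        by (auto simp: indicator_def)
    qed
    also have "\<dots> = ennreal T + integral\<^sup>N lborel (pos_weight :: real ^ 'n \<Rightarrow> ennreal)"
      by (subst nn_integral_add) (auto simp: potT)
    also have "\<dots> < \<infinity>" using pos_weight(2) by auto
    finally show "(\<integral>\<^sup>+s\<in>S. ennreal ((1 / d s) powr (- \<alpha>)) \<partial>lborel) < \<infinity>" .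
    fix c :: real assume c: "c > 0"
    let ?C = "1 + log_plus c"
    have C: "?C \<ge> 1" using log_plus_nonneg[of c] by simp
    have pw: "Psi 1 (\<rho> (t - s)) (\<tau> t) (c * (1 / d s)) \<le> ennreal ?C * ennreal (\<bar>\<rho> (t - s)\<bar> * (1 + log_plus (y t s)))"
      if "\<rho> (t - s) \<noteq> 0 \<longrightarrow> pot \<phi> s > 0 \<and> mass t > 0 \<and> T > 0" for t s
    proof (cases "\<rho> (t - s) = 0")
      case False
      define x where "x = \<bar>\<rho> (t - s)\<bar>"
      have x: "x > 0" and pos: "pot \<phi> s > 0" "mass t > 0" "T > 0" using False that by (auto simp: x_def)
      have ypos: "y t s > 0" using x pos by (simp add: y_def x_def)
      have "1 / d s \<le> 1 / pot \<phi> s" using pos d[of s] by (intro divide_left_mono) auto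
      moreover have "x / \<tau> t \<le> x / (mass t / T)" using pos x \<tau>[of t] by (intro divide_left_mono) auto
      ultimately have "(1 / d s) * (x / \<tau> t) \<le> (1 / pot \<phi> s) * (x / (mass t / T))"
        using pos x \<tau>(1)[of t] by (intro mult_mono) auto
      also have "\<dots> = y t s" using pos by (simp add: y_def x_def mult_ac)
      finally have "c * ((1 / d s) * (x / \<tau> t)) \<le> c * y t s" using c by (intro mult_left_mono) auto
      then have le: "c * (1 / d s) * x / \<tau> t \<le> c * y t s" by simp
      have "log_plus (c * (1 / d s) * x / \<tau> t) \<le> log_plus (c * y t s)"
        using c d(1)[of s] x \<tau>(1)[of t] by (intro log_plus_mono le) simp
      also have "\<dots> \<le> log_plus c + log_plus (y t s)" by (rule log_plus_mult[OF c ypos])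
      finally have l: "1 + log_plus (c * (1 / d s) * x / \<tau> t) \<le> ?C * (1 + log_plus (y t s))"
        using mult_nonneg_nonneg[OF log_plus_nonneg[of c] log_plus_nonneg[of "y t s"]]
        by (simp only: distrib_left distrib_right mult_1_left mult_1_right)
      have "Psi 1 (\<rho> (t - s)) (\<tau> t) (c * (1 / d s)) \<le> ennreal (x * (1 + log_plus (c * (1 / d s) * x / \<tau> t)))"
        unfolding x_def using c d(1)[of s] by (intro Psi_eq1 \<tau>) simp
      also have "\<dots> \<le> ennreal (?C * (x * (1 + log_plus (y t s))))"
        using mult_left_mono[OF l, of x] x by (intro ennreal_leI) (simp add: mult_ac)
      also have "\<dots> = ennreal ?C * ennreal (x * (1 + log_plus (y t s)))"
        using C x log_plus_nonneg[of "y t s"] by (intro ennreal_mult) auto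
      finally show ?thesis by (simp add: x_def)
    qed simp
    let ?P = "\<lambda>t. \<integral>\<^sup>+s\<in>S. Psi \<alpha> (\<rho> (t - s)) (\<tau> t) (c * (1 / d s)) \<partial>lborel"
    have "(\<integral>\<^sup>+t. ennreal \<bar>\<phi> t\<bar> * ?P t \<partial>lborel) = (\<integral>\<^sup>+t. ?P t \<partial>\<mu> \<phi>)"
      by (rule nn_integral_mu[OF \<phi>, symmetric]) measurable
    also have "\<dots> \<le> (\<integral>\<^sup>+t. ennreal ?C * ?H t \<partial>\<mu> \<phi>)"
    proof (rule nn_integral_mono_AE)
      show "AE t in \<mu> \<phi>. ?P t \<le> ennreal ?C * ?H t"
        using ae
      proof eventually_elim
        case (elim t)
        have "?P t \<le> (\<integral>\<^sup>+s. ennreal ?C * (ennreal (\<bar>\<rho> (t - s)\<bar> * (1 + log_plus (y t s))) * indicator S s) \<partial>lborel)"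
        proof (rule nn_integral_mono_AE)
          show "AE s in lborel. Psi \<alpha> (\<rho> (t - s)) (\<tau> t) (c * (1 / d s)) * indicator S s \<le>
              ennreal ?C * (ennreal (\<bar>\<rho> (t - s)\<bar> * (1 + log_plus (y t s))) * indicator S s)"
            using elim
          proof eventually_elim
            case (elim s)
            then show ?case using pw[of t s] by (cases "s \<in> S") (simp_all add: a)
          qed
        qed
        also have "\<dots> = ennreal ?C * ?H t" by (rule nn_integral_cmult) measurable
        finally show ?case .
      qed
    qed
    also have "\<dots> = ennreal ?C * (\<integral>\<^sup>+t. ?H t \<partial>\<mu> \<phi>)"
      by (rule nn_integral_cmult) (simp add: \<mu>_def)
    also have "\<dots> < \<infinity>" using H by (simp add: ennreal_mult_less_top)
    finally show "(\<integral>\<^sup>+t. ennreal \<bar>\<phi> t\<bar> * ?P t \<partial>lborel) < \<infinity>" .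
  qed measurable
qed

lemma pairing_measurable:
  assumes "\<phi> \<in> test_funs" shows "pairing u \<phi> \<in> borel_measurable M"
proof -
  have [measurable]: "\<phi> \<in> borel_measurable borel" by (rule test_fun_measurable[OF assms])
  note [measurable] = joint
  show ?thesis unfolding pairing_def by measurable
qed

lemma AE_locally_integrable:
  assumes int: "\<And>\<phi>. \<phi> \<in> test_funs \<Longrightarrow> AE \<omega> in M. integrable lborel (\<lambda>t. u t \<omega> * \<phi> t)"
  shows "AE \<omega> in M. locally_integrable (\<lambda>t. u t \<omega>)"
proof -
  have "\<exists>\<phi>\<in>test_funs. \<forall>x :: real ^ 'n. norm x \<le> real k \<longrightarrow> \<phi> x \<ge> exp (- 1)" for k :: nat
    by (rule bump_exists[of "real k"]) blast
  then obtain \<phi> where \<phi>: "\<And>k. \<phi> k \<in> test_funs" "\<And>k (x :: real ^ 'n). norm x \<le> real k \<Longrightarrow> \<phi> k x \<ge> exp (- 1)"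
    by metis
  have "AE \<omega> in M. \<forall>k. integrable lborel (\<lambda>t. u t \<omega> * \<phi> k t)"
    unfolding AE_all_countable using int \<phi>(1) by auto
  then show ?thesis using AE_space
  proof eventually_elim
    case (elim \<omega>)
    have [measurable]: "(\<lambda>t. u t \<omega>) \<in> borel_measurable borel"
      using measurable_Pair1[OF joint elim(2)] by simp
    show ?case
      unfolding locally_integrable_def set_integrable_def
    proof (intro allI impI)
      fix K :: "(real ^ 'n) set" assume K: "compact K"
      then have [measurable]: "K \<in> sets borel" by (rule borel_compact)
      obtain r where r: "\<And>x. x \<in> K \<Longrightarrow> norm x \<le> r" using compact_imp_bounded[OF K] by (auto simp: bounded_iff)
      obtain k :: nat where k: "r \<le> real k" using real_arch_simple by blast
      have "integrable lborel (\<lambda>t. exp 1 * (u t \<omega> * \<phi> k t))" using elim(1) by (intro integrable_mult_right) simp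
      then show "integrable lborel (\<lambda>t. indicator K t *\<^sub>R u t \<omega>)"
      proof (rule Bochner_Integration.integrable_bound)
        show "AE t in lborel. norm (indicator K t *\<^sub>R u t \<omega>) \<le> norm (exp 1 * (u t \<omega> * \<phi> k t))"
        proof (intro AE_I2)
          fix t
          show "norm (indicator K t *\<^sub>R u t \<omega>) \<le> norm (exp 1 * (u t \<omega> * \<phi> k t))"
          proof (cases "t \<in> K")
            case True
            then have p: "exp (- 1) \<le> \<phi> k t" using r[OF True] k by (intro \<phi>(2)) auto
            then have "exp 1 * exp (- 1) \<le> exp 1 * \<bar>\<phi> k t\<bar>" by (intro mult_left_mono) auto
            then have "1 \<le> exp 1 * \<bar>\<phi> k t\<bar>" by (simp add: exp_minus)
            then have "\<bar>u t \<omega>\<bar> * 1 \<le> \<bar>u t \<omega>\<bar> * (exp 1 * \<bar>\<phi> k t\<bar>)" by (intro mult_left_mono) auto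
            then show ?thesis using True by (simp add: abs_mult mult_ac)
          qed simp
        qed
      qed measurable
    qed
  qed
qed

lemma convolve_eq:
  assumes T: "\<And>\<phi>. \<phi> \<in> test_funs \<Longrightarrow> T \<phi> = (LINT x|lborel. \<rho> x * \<phi> x)" and \<phi>: "\<phi> \<in> test_funs"
  shows "convolve \<phi> (reflect T) = (\<lambda>s. LINT t|lborel. \<rho> (t - s) * \<phi> t)"
proof
  fix s
  have [measurable]: "\<phi> \<in> borel_measurable borel" by (rule test_fun_measurable[OF \<phi>])
  have "convolve \<phi> (reflect T) s = T (\<lambda>x. \<phi> (s + x))" by (simp add: convolve_def reflect_def)
  also have "\<dots> = (LINT x|lborel. \<rho> x * \<phi> (s + x))" by (rule T[OF test_funs_shift[OF \<phi>]])
  also have "\<dots> = (LINT x|distr lborel borel ((+) (- s)). \<rho> x * \<phi> (s + x))" by (simp add: lborel_distr_plus)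
  also have "\<dots> = (LINT t|lborel. \<rho> (t - s) * \<phi> t)" by (subst integral_distr) auto
  finally show "convolve \<phi> (reflect T) s = (LINT t|lborel. \<rho> (t - s) * \<phi> t)" .
qed

lemma mild_eq_genI:
  assumes T: "\<And>\<phi>. \<phi> \<in> test_funs \<Longrightarrow> T \<phi> = (LINT x|lborel. \<rho> x * \<phi> x)"
    and *: "\<And>\<phi>. \<phi> \<in> test_funs \<Longrightarrow> (AE \<omega> in M. integrable lborel (\<lambda>t. u t \<omega> * \<phi> t)) \<and>
      has_noise_integral M \<alpha> S W (\<lambda>s. LINT t|lborel. \<rho> (t - s) * \<phi> t) (pairing u \<phi>)"
  shows "mild_eq_gen M \<alpha> S W T u"
proof -
  let ?V = "gen_solution M \<alpha> S W T"
  have conv: "has_noise_integral M \<alpha> S W (convolve \<phi> (reflect T)) (pairing u \<phi>)" if "\<phi> \<in> test_funs" for \<phi>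
    using *[OF that] convolve_eq[OF T that] by simp
  have gen: "has_noise_integral M \<alpha> S W (convolve \<phi> (reflect T)) (?V \<phi>)" if "\<phi> \<in> test_funs" for \<phi>
    unfolding gen_solution_def noise_integral_def by (rule someI[of "has_noise_integral M \<alpha> S W (convolve \<phi> (reflect T))", OF conv[OF that]])
  have eq: "AE \<omega> in M. pairing u \<phi> \<omega> = ?V \<phi> \<omega>" if "\<phi> \<in> test_funs" for \<phi>
    using conv[OF that] gen[OF that] by (rule noise_integral_unique)
  have lin: "AE \<omega> in M. pairing u (\<lambda>x. a * \<phi> x + b * \<psi> x) \<omega> = a * pairing u \<phi> \<omega> + b * pairing u \<psi> \<omega>"
    if "\<phi> \<in> test_funs" "\<psi> \<in> test_funs" for \<phi> \<psi> a b
    using *[OF that(1), THEN conjunct1] *[OF that(2), THEN conjunct1]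
  proof eventually_elim
    case (elim \<omega>)
    have "pairing u (\<lambda>x. a * \<phi> x + b * \<psi> x) \<omega> = (LINT t|lborel. a * (u t \<omega> * \<phi> t) + b * (u t \<omega> * \<psi> t))"
      unfolding pairing_def by (intro Bochner_Integration.integral_cong) (auto simp: algebra_simps)
    also have "\<dots> = a * pairing u \<phi> \<omega> + b * pairing u \<psi> \<omega>"
      unfolding pairing_def using elim by (subst Bochner_Integration.integral_add) auto
    finally show ?case .
  qed
  have lin_gen: "AE \<omega> in M. ?V (\<lambda>x. a * \<phi> x + b * \<psi> x) \<omega> = a * ?V \<phi> \<omega> + b * ?V \<psi> \<omega>"
    if "\<phi> \<in> test_funs" "\<psi> \<in> test_funs" for \<phi> \<psi> a b
    using lin[OF that, of a b] eq[OF that(1)] eq[OF that(2)] eq[OF test_funs_linear[OF that], of a b]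
    by eventually_elim simp
  show ?thesis
    unfolding mild_eq_gen_def generalized_process_def gen_solution_well_defined_def
    using AE_locally_integrable * pairing_measurable lin lin_gen gen eq
    by (auto simp: has_noise_integral_def)
qed

end

theorem theorem4p1:
  fixes \<alpha> :: real and S :: "(real ^ 'n::finite) set"
    and M :: "'w measure" and W :: "(real ^ 'n) set \<Rightarrow> 'w \<Rightarrow> real"
    and m :: nat and a :: "'n list \<Rightarrow> real ^ 'n \<Rightarrow> real"
    and T :: "(real ^ 'n \<Rightarrow> real) \<Rightarrow> real" and \<rho> :: "real ^ 'n \<Rightarrow> real"
    and u :: "real ^ 'n \<Rightarrow> 'w \<Rightarrow> real"
  assumes alpha: "0 < \<alpha>" "\<alpha> < 2"
    and S: "S \<in> sets borel"
    and prob: "prob_space M"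
    and noise: "stable_white_noise M \<alpha> S W"
    and coeffs: "\<And>I. length I \<le> m \<Longrightarrow> smooth (a I)"
    and fund: "fundamental_solution m a T"
    and rep: "represents \<rho> T"
    and integ: "\<And>t. (\<lambda>s. \<rho> (t - s)) \<in> L_space \<alpha> S"
    and mild: "mild_solution M \<alpha> S W \<rho> u"
    and joint: "(\<lambda>(t, \<omega>). u t \<omega>) \<in> borel_measurable (borel \<Otimes>\<^sub>M M)"
  shows "(\<alpha> > 1 \<and>
          (\<forall>\<phi>\<in>test_funs.
             (\<integral>\<^sup>+t. ennreal ((LINT s:S|lborel. \<bar>\<rho> (t - s)\<bar> powr \<alpha>) powr (1 / \<alpha>)) \<partial>\<mu> \<phi>) < \<infinity>)
          \<longrightarrow> mild_eq_gen M \<alpha> S W T u) \<and>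
         (\<alpha> = 1 \<and>
          (\<forall>\<phi>\<in>test_funs.
             (\<integral>\<^sup>+t. (\<integral>\<^sup>+s\<in>S. ennreal (\<bar>\<rho> (t - s)\<bar> * log_bracket S \<rho> \<phi> t s) \<partial>lborel) \<partial>\<mu> \<phi>) < \<infinity>)
          \<longrightarrow> mild_eq_gen M \<alpha> S W T u) \<and>
         (\<alpha> < 1 \<and>
          (\<forall>\<phi>\<in>test_funs.
             (\<integral>\<^sup>+s\<in>S. ennreal ((LINT t|\<mu> \<phi>. \<bar>\<rho> (t - s)\<bar>) powr \<alpha>) \<partial>lborel) < \<infinity>)
          \<longrightarrow> mild_eq_gen M \<alpha> S W T u)"
proof -
  interpret prob_space M by (rule prob)
  interpret mild_setting M \<alpha> S W \<rho> u
    using alpha S noise rep integ mild joint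
    by unfold_locales (auto simp: represents_def mild_solution_def)
  have T: "T \<phi> = (LINT x|lborel. \<rho> x * \<phi> x)" if "\<phi> \<in> test_funs" for \<phi>
    using rep that by (auto simp: represents_def)
  show ?thesis
  proof (intro conjI impI, goal_cases)
    case 1
    then show ?case by (intro mild_eq_genI[OF T fubini_gt1]) auto
  next
    case 2
    then show ?case by (intro mild_eq_genI[OF T fubini_eq1]) auto
  next
    case 3
    then show ?case by (intro mild_eq_genI[OF T fubini_lt1]) auto
  qed
qed

end
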